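(* Let $d>0$, let $\Omega$ be the open ball of $\mathbb{R}^n$ of radius $d/2$ centered at $0$, and let $r\in[0,d]$. Assume $f,g\in L^2_r(\Omega)$, $f\ge0$ and $g\ge 0$ a.e. in $\Omega$, $a\in W^{1,\infty}(\mathbb{R})$ and $\inf_{\mathbb{R}}a>0$. Suppose there exist an odd integer $n_1\geq 1$ and $n_1+1$ nonnegative real numbers $m_0,\dots,m_{n_1}$ with $m_0=0$ and $m_i<m_{i+1}$ for all $i\in\{0,\dots,n_1-1\}$, such that $$a(m_i)=\max_{[m_i,m_{i+1}]}a,\qquad a(m_{i+1})=\min_{[m_i,m_{i+1}]}a\qquad\text{for all } i\in\{0,2,\dots,n_1-3,n_1-1\},$$ and $$I_r\subset\bigcap_{i\in\{0,2,\dots,n_1-3,n_1-1\}}[\,m_ia(m_i),\,m_{i+1}a(m_{i+1})\,].$$ Then the problem $$(P_r)\qquad -\mathrm{div}(a(l_r(u))\nabla u)=f\ \text{ in }\Omega,\qquad u\in H^1_0(\Omega),$$ admits at least $\frac{n_1+1}{2}$ radial solutions $\{u_i\}_{i\in\{0,2,\dots,n_1-1\}}$, such that $$m_i\le l_r(u_i)\le m_{i+1}\quad\text{a.e. in }\Omega,\qquad\text{for all } i\in\{0,2,\dots,n_1-3,n_1-1\}.$$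
   Context: $L^2_r(\Omega)$ denotes the set of radial functions $u\in L^2(\Omega)$, i.e. those for which there is $\tilde u\in L^2(]0,d/2[)$ with $u(x)=\tilde u(\|x\|)$ (the subscript here stands for "radial" and is unrelated to the number $r$). For $v\in L^2(\Omega)$, $l_r(v)(x)=\int_{\Omega\cap B(x,r)}g(y)v(y)\,dy$, where $B(x,r)$ is the closed ball of center $x$ and radius $r$. Solutions of $(P_r)$ are understood in the weak sense. Let $\phi\in H^1_0(\Omega)$ be the weak solution of $-\Delta\phi=f$ in $\Omega$; then $I_r:=[\inf_\Omega l_r(\phi),\ \sup_\Omega l_r(\phi)]$. *)

theory Defs
  imports "HOL-Analysis.Analysis"
begin

(* Elements of Lebesgue and Sobolev spaces are represented by functions on the whole space,
   of which only the values on the open set \<Omega> matter; equality in such a space is equality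
   almost everywhere with respect to lebesgue_on \<Omega>. *)

definition L2 :: "'a::euclidean_space set \<Rightarrow> ('a \<Rightarrow> 'b::euclidean_space) set" where
  "L2 \<Omega> = {u. u \<in> borel_measurable (lebesgue_on \<Omega>) \<and>
              integrable (lebesgue_on \<Omega>) (\<lambda>x. (norm (u x))\<^sup>2)}"

definition Linfty :: "'a::euclidean_space set \<Rightarrow> ('a \<Rightarrow> 'b::euclidean_space) set" where
  "Linfty \<Omega> = {u. u \<in> borel_measurable (lebesgue_on \<Omega>) \<and>
                  (\<exists>C. AE x in lebesgue_on \<Omega>. norm (u x) \<le> C)}"

definition locally_integrable ::
    "'a::euclidean_space set \<Rightarrow> ('a \<Rightarrow> 'b::euclidean_space) \<Rightarrow> bool" where
  "locally_integrable \<Omega> u \<longleftrightarrow> (\<forall>K. compact K \<and> K \<subseteq> \<Omega> \<longrightarrow> integrable (lebesgue_on K) u)"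

definition gradient :: "('a::euclidean_space \<Rightarrow> real) \<Rightarrow> 'a \<Rightarrow> 'a" where
  "gradient \<psi> x = (\<Sum>b\<in>Basis. frechet_derivative \<psi> (at x) b *\<^sub>R b)"

primrec Ck :: "nat \<Rightarrow> ('a::euclidean_space \<Rightarrow> real) \<Rightarrow> bool" where
  "Ck 0 \<psi> \<longleftrightarrow> continuous_on UNIV \<psi>"
| "Ck (Suc k) \<psi> \<longleftrightarrow> \<psi> differentiable_on UNIV \<and>
     (\<forall>b\<in>Basis. Ck k (\<lambda>x. frechet_derivative \<psi> (at x) b))"

(* The space of smooth functions with compact support in \<Omega>, extended by zero. *)
definition test_functions :: "'a::euclidean_space set \<Rightarrow> ('a \<Rightarrow> real) set" where
  "test_functions \<Omega> = {\<psi>. (\<forall>k. Ck k \<psi>) \<and>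
     compact (closure {x. \<psi> x \<noteq> 0}) \<and> closure {x. \<psi> x \<noteq> 0} \<subseteq> \<Omega>}"

definition has_weak_gradient ::
    "'a::euclidean_space set \<Rightarrow> ('a \<Rightarrow> real) \<Rightarrow> ('a \<Rightarrow> 'a) \<Rightarrow> bool" where
  "has_weak_gradient \<Omega> u G \<longleftrightarrow> locally_integrable \<Omega> u \<and> locally_integrable \<Omega> G \<and>
     (\<forall>\<psi>\<in>test_functions \<Omega>. \<forall>b\<in>Basis.
        (LINT x|lebesgue_on \<Omega>. u x * (gradient \<psi> x \<bullet> b)) =
        - (LINT x|lebesgue_on \<Omega>. (G x \<bullet> b) * \<psi> x))"

(* Membership is invariant under changes on null sets: where pointwise values of a function in
   W1infty UNIV are used, continuity is required separately to fix the Lipschitz representative. *)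
definition W1infty :: "'a::euclidean_space set \<Rightarrow> ('a \<Rightarrow> real) set" where
  "W1infty \<Omega> = {u. u \<in> Linfty \<Omega> \<and> (\<exists>G. has_weak_gradient \<Omega> u G \<and> G \<in> Linfty \<Omega>)}"

(* The closure of the test functions in the norm of the Sobolev space H^1. *)
definition H10 :: "'a::euclidean_space set \<Rightarrow> ('a \<Rightarrow> real) set" where
  "H10 \<Omega> = {u. u \<in> L2 \<Omega> \<and> (\<exists>G. has_weak_gradient \<Omega> u G \<and> G \<in> L2 \<Omega> \<and>
     (\<exists>\<psi> :: nat \<Rightarrow> 'a \<Rightarrow> real. (\<forall>k. \<psi> k \<in> test_functions \<Omega>) \<and>
        (\<lambda>k. (LINT x|lebesgue_on \<Omega>. (u x - \<psi> k x)\<^sup>2) +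
             (LINT x|lebesgue_on \<Omega>. (norm (G x - gradient (\<psi> k) x))\<^sup>2)) \<longlonglongrightarrow> 0))}"

(* Weak solutions of -div (A grad u) = f in \<Omega>, u = 0 on the boundary.  Weak gradients are
   unique up to null sets, so the choice of Gu and Gv is immaterial. *)
definition weak_solution ::
    "'a::euclidean_space set \<Rightarrow> ('a \<Rightarrow> real) \<Rightarrow> ('a \<Rightarrow> real) \<Rightarrow> ('a \<Rightarrow> real) \<Rightarrow> bool" where
  "weak_solution \<Omega> A f u \<longleftrightarrow> u \<in> H10 \<Omega> \<and>
     (\<exists>Gu. has_weak_gradient \<Omega> u Gu \<and>
        (\<forall>v\<in>H10 \<Omega>. \<forall>Gv. has_weak_gradient \<Omega> v Gv \<longrightarrow>
           (LINT x|lebesgue_on \<Omega>. A x * (Gu x \<bullet> Gv x)) =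
           (LINT x|lebesgue_on \<Omega>. f x * v x)))"

(* Radial functions on the ball of radius R.  The profile w is required to be square integrable
   on ]0,R[ for the unweighted Lebesgue measure, not for the measure t^(n-1) dt. *)
definition L2_radial :: "real \<Rightarrow> ('a::euclidean_space \<Rightarrow> real) set" where
  "L2_radial R = {u. u \<in> L2 (ball 0 R) \<and>
     (\<exists>w :: real \<Rightarrow> real. w \<in> L2 {0<..<R} \<and> (AE x in lebesgue_on (ball 0 R). u x = w (norm x)))}"

definition nonlocal ::
    "'a::euclidean_space set \<Rightarrow> ('a \<Rightarrow> real) \<Rightarrow> real \<Rightarrow> ('a \<Rightarrow> real) \<Rightarrow> 'a \<Rightarrow> real" where
  "nonlocal \<Omega> g r v x = (LINT y|lebesgue_on (\<Omega> \<inter> cball x r). g y * v y)"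

definition nonlocal_range ::
    "'a::euclidean_space set \<Rightarrow> ('a \<Rightarrow> real) \<Rightarrow> real \<Rightarrow> ('a \<Rightarrow> real) \<Rightarrow> real set" where
  "nonlocal_range \<Omega> g r \<phi> = {(INF x\<in>\<Omega>. nonlocal \<Omega> g r \<phi> x)..(SUP x\<in>\<Omega>. nonlocal \<Omega> g r \<phi> x)}"

end

theory Submission
  imports Defs "HOL-Complex_Analysis.Great_Picard"
begin

text \<open>
  For radial \<open>f\<close> with profile \<open>F\<close>, the field \<open>(P(\<parallel>x\<parallel>) / \<parallel>x\<parallel>) x\<close> with
  \<open>P(t) = t\<^sup>1\<^sup>-\<^sup>n \<integral>\<^sub>0\<^sup>t s\<^sup>n\<^sup>-\<^sup>1 F(s) ds\<close> has divergence \<open>f\<close>, and \<open>P\<close> is continuous with \<open>P(0) = 0\<close> because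
  \<open>F\<close> is integrable for the unweighted measure. Hence for a continuous positive radial coefficient
  \<open>\<alpha>\<close> the weak solution is explicit: \<open>u(x) = \<integral> P / \<alpha>\<close> over \<open>[\<parallel>x\<parallel>, d/2]\<close>. The nonlocal problem becomes a fixed point
  problem for the profile of \<open>u\<close>, with equi-Lipschitz images, to which Schauder's argument applies
  once the argument of \<open>a\<close> is clipped to \<open>[m\<^sub>i, m\<^sub>i\<^sub>+\<^sub>1]\<close>. Since \<open>a(m\<^sub>i\<^sub>+\<^sub>1) \<le> \<alpha> \<le> a(m\<^sub>i)\<close> on that
  interval, \<open>\<phi> / a(m\<^sub>i) \<le> u \<le> \<phi> / a(m\<^sub>i\<^sub>+\<^sub>1)\<close>, and the hypothesis on the range of \<open>l\<^sub>r(\<phi>)\<close> shows that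
  \<open>l\<^sub>r(u)\<close> lies in \<open>[m\<^sub>i, m\<^sub>i\<^sub>+\<^sub>1]\<close>, so the clipping was inactive.
\<close>

section \<open>Smooth functions and test functions\<close>

text \<open>The radial problem is solved by quadrature: the flux does not depend on the coefficient,
  which enters only as a divisor. Comparing solutions is therefore comparing integrands, and
  compactness concerns profiles of one variable. Three obstacles shape the rest. First,
  \<open>\<phi>\<close> is an arbitrary weak solution and has to be identified almost everywhere
  with the explicit one; this takes uniqueness of weak gradients and a Poincare inequality.
  Secondly, membership in \<open>H10\<close> means approximation by test functions, while the
  explicit profile is merely continuously differentiable and its slope divided by the radius may be
  unbounded at the centre; even powers of the norm are used throughout because they are polynomials
  in x. Thirdly, the divergence of the flux field is a direct computation only for even polynomial
  densities; three limits, each with one fixed integrable majorant, carry it to integrable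
  densities. Solutions for different indices differ because two intervals with even index are
  separated by a gap, the \<open>m i\<close> being strictly increasing.\<close>

lemma CkI:
  assumes "\<And>x. (\<psi> has_derivative D x) (at x)" and "\<And>b. b \<in> Basis \<Longrightarrow> Ck k (\<lambda>x. D x b)"
  shows "Ck (Suc k) \<psi>"
proof -
  have "frechet_derivative \<psi> (at x) = D x" for x
    using frechet_derivative_at[OF assms(1)] by simp
  then show ?thesis
    using assms by (auto simp: differentiable_on_def differentiable_def intro: has_derivative_at_withinI)
qed

lemma Ck_Suc_has_derivative:
  assumes "Ck (Suc k) \<psi>"
  shows "(\<psi> has_derivative frechet_derivative \<psi> (at x)) (at x)"
  using assms by (auto simp: differentiable_on_def frechet_derivative_works)

lemma Ck_imp_continuous: "Ck k \<psi> \<Longrightarrow> continuous_on UNIV \<psi>"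
  by (cases k) (auto simp: differentiable_imp_continuous_on)

lemma Ck_SucD: "Ck (Suc k) \<psi> \<Longrightarrow> Ck k \<psi>"
proof (induction k arbitrary: \<psi>)
  case 0
  then show ?case by (simp add: differentiable_imp_continuous_on)
next
  case (Suc k)
  then show ?case by (metis Ck.simps(2))
qed

lemma Ck_const: "Ck k (\<lambda>x. c)"
proof (induction k arbitrary: c)
  case (Suc k)
  show ?case by (rule CkI[where D="\<lambda>x v. 0"]) (use Suc in auto)
qed simp

lemma Ck_bounded_linear: "bounded_linear h \<Longrightarrow> Ck k h"
proof (cases k)
  case 0
  assume "bounded_linear h"
  then show ?thesis using 0 by (simp add: linear_continuous_on)
next
  case (Suc j)
  assume "bounded_linear h"
  then show ?thesis unfolding Suc
    by (intro CkI[where D="\<lambda>x. h"]) (auto intro: bounded_linear_imp_has_derivative Ck_const)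
qed

lemma Ck_add: "Ck k f \<Longrightarrow> Ck k g \<Longrightarrow> Ck k (\<lambda>x. f x + g x)"
proof (induction k arbitrary: f g)
  case 0
  then show ?case by (simp add: continuous_on_add)
next
  case (Suc k)
  show ?case
    by (rule CkI[where D="\<lambda>x v. frechet_derivative f (at x) v + frechet_derivative g (at x) v"])
      (use Suc in \<open>auto intro!: has_derivative_add Ck_Suc_has_derivative[of k] simp del: Ck.simps\<close>, simp)
qed

lemma Ck_mult: "Ck k f \<Longrightarrow> Ck k g \<Longrightarrow> Ck k (\<lambda>x. f x * g x)"
proof (induction k arbitrary: f g)
  case 0
  then show ?case by (simp add: continuous_on_mult)
next
  case (Suc k)
  show ?case
  proof (rule CkI[where D="\<lambda>x v. f x * frechet_derivative g (at x) v + frechet_derivative f (at x) v * g x"])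
    show "((\<lambda>x. f x * g x) has_derivative
        (\<lambda>v. f x * frechet_derivative g (at x) v + frechet_derivative f (at x) v * g x)) (at x)" for x
      using Suc.prems by (intro has_derivative_mult Ck_Suc_has_derivative[of k])
    show "Ck k (\<lambda>x. f x * frechet_derivative g (at x) b + frechet_derivative f (at x) b * g x)"
      if "b \<in> Basis" for b
    proof (intro Ck_add Suc.IH)
      show "Ck k f" "Ck k g" using Suc.prems Ck_SucD by blast+
      show "Ck k (\<lambda>x. frechet_derivative g (at x) b)" "Ck k (\<lambda>x. frechet_derivative f (at x) b)"
        using Suc.prems that by simp_all
    qed
  qed
qed

lemma Ck_real_polynomial_function: "real_polynomial_function p \<Longrightarrow> Ck k p"
  by (induction rule: real_polynomial_function.induct)
    (auto intro: Ck_bounded_linear Ck_const Ck_add Ck_mult)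

text \<open>Indexing all derivatives of the outer function by \<open>j\<close> lets the induction
  hypothesis apply to \<open>h (Suc j)\<close>, which is what the chain rule produces.\<close>

lemma Ck_compose:
  fixes h :: "nat \<Rightarrow> real \<Rightarrow> real"
  assumes h: "\<And>j x. (h j has_real_derivative h (Suc j) x) (at x)" and s: "\<And>k. Ck k s"
  shows "Ck k (\<lambda>x. h j (s x))"
proof (induction k arbitrary: j)
  case 0
  have "continuous_on UNIV (h j)"
    by (meson h DERIV_isCont continuous_at_imp_continuous_on)
  then have "continuous_on UNIV (h j \<circ> s)"
    by (rule continuous_on_compose[OF Ck_imp_continuous[OF s] continuous_on_subset]) simp
  then show ?case by (simp add: comp_def)
next
  case (Suc k)
  show ?case
  proof (rule CkI[where D="\<lambda>x v. frechet_derivative s (at x) v * h (Suc j) (s x)"])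
    show "((\<lambda>x. h j (s x)) has_derivative (\<lambda>v. frechet_derivative s (at x) v * h (Suc j) (s x))) (at x)" for x
      by (rule DERIV_compose_FDERIV[OF h Ck_Suc_has_derivative[OF s[of "Suc 0"]]])
    show "Ck k (\<lambda>x. frechet_derivative s (at x) b * h (Suc j) (s x))" if "b \<in> Basis" for b
      using s[of "Suc k"] that by (intro Ck_mult Suc.IH) simp
  qed
qed

section \<open>Gradients of differentiable functions\<close>

lemma gradient_inner:
  assumes "Ck (Suc k) \<psi>"
  shows "gradient \<psi> x \<bullet> v = frechet_derivative \<psi> (at x) v"
proof -
  interpret linear "frechet_derivative \<psi> (at x)"
    using Ck_Suc_has_derivative[OF assms] by (rule has_derivative_linear)
  have "frechet_derivative \<psi> (at x) v = frechet_derivative \<psi> (at x) (\<Sum>b\<in>Basis. (v \<bullet> b) *\<^sub>R b)"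
    by (simp add: euclidean_representation)
  also have "\<dots> = gradient \<psi> x \<bullet> v"
    unfolding gradient_def inner_sum_left by (simp add: sum scale inner_commute mult.commute)
  finally show ?thesis by simp
qed

lemma gradient_eqI:
  assumes "(\<psi> has_derivative (\<lambda>v. w \<bullet> v)) (at x)"
  shows "gradient \<psi> x = w"
proof -
  have "frechet_derivative \<psi> (at x) = (\<lambda>v. w \<bullet> v)"
    using frechet_derivative_at[OF assms] by simp
  then show ?thesis
    unfolding gradient_def by (simp add: euclidean_representation)
qed

lemma has_derivative_gradient:
  assumes "Ck (Suc k) \<psi>"
  shows "(\<psi> has_derivative (\<lambda>v. gradient \<psi> x \<bullet> v)) (at x)"
  using Ck_Suc_has_derivative[OF assms, of x] gradient_inner[OF assms, of x] by (simp add: fun_eq_iff[symmetric])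

lemma continuous_on_gradient:
  assumes "Ck (Suc k) \<psi>"
  shows "continuous_on UNIV (gradient \<psi>)"
proof -
  have "continuous_on UNIV (\<lambda>x. frechet_derivative \<psi> (at x) b)" if "b \<in> Basis" for b
    using assms that by (auto intro: Ck_imp_continuous)
  then show ?thesis
    unfolding gradient_def[abs_def] by (intro continuous_intros) auto
qed

section \<open>Smooth cut-off profiles built from exp(-1/s)\<close>

text \<open>With y = 1/s the positive branch is p(y) exp(-y). The polynomial parameter keeps the
  family closed under differentiation; \<open>flat_exp 1\<close> is the usual smooth function that
  vanishes to infinite order at 0.\<close>

definition flat_exp :: "real poly \<Rightarrow> real \<Rightarrow> real" where
  "flat_exp p s = (if s \<le> 0 then 0 else poly p (1 / s) * exp (- (1 / s)))"

lemma poly_div_exp_tendsto_0: "((\<lambda>x::real. poly p x * exp (- x)) \<longlongrightarrow> 0) at_top"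
proof -
  have "((\<lambda>x::real. \<Sum>i\<le>degree p. coeff p i * (x ^ i / exp x)) \<longlongrightarrow> (\<Sum>i\<le>degree p. coeff p i * 0)) at_top"
    by (intro tendsto_intros tendsto_power_div_exp_0)
  then show ?thesis
    by (simp add: poly_altdef sum_distrib_right exp_minus divide_inverse mult.assoc)
qed

lemma flat_exp_tendsto_0: "(flat_exp p \<longlongrightarrow> 0) (at 0)"
proof (rule filterlim_split_at)
  have "eventually (\<lambda>s. flat_exp p s = 0) (at_left 0)"
    unfolding flat_exp_def eventually_at_filter by (rule always_eventually) auto
  then show "(flat_exp p \<longlongrightarrow> 0) (at_left 0)"
    by (simp add: tendsto_eventually)
  have "filterlim (\<lambda>s::real. 1 / s) at_top (at_right 0)"
    using filterlim_inverse_at_top_right by (simp add: inverse_eq_divide)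
  from filterlim_compose[OF poly_div_exp_tendsto_0[of p] this]
  have "((\<lambda>s. poly p (1 / s) * exp (- (1 / s))) \<longlongrightarrow> 0) (at_right 0)" .
  moreover have "eventually (\<lambda>s. poly p (1 / s) * exp (- (1 / s)) = flat_exp p s) (at_right 0)"
    unfolding flat_exp_def eventually_at_filter by (rule always_eventually) auto
  ultimately show "(flat_exp p \<longlongrightarrow> 0) (at_right 0)"
    by (rule Lim_transform_eventually)
qed

lemma flat_exp_has_derivative:
  "(flat_exp p has_real_derivative flat_exp ([:0, 0, 1:] * (p - pderiv p)) s) (at s)"
proof -
  consider "s < 0" | "s = 0" | "s > 0" by linarith
  then show ?thesis
  proof cases
    case 1
    have "((\<lambda>s. 0) has_real_derivative 0) (at s)" by simp
    then have "(flat_exp p has_real_derivative 0) (at s)"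
      by (rule DERIV_cong_ev[OF refl _ refl, THEN iffD1, rotated])
        (use 1 in \<open>auto simp: flat_exp_def eventually_nhds intro!: exI[of _ "{..<0}"]\<close>)
    then show ?thesis using 1 by (simp add: flat_exp_def)
  next
    case 2
    have "(flat_exp ([:0, 1:] * p) \<longlongrightarrow> 0) (at 0)" by (rule flat_exp_tendsto_0)
    \<comment> \<open>Dividing by \<open>h\<close> multiplies the polynomial by its variable, so the
      difference quotient at 0 stays in the family. At h = 0 both sides are 0, the right one by
      division by zero.\<close>
    moreover have "flat_exp ([:0, 1:] * p) = (\<lambda>h. (flat_exp p (0 + h) - flat_exp p 0) / h)"
      by (simp add: flat_exp_def fun_eq_iff)
    ultimately have "((\<lambda>h. (flat_exp p (0 + h) - flat_exp p 0) / h) \<longlongrightarrow> 0) (at 0)" by (simp only:)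
    moreover have "flat_exp q 0 = 0" for q by (simp add: flat_exp_def)
    ultimately show ?thesis by (simp only: 2 DERIV_def)
  next
    case 3
    have "((\<lambda>s. poly p (1 / s) * exp (- (1 / s))) has_real_derivative
        flat_exp ([:0, 0, 1:] * (p - pderiv p)) s) (at s)"
      using 3 by (auto intro!: derivative_eq_intros simp: flat_exp_def field_simps power2_eq_square)
    then show ?thesis
      by (rule DERIV_cong_ev[OF refl _ refl, THEN iffD1, rotated])
        (use 3 in \<open>auto simp: flat_exp_def eventually_nhds intro!: exI[of _ "{0<..}"]\<close>)
  qed
qed

lemma Ck_flat_exp:
  assumes "\<And>k. Ck k s"
  shows "Ck k (\<lambda>x. flat_exp p (s x))"
proof -
  \<comment> \<open>\<open>T\<close> is the operator on polynomials induced by differentiation; its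
    iterates list all derivatives in the form that \<open>Ck_compose\<close> expects.\<close>
  define T where "T q = [:0, 0, 1:] * (q - pderiv q)" for q :: "real poly"
  define h where "h j = flat_exp ((T ^^ j) p)" for j
  have "(h j has_real_derivative h (Suc j) x) (at x)" for j x
    unfolding h_def using flat_exp_has_derivative[of "(T ^^ j) p" x] by (simp only: funpow.simps comp_def T_def)
  from Ck_compose[of h, OF this assms, of k 0] show ?thesis
    by (simp only: h_def funpow.simps id_apply)
qed

section \<open>Compactly supported smooth functions\<close>

lemma test_functionsI:
  assumes "\<And>k. Ck k \<psi>" and "compact K" and "K \<subseteq> \<Omega>" and "\<And>x. x \<notin> K \<Longrightarrow> \<psi> x = 0"
  shows "\<psi> \<in> test_functions \<Omega>"
proof -
  have "closure {x. \<psi> x \<noteq> 0} \<subseteq> K"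
    using assms by (intro closure_minimal compact_imp_closed) auto
  moreover have "bounded {x. \<psi> x \<noteq> 0}"
    using assms by (intro bounded_subset[OF compact_imp_bounded[of K]]) auto
  ultimately show ?thesis
    unfolding test_functions_def mem_Collect_eq compact_closure
    using assms(1) order_trans[OF _ assms(3)] by blast
qed

lemma test_functionsE:
  assumes "\<psi> \<in> test_functions \<Omega>"
  obtains K where "compact K" and "K \<subseteq> \<Omega>" and "\<forall>x. x \<notin> K \<longrightarrow> \<psi> x = 0"
proof -
  have *: "(\<forall>k. Ck k \<psi>) \<and> compact (closure {x. \<psi> x \<noteq> 0}) \<and> closure {x. \<psi> x \<noteq> 0} \<subseteq> \<Omega>"
    using assms unfolding test_functions_def mem_Collect_eq .
  have out: "\<forall>x. x \<notin> closure {x. \<psi> x \<noteq> 0} \<longrightarrow> \<psi> x = 0"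
    using closure_subset[of "{x. \<psi> x \<noteq> 0}"] by blast
  show ?thesis
    by (rule that[OF conjunct1[OF conjunct2[OF *]] conjunct2[OF conjunct2[OF *]] out])
qed

lemma test_functions_Ck: "\<psi> \<in> test_functions \<Omega> \<Longrightarrow> Ck k \<psi>"
  unfolding test_functions_def mem_Collect_eq by (elim conjE allE)

lemma gradient_eq_0_outside:
  assumes "closed K" and "\<And>x. x \<notin> K \<Longrightarrow> \<psi> x = 0" and "x \<notin> K"
  shows "gradient \<psi> x = 0"
proof (rule gradient_eqI)
  have "((\<lambda>x. 0) has_derivative (\<lambda>v. 0)) (at x)" by simp
  then have "(\<psi> has_derivative (\<lambda>v. 0)) (at x)"
    by (rule has_derivative_transform_within_open[of _ _ _ UNIV "- K"]) (use assms in auto)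
  then show "(\<psi> has_derivative (\<lambda>v. 0 \<bullet> v)) (at x)" by simp
qed

lemma test_functions_mult:
  assumes "\<psi> \<in> test_functions \<Omega>" and "\<And>k. Ck k p"
  shows "(\<lambda>x. p x * \<psi> x) \<in> test_functions \<Omega>"
proof -
  obtain K where K_: "compact K" "K \<subseteq> \<Omega>" "\<forall>x. x \<notin> K \<longrightarrow> \<psi> x = 0"
    by (rule test_functionsE[OF assms(1)])
    note K = K_(1,2) K_(3)[rule_format]
  show ?thesis
    by (rule test_functionsI[OF Ck_mult[OF assms(2) test_functions_Ck[OF assms(1)]] K(1,2)])
      (simp add: K(3))
qed

lemma continuous_compact_support_integrable:
  fixes h :: "'a::euclidean_space \<Rightarrow> 'b::euclidean_space"
  assumes "continuous_on UNIV h" and "compact K" and "\<And>x. x \<notin> K \<Longrightarrow> h x = 0"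
  shows "integrable lborel h"
proof -
  have "integrable lborel (\<lambda>x. indicator K x *\<^sub>R h x)"
    by (rule borel_integrable_compact[OF assms(2) continuous_on_subset[OF assms(1)]]) simp
  moreover have "indicator K x *\<^sub>R h x = h x" for x
    using assms(3) by (auto simp: indicator_def)
  ultimately show ?thesis by simp
qed

text \<open>The difference quotients of \<open>\<psi>\<close> have vanishing integral by translation invariance.\<close>
lemma integral_partial_derivative_eq_0:
  fixes \<psi> :: "'a::euclidean_space \<Rightarrow> real"
  assumes ck: "Ck (Suc 0) \<psi>" and K: "compact K" and out: "\<And>x. x \<notin> K \<Longrightarrow> \<psi> x = 0"
  shows "(LINT x|lborel. gradient \<psi> x \<bullet> b) = 0"
proof -
  define D where "D x = gradient \<psi> x \<bullet> b" for x
  have contD: "continuous_on UNIV D" and cont: "continuous_on UNIV \<psi>"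
    unfolding D_def using continuous_on_gradient[OF ck] Ck_imp_continuous[OF ck]
    by (auto intro: continuous_intros)
  have D_out: "D x = 0" if "x \<notin> K" for x
    using gradient_eq_0_outside[OF compact_imp_closed[OF K] out that] by (simp add: D_def)
  have "bounded (D ` K)"
    by (rule compact_imp_bounded[OF compact_continuous_image[OF continuous_on_subset[OF contD] K]]) simp
  then obtain C0 where C0: "\<And>x. x \<in> K \<Longrightarrow> \<bar>D x\<bar> \<le> C0"
    unfolding bounded_iff by auto
  define C where "C = max 0 C0"
  have C: "\<bar>D x\<bar> \<le> C" for x
    using C0[of x] D_out[of x] by (cases "x \<in> K") (auto simp: C_def)
  obtain B where B: "\<And>x. x \<in> K \<Longrightarrow> norm x \<le> B"
    using compact_imp_bounded[OF K] unfolding bounded_iff by blast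
  define q where "q k x = (\<psi> (inverse (real (Suc k)) *\<^sub>R b + x) - \<psi> x) * real (Suc k)" for k x
  have line: "((\<lambda>t. \<psi> (t *\<^sub>R b + x)) has_real_derivative D (t *\<^sub>R b + x)) (at t)" for t x
  proof -
    have "((\<lambda>t. \<psi> (t *\<^sub>R b + x)) has_derivative (\<lambda>h. gradient \<psi> (t *\<^sub>R b + x) \<bullet> (h *\<^sub>R b))) (at t)"
      by (rule has_derivative_compose[OF _ has_derivative_gradient[OF ck]])
        (auto intro!: derivative_eq_intros)
    then show ?thesis
      unfolding has_field_derivative_def by (rule has_derivative_eq_rhs) (auto simp: D_def)
  qed
  have q_bound: "\<bar>q k x\<bar> \<le> C" for k x
  proof -
    define e where "e = inverse (real (Suc k))"
    have e: "e > 0" by (simp add: e_def)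
    obtain z where "\<psi> (e *\<^sub>R b + x) - \<psi> (0 *\<^sub>R b + x) = (e - 0) * D (z *\<^sub>R b + x)"
      using MVT2[OF e, of "\<lambda>t. \<psi> (t *\<^sub>R b + x)" "\<lambda>t. D (t *\<^sub>R b + x)"] line by blast
    then have "q k x = D (z *\<^sub>R b + x)"
      unfolding q_def e_def[symmetric] using e by (simp add: e_def)
    then show ?thesis using C by simp
  qed
  \<comment> \<open>The steps have length at most that of \<open>b\<close>, so all quotients vanish
    off one fixed ball; \<open>C\<close> times its indicator then dominates the whole
    sequence.\<close>
  have q_out: "q k x = 0" if "norm x > B + norm b" for k x
  proof -
    define e where "e = inverse (real (Suc k))"
    have "norm (e *\<^sub>R b) \<le> norm b"
      by (simp add: e_def field_simps mult_left_le)
    then have "norm (e *\<^sub>R b + x) > B"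
      using that norm_triangle_ineq2[of x "- (e *\<^sub>R b)"] by (simp add: add.commute)
    then have "\<psi> (e *\<^sub>R b + x) = 0" using B out by force
    moreover have "norm x > B" using that norm_ge_zero[of b] by linarith
    then have "\<psi> x = 0" using B out by force
    ultimately show ?thesis by (simp add: q_def e_def)
  qed
  have lim: "(\<lambda>k. q k x) \<longlonglongrightarrow> D x" for x
  proof -
    have "((\<lambda>h. (\<psi> (h *\<^sub>R b + x) - \<psi> x) / h) \<longlongrightarrow> D x) (at 0)"
      using line[of x 0] by (simp add: DERIV_def)
    moreover have "filterlim (\<lambda>k. inverse (real (Suc k))) (at 0) sequentially"
      unfolding filterlim_at using LIMSEQ_inverse_real_of_nat by auto
    ultimately have "(\<lambda>k. (\<psi> (inverse (real (Suc k)) *\<^sub>R b + x) - \<psi> x) / inverse (real (Suc k))) \<longlonglongrightarrow> D x"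
      by (rule filterlim_compose)
    then show ?thesis by (simp add: q_def[abs_def] divide_inverse)
  qed
  have meas: "\<psi> \<in> borel_measurable borel" "D \<in> borel_measurable borel"
    using cont contD by (auto intro: borel_measurable_continuous_onI)
  have "(\<lambda>k. LINT x|lborel. q k x) \<longlonglongrightarrow> (LINT x|lborel. D x)"
  proof (rule integral_dominated_convergence[where w="\<lambda>x. C * indicator (cball 0 (B + norm b)) x"])
    show "D \<in> borel_measurable lborel" using meas by simp
    show "q k \<in> borel_measurable lborel" for k
      unfolding q_def[abs_def] using meas by measurable
    show "integrable lborel (\<lambda>x. C * indicator (cball 0 (B + norm b)) x)"
      by (intro integrable_mult_right integrable_real_indicator emeasure_lborel_cball_finite) auto
    show "AE x in lborel. norm (q k x) \<le> C * indicator (cball 0 (B + norm b)) x" for k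
      using q_bound q_out[of _ k] by (auto simp: indicator_def)
  qed (use lim in auto)
  moreover have "(LINT x|lborel. q k x) = 0" for k
  proof -
    define c where "c = inverse (real (Suc k)) *\<^sub>R b"
    have int: "integrable lborel \<psi>" by (rule continuous_compact_support_integrable[OF cont K out])
    have int': "integrable lborel (\<lambda>x. \<psi> (c + x))"
      using int integrable_distr[of "(+) c" lborel borel \<psi>] by (simp add: lborel_distr_plus)
    have "(LINT x|lborel. \<psi> (c + x)) = (LINT x|distr lborel borel ((+) c). \<psi> x)"
      by (rule integral_distr[symmetric]) (use meas in auto)
    then have "(LINT x|lborel. \<psi> (c + x)) = (LINT x|lborel. \<psi> x)"
      by (simp add: lborel_distr_plus)
    then have "(LINT x|lborel. \<psi> (c + x) - \<psi> x) = 0"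
      by (simp only: Bochner_Integration.integral_diff[OF int' int] diff_self)
    then show ?thesis
      unfolding q_def c_def[symmetric] by (simp only: integral_mult_left_zero mult_zero_left)
  qed
  ultimately have "(\<lambda>k. 0) \<longlonglongrightarrow> (LINT x|lborel. D x)" by (simp only:)
  then show ?thesis
    unfolding D_def by (simp only: LIMSEQ_const_iff)
qed

section \<open>Square integrable functions\<close>

lemma AE_lebesgue_on_iff:
  "S \<in> sets lebesgue \<Longrightarrow> (AE x in lebesgue_on S. P x) \<longleftrightarrow> (AE x in lebesgue. x \<in> S \<longrightarrow> P x)"
  by (rule AE_restrict_space_iff) auto

text \<open>Lebesgue measure is complete, so a change on a null set cannot destroy measurability;
  extension by zero carries this over to a subset.\<close>

lemma borel_measurable_lebesgue_on_AE:
  fixes f :: "'a::euclidean_space \<Rightarrow> 'b::euclidean_space"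
  assumes S: "S \<in> sets lebesgue" and f: "f \<in> borel_measurable (lebesgue_on S)"
    and ae: "AE x in lebesgue_on S. f x = g x"
  shows "g \<in> borel_measurable (lebesgue_on S)"
proof -
  have "(\<lambda>x. if x \<in> S then f x else 0) \<in> borel_measurable lebesgue"
    using f S by (simp add: borel_measurable_if)
  moreover have "AE x in lebesgue. (if x \<in> S then f x else 0) = (if x \<in> S then g x else 0)"
    using ae unfolding AE_lebesgue_on_iff[OF S] by eventually_elim simp
  ultimately have "(\<lambda>x. if x \<in> S then g x else 0) \<in> borel_measurable lebesgue"
    by (rule borel_measurable_AE)
  then show ?thesis using S by (simp add: borel_measurable_if)
qed

lemma integral_lebesgue_on_cong_AE:
  fixes f :: "'a::euclidean_space \<Rightarrow> 'b::euclidean_space"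
  assumes "S \<in> sets lebesgue" and "f \<in> borel_measurable (lebesgue_on S)"
    and "AE x in lebesgue_on S. f x = g x"
  shows "integral\<^sup>L (lebesgue_on S) f = integral\<^sup>L (lebesgue_on S) g"
  using assms borel_measurable_lebesgue_on_AE[OF assms] by (intro integral_cong_AE)

lemma integral_lebesgue_on_subset:
  fixes f :: "'a::euclidean_space \<Rightarrow> 'b::euclidean_space"
  assumes "S \<subseteq> T" "S \<in> sets lebesgue" "T \<in> sets lebesgue" and "\<And>x. x \<in> T - S \<Longrightarrow> f x = 0"
  shows "integral\<^sup>L (lebesgue_on T) f = integral\<^sup>L (lebesgue_on S) f"
proof -
  have "(\<lambda>x. indicat_real T x *\<^sub>R f x) = (\<lambda>x. indicat_real S x *\<^sub>R f x)"
    using assms by (intro ext) (auto split: split_indicator)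
  then show ?thesis using assms by (simp add: Bochner_Integration.integral_restrict_space)
qed

lemma integrable_lebesgue_on_superset:
  fixes f :: "'a::euclidean_space \<Rightarrow> 'b::euclidean_space"
  assumes "S \<subseteq> T" "S \<in> sets lebesgue" "T \<in> sets lebesgue" and "\<And>x. x \<in> T - S \<Longrightarrow> f x = 0"
    and "integrable (lebesgue_on S) f"
  shows "integrable (lebesgue_on T) f"
proof -
  have "(\<lambda>x. indicat_real T x *\<^sub>R f x) = (\<lambda>x. indicat_real S x *\<^sub>R f x)"
    using assms by (intro ext) (auto split: split_indicator)
  then show ?thesis using assms by (simp add: integrable_restrict_space)
qed

lemma integrable_lebesgue_on_mono:
  fixes f :: "'a::euclidean_space \<Rightarrow> 'b::euclidean_space"
  assumes "integrable (lebesgue_on T) f" and "S \<subseteq> T" "S \<in> sets lebesgue" "T \<in> sets lebesgue"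
  shows "integrable (lebesgue_on S) f"
proof -
  have "integrable lebesgue (\<lambda>x. indicat_real S x *\<^sub>R (indicat_real T x *\<^sub>R f x))"
    using assms by (intro integrable_mult_indicator[of S lebesgue]) (simp_all add: integrable_restrict_space)
  moreover have "(\<lambda>x. indicat_real S x *\<^sub>R (indicat_real T x *\<^sub>R f x)) = (\<lambda>x. indicat_real S x *\<^sub>R f x)"
    using assms by (intro ext) (auto split: split_indicator)
  ultimately show ?thesis using assms by (simp add: integrable_restrict_space)
qed

lemma integral_lebesgue_on_eq_lborel:
  fixes f :: "'a::euclidean_space \<Rightarrow> 'b::euclidean_space"
  assumes "S \<in> sets lebesgue" "f \<in> borel_measurable borel" "\<And>x. x \<notin> S \<Longrightarrow> f x = 0"
  shows "integral\<^sup>L (lebesgue_on S) f = integral\<^sup>L lborel f"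
proof -
  have "(\<lambda>x. indicat_real S x *\<^sub>R f x) = f"
    using assms by (auto simp: indicator_def)
  then show ?thesis using assms by (simp add: Bochner_Integration.integral_restrict_space integral_completion)
qed

lemma integrable_lebesgue_on_lborel:
  fixes f :: "'a::euclidean_space \<Rightarrow> 'b::euclidean_space"
  assumes "integrable lborel f" "S \<in> sets lebesgue"
  shows "integrable (lebesgue_on S) f"
proof -
  have "integrable lebesgue f" using assms by (simp add: integrable_completion)
  then show ?thesis
    using assms(2) by (auto simp: integrable_restrict_space intro: integrable_mult_indicator)
qed

lemma integrable_lebesgue_on_compact:
  fixes f :: "'a::euclidean_space \<Rightarrow> 'b::euclidean_space"
  assumes "continuous_on K f" "compact K"
  shows "integrable (lebesgue_on K) f"
proof -
  have "integrable lborel (\<lambda>x. indicator K x *\<^sub>R f x)"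
    by (rule borel_integrable_compact[OF assms(2,1)])
  moreover have "K \<in> sets lebesgue" using assms(2) by (simp add: compact_imp_closed)
  ultimately have "integrable (lebesgue_on K) (\<lambda>x. indicator K x *\<^sub>R f x)"
    by (rule integrable_lebesgue_on_lborel)
  then show ?thesis
    by (rule Bochner_Integration.integrable_cong[THEN iffD1, OF refl, rotated]) simp
qed

lemma integrable_lebesgue_on_bounded:
  fixes f :: "'a::euclidean_space \<Rightarrow> 'b::euclidean_space"
  assumes "S \<in> lmeasurable" and "f \<in> borel_measurable (lebesgue_on S)"
    and "AE x in lebesgue_on S. norm (f x) \<le> C"
  shows "integrable (lebesgue_on S) f"
proof (rule Bochner_Integration.integrable_bound[OF _ assms(2)])
  show "integrable (lebesgue_on S) (\<lambda>x. C)"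
    using assms(1) by (intro finite_measure.integrable_const finite_measure_lebesgue_on)
  show "AE x in lebesgue_on S. norm (f x) \<le> norm C"
    using assms(3) by eventually_elim simp
qed

section \<open>The inner product structure of \<open>L2\<close>\<close>

lemma L2_measurable: "u \<in> L2 S \<Longrightarrow> u \<in> borel_measurable (lebesgue_on S)"
  by (simp add: L2_def)

lemma L2_integrable_norm_sq: "u \<in> L2 S \<Longrightarrow> integrable (lebesgue_on S) (\<lambda>x. (norm (u x))\<^sup>2)"
  by (simp add: L2_def)

lemma L2_inner_integrable:
  assumes "u \<in> L2 S" and "v \<in> L2 S"
  shows "integrable (lebesgue_on S) (\<lambda>x. u x \<bullet> v x)"
proof (rule Bochner_Integration.integrable_bound)
  show "integrable (lebesgue_on S) (\<lambda>x. (norm (u x))\<^sup>2 + (norm (v x))\<^sup>2)"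
    using assms by (intro Bochner_Integration.integrable_add L2_integrable_norm_sq)
  show "(\<lambda>x. u x \<bullet> v x) \<in> borel_measurable (lebesgue_on S)"
    using assms by (intro borel_measurable_inner L2_measurable)
  have "\<bar>u x \<bullet> v x\<bar> \<le> (norm (u x))\<^sup>2 + (norm (v x))\<^sup>2" for x
    using Cauchy_Schwarz_ineq2[of "u x" "v x"] sum_squares_bound[of "norm (u x)" "norm (v x)"]
      mult_nonneg_nonneg[of "norm (u x)" "norm (v x)"] by (simp add: mult.assoc)
  then show "AE x in lebesgue_on S. norm (u x \<bullet> v x) \<le> norm ((norm (u x))\<^sup>2 + (norm (v x))\<^sup>2)"
    by simp
qed

lemma L2_mult_integrable:
  fixes u v :: "'a::euclidean_space \<Rightarrow> real"
  assumes "u \<in> L2 S" and "v \<in> L2 S"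
  shows "integrable (lebesgue_on S) (\<lambda>x. u x * v x)"
  using L2_inner_integrable[OF assms] by simp

lemma L2_scaleR: "u \<in> L2 S \<Longrightarrow> (\<lambda>x. c *\<^sub>R u x) \<in> L2 S"
  by (auto simp: L2_def power_mult_distrib)

lemma L2_add:
  assumes "u \<in> L2 S" and "v \<in> L2 S"
  shows "(\<lambda>x. u x + v x) \<in> L2 S"
proof -
  have "integrable (lebesgue_on S) (\<lambda>x. (norm (u x))\<^sup>2 + 2 * (u x \<bullet> v x) + (norm (v x))\<^sup>2)"
    using assms by (intro Bochner_Integration.integrable_add L2_integrable_norm_sq
        integrable_mult_right L2_inner_integrable)
  moreover have "(norm (u x))\<^sup>2 + 2 * (u x \<bullet> v x) + (norm (v x))\<^sup>2 = (norm (u x + v x))\<^sup>2" for x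
    by (simp add: power2_norm_eq_inner inner_add_left inner_add_right inner_commute)
  ultimately show ?thesis
    using assms by (auto simp: L2_def)
qed

lemma L2_diff:
  assumes "u \<in> L2 S" and "v \<in> L2 S"
  shows "(\<lambda>x. u x - v x) \<in> L2 S"
  using L2_add[OF assms(1) L2_scaleR[OF assms(2), of "-1"]] by simp

text \<open>The squared norm of u + t v is a quadratic in t that is never negative, so its
  discriminant is not positive.\<close>

lemma L2_cauchy_schwarz:
  assumes u: "u \<in> L2 S" and v: "v \<in> L2 S"
  shows "(LINT x|lebesgue_on S. u x \<bullet> v x)\<^sup>2
      \<le> (LINT x|lebesgue_on S. (norm (u x))\<^sup>2) * (LINT x|lebesgue_on S. (norm (v x))\<^sup>2)"
proof -
  define a b c where "a = (LINT x|lebesgue_on S. (norm (u x))\<^sup>2)"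
    and "b = (LINT x|lebesgue_on S. u x \<bullet> v x)" and "c = (LINT x|lebesgue_on S. (norm (v x))\<^sup>2)"
  have *: "0 \<le> a + 2 * t * b + t\<^sup>2 * c" for t
  proof -
    have "0 \<le> (LINT x|lebesgue_on S. (norm (u x + t *\<^sub>R v x))\<^sup>2)"
      by (rule integral_nonneg_AE) simp
    also have "\<dots> = (LINT x|lebesgue_on S. (norm (u x))\<^sup>2 + 2 * t * (u x \<bullet> v x) + t\<^sup>2 * (norm (v x))\<^sup>2)"
      by (rule Bochner_Integration.integral_cong)
        (simp_all add: power2_norm_eq_inner inner_add_left inner_add_right inner_commute
          algebra_simps power2_eq_square[of t])
    also have "\<dots> = a + 2 * t * b + t\<^sup>2 * c"
      unfolding a_def b_def c_def using u v
      by (simp add: L2_inner_integrable L2_integrable_norm_sq)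
    finally show ?thesis .
  qed
  have c0: "c \<ge> 0" unfolding c_def by (rule integral_nonneg_AE) simp
  have "b\<^sup>2 \<le> a * c"
  proof (cases "c = 0")
    case True
    have "b = 0"
    proof (rule ccontr)
      assume "b \<noteq> 0"
      \<comment> \<open>For c = 0 the quadratic is affine, and this t gives it the value -1.\<close>
      then show False using *[of "- (a + 1) / (2 * b)"] True by (simp add: field_simps)
    qed
    then show ?thesis using True by simp
  next
    case False
    \<comment> \<open>Here t is the minimiser -b/c of the quadratic.\<close>
    then have "0 \<le> a - b\<^sup>2 / c"
      using *[of "- b / c"] by (simp add: power2_eq_square field_simps)
    then show ?thesis using False c0 by (simp add: field_simps)
  qed
  then show ?thesis by (simp only: a_def b_def c_def)
qed

text \<open>Cauchy-Schwarz turns norm convergence into convergence of inner products with a fixed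
  function. Through this, identities for test functions pass to \<open>H10\<close>.\<close>

lemma L2_tendsto_inner:
  fixes u h :: "'a::euclidean_space \<Rightarrow> 'b::euclidean_space"
  assumes u: "u \<in> L2 S" and uk: "\<And>k. uk k \<in> L2 S" and h: "h \<in> L2 S"
    and lim: "(\<lambda>k. LINT x|lebesgue_on S. (norm (u x - uk k x))\<^sup>2) \<longlonglongrightarrow> 0"
  shows "(\<lambda>k. LINT x|lebesgue_on S. uk k x \<bullet> h x) \<longlonglongrightarrow> (LINT x|lebesgue_on S. u x \<bullet> h x)"
proof -
  let ?d = "\<lambda>k. LINT x|lebesgue_on S. (u x - uk k x) \<bullet> h x"
  have "(\<lambda>k. (LINT x|lebesgue_on S. (norm (u x - uk k x))\<^sup>2) * (LINT x|lebesgue_on S. (norm (h x))\<^sup>2)) \<longlonglongrightarrow> 0"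
    using tendsto_mult_left_zero[OF lim] .
  then have "(\<lambda>k. (?d k)\<^sup>2) \<longlonglongrightarrow> 0"
    by (rule tendsto_sandwich[OF _ _ tendsto_const, rotated 2])
      (auto intro!: always_eventually L2_cauchy_schwarz[OF L2_diff[OF u uk] h])
  then have "?d \<longlonglongrightarrow> 0"
    using tendsto_real_sqrt[of "\<lambda>k. (?d k)\<^sup>2" 0] by (simp add: tendsto_rabs_zero_iff)
  moreover have "?d k = (LINT x|lebesgue_on S. u x \<bullet> h x) - (LINT x|lebesgue_on S. uk k x \<bullet> h x)" for k
    by (simp add: inner_diff_left L2_inner_integrable u uk h)
  ultimately have "(\<lambda>k. (LINT x|lebesgue_on S. u x \<bullet> h x) - ?d k)
      \<longlonglongrightarrow> (LINT x|lebesgue_on S. u x \<bullet> h x) - 0"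
    by (intro tendsto_intros)
  moreover have "(LINT x|lebesgue_on S. u x \<bullet> h x) - ?d k = (LINT x|lebesgue_on S. uk k x \<bullet> h x)" for k
    using \<open>\<And>k. ?d k = _ k\<close>[of k] by simp
  ultimately show ?thesis by simp
qed

lemma L2_bounded:
  assumes "S \<in> lmeasurable" and "f \<in> borel_measurable (lebesgue_on S)"
    and "\<And>x. x \<in> S \<Longrightarrow> norm (f x) \<le> C"
  shows "f \<in> L2 S"
proof -
  have "integrable (lebesgue_on S) (\<lambda>x. (norm (f x))\<^sup>2)"
  proof (rule integrable_lebesgue_on_bounded[OF assms(1)])
    show "(\<lambda>x. (norm (f x))\<^sup>2) \<in> borel_measurable (lebesgue_on S)" using assms(2) by measurable
    show "AE x in lebesgue_on S. norm ((norm (f x))\<^sup>2) \<le> C\<^sup>2"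
      using assms(1,3) by (intro AE_I2) (auto intro: power_mono)
  qed
  then show ?thesis using assms(2) by (simp add: L2_def)
qed

lemma L2_bounded_mult:
  assumes "S \<in> sets lebesgue" "u \<in> L2 S" and "A \<in> borel_measurable (lebesgue_on S)"
    and "\<And>x. x \<in> S \<Longrightarrow> \<bar>A x\<bar> \<le> C"
  shows "(\<lambda>x. A x *\<^sub>R u x) \<in> L2 S"
proof -
  have m: "(\<lambda>x. A x *\<^sub>R u x) \<in> borel_measurable (lebesgue_on S)"
    using assms(3) L2_measurable[OF assms(2)] by measurable
  have "integrable (lebesgue_on S) (\<lambda>x. (norm (A x *\<^sub>R u x))\<^sup>2)"
  proof (rule Bochner_Integration.integrable_bound)
    show "integrable (lebesgue_on S) (\<lambda>x. C\<^sup>2 * (norm (u x))\<^sup>2)"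
      using assms by (intro integrable_mult_right L2_integrable_norm_sq)
    show "(\<lambda>x. (norm (A x *\<^sub>R u x))\<^sup>2) \<in> borel_measurable (lebesgue_on S)" using m by measurable
    have "(A x)\<^sup>2 \<le> C\<^sup>2" if "x \<in> S" for x
      using power_mono[OF assms(4)[OF that], of 2] by simp
    then show "AE x in lebesgue_on S. norm ((norm (A x *\<^sub>R u x))\<^sup>2) \<le> norm (C\<^sup>2 * (norm (u x))\<^sup>2)"
      using assms(1) by (intro AE_I2) (auto simp: power_mult_distrib intro: mult_right_mono)
  qed
  then show ?thesis using m by (simp add: L2_def)
qed

text \<open>On a set of finite measure, |u| is dominated by the integrable function 1 +
  |u|^2.\<close>

lemma L2_integrable:
  fixes u :: "'a::euclidean_space \<Rightarrow> 'b::euclidean_space"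
  assumes "u \<in> L2 S" and "S \<in> lmeasurable"
  shows "integrable (lebesgue_on S) u"
proof (rule Bochner_Integration.integrable_bound)
  have "integrable (lebesgue_on S) (\<lambda>x. 1 :: real)"
    by (rule integrable_lebesgue_on_bounded[OF assms(2), of _ 1]) auto
  then show "integrable (lebesgue_on S) (\<lambda>x. 1 + (norm (u x))\<^sup>2)"
    using assms by (intro Bochner_Integration.integrable_add L2_integrable_norm_sq)
  have "t \<le> 1 + t\<^sup>2" for t :: real
    using zero_le_power2[of "t - 1/2"] by (simp add: power2_eq_square algebra_simps)
  then show "AE x in lebesgue_on S. norm (u x) \<le> norm (1 + (norm (u x))\<^sup>2)"
    by (simp add: add_nonneg_nonneg)
qed (use assms in \<open>simp add: L2_measurable\<close>)

lemma L2_subset: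
  assumes "u \<in> L2 T" and "S \<subseteq> T" "S \<in> sets lebesgue" "T \<in> sets lebesgue"
  shows "u \<in> L2 S"
  using assms integrable_lebesgue_on_mono[OF L2_integrable_norm_sq[OF assms(1)] assms(2-)]
    measurable_restrict_mono[OF L2_measurable[OF assms(1)] assms(2)] by (simp add: L2_def)

lemma L2_locally_integrable:
  assumes "u \<in> L2 S" and "S \<in> sets lebesgue"
  shows "locally_integrable S u"
  unfolding locally_integrable_def
proof (intro allI impI, elim conjE)
  fix K :: "'a set" assume K: "compact K" "K \<subseteq> S"
  then have "u \<in> L2 K"
    using assms by (intro L2_subset[OF assms(1)]) (auto simp: compact_imp_closed)
  then show "integrable (lebesgue_on K) u"
    using K by (intro L2_integrable) (auto simp: lmeasurable_compact)
qed

lemma L2_compact_support: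
  fixes h :: "'a::euclidean_space \<Rightarrow> 'b::euclidean_space"
  assumes "continuous_on UNIV h" and "compact K" and "\<And>x. x \<notin> K \<Longrightarrow> h x = 0" and "S \<in> sets lebesgue"
  shows "h \<in> L2 S"
proof -
  have "integrable lborel (\<lambda>x. (norm (h x))\<^sup>2)"
    by (rule continuous_compact_support_integrable[OF _ assms(2)])
      (use assms in \<open>auto intro!: continuous_intros\<close>)
  from integrable_lebesgue_on_lborel[OF this assms(4)] show ?thesis
    using assms(1,4) continuous_imp_measurable_on_sets_lebesgue[of UNIV h]
    by (auto simp: L2_def lebesgue_on_UNIV_eq intro: measurable_restrict_space1)
qed

lemma test_functions_L2:
  assumes "\<psi> \<in> test_functions \<Omega>" and "S \<in> sets lebesgue"
  shows "\<psi> \<in> L2 S" and "gradient \<psi> \<in> L2 S"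
proof -
  obtain K where K_: "compact K" "K \<subseteq> \<Omega>" "\<forall>x. x \<notin> K \<longrightarrow> \<psi> x = 0"
    by (rule test_functionsE[OF assms(1)])
    note K = K_(1,2) K_(3)[rule_format]
  show "\<psi> \<in> L2 S"
    by (rule L2_compact_support[OF Ck_imp_continuous[OF test_functions_Ck[OF assms(1)]] K(1,3) assms(2)])
  show "gradient \<psi> \<in> L2 S"
    by (rule L2_compact_support[OF continuous_on_gradient[OF test_functions_Ck[OF assms(1)]] K(1) _ assms(2)])
      (rule gradient_eq_0_outside[OF compact_imp_closed[OF K(1)] K(3)])
qed

lemma gradient_mult:
  assumes "Ck (Suc 0) p" and "Ck (Suc 0) q"
  shows "gradient (\<lambda>x. p x * q x) x = p x *\<^sub>R gradient q x + q x *\<^sub>R gradient p x"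
proof (rule gradient_eqI)
  have "((\<lambda>x. p x * q x) has_derivative (\<lambda>v. p x * (gradient q x \<bullet> v) + (gradient p x \<bullet> v) * q x)) (at x)"
    by (intro has_derivative_mult has_derivative_gradient[of 0] assms)
  then show "((\<lambda>x. p x * q x) has_derivative (\<lambda>v. (p x *\<^sub>R gradient q x + q x *\<^sub>R gradient p x) \<bullet> v)) (at x)"
    by (rule has_derivative_eq_rhs) (auto simp: inner_add_left)
qed

text \<open>The product of \<open>p\<close> and \<open>\<psi>\<close> has compact support although
  \<open>p\<close> itself may not, and the vanishing integral of its partial derivative is the
  formula.\<close>

lemma integral_by_parts_test_function:
  fixes p :: "'a::euclidean_space \<Rightarrow> real"
  assumes S: "\<Omega> \<in> sets lebesgue" and \<psi>: "\<psi> \<in> test_functions \<Omega>" and p: "Ck (Suc 0) p"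
  shows "(LINT x|lebesgue_on \<Omega>. p x * (gradient \<psi> x \<bullet> b)) = - (LINT x|lebesgue_on \<Omega>. (gradient p x \<bullet> b) * \<psi> x)"
proof -
  obtain K where K_: "compact K" "K \<subseteq> \<Omega>" "\<forall>x. x \<notin> K \<longrightarrow> \<psi> x = 0"
    by (rule test_functionsE[OF \<psi>])
    note K = K_(1,2) K_(3)[rule_format]
  note ck = test_functions_Ck[OF \<psi>, of "Suc 0"]
  have g0: "gradient \<psi> x = 0" if "x \<notin> K" for x
    using gradient_eq_0_outside[OF compact_imp_closed[OF K(1)] K(3) that] .
  have o: "gradient \<psi> x = 0" "\<psi> x = 0" if "x \<notin> \<Omega>" for x
    using that K(2,3) g0 by blast+
  note cont = Ck_imp_continuous[OF ck] Ck_imp_continuous[OF p] continuous_on_gradient[OF ck] continuous_on_gradient[OF p]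
  have c1: "continuous_on UNIV (\<lambda>x. p x * (gradient \<psi> x \<bullet> b))" and c2: "continuous_on UNIV (\<lambda>x. (gradient p x \<bullet> b) * \<psi> x)"
    using cont by (auto intro!: continuous_intros)
  have i1: "integrable lborel (\<lambda>x. p x * (gradient \<psi> x \<bullet> b))"
    by (rule continuous_compact_support_integrable[OF c1 K(1)]) (simp add: g0)
  have i2: "integrable lborel (\<lambda>x. (gradient p x \<bullet> b) * \<psi> x)"
    by (rule continuous_compact_support_integrable[OF c2 K(1)]) (simp add: K(3))
  have "0 = (LINT x|lborel. gradient (\<lambda>x. p x * \<psi> x) x \<bullet> b)"
    by (rule integral_partial_derivative_eq_0[OF Ck_mult[OF p ck] K(1), symmetric]) (simp add: K(3))
  also have "\<dots> = (LINT x|lborel. p x * (gradient \<psi> x \<bullet> b) + (gradient p x \<bullet> b) * \<psi> x)"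
    by (rule Bochner_Integration.integral_cong) (simp_all only: gradient_mult[OF p ck] inner_add_left inner_scaleR_left mult.commute[of "\<psi> _"])
  also have "\<dots> = (LINT x|lborel. p x * (gradient \<psi> x \<bullet> b)) + (LINT x|lborel. (gradient p x \<bullet> b) * \<psi> x)"
    by (rule Bochner_Integration.integral_add[OF i1 i2])
  also have "(LINT x|lborel. p x * (gradient \<psi> x \<bullet> b)) = (LINT x|lebesgue_on \<Omega>. p x * (gradient \<psi> x \<bullet> b))"
    by (rule integral_lebesgue_on_eq_lborel[OF S, symmetric])
      (use c1 o in \<open>auto intro: borel_measurable_continuous_onI\<close>)
  also have "(LINT x|lborel. (gradient p x \<bullet> b) * \<psi> x) = (LINT x|lebesgue_on \<Omega>. (gradient p x \<bullet> b) * \<psi> x)"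
    by (rule integral_lebesgue_on_eq_lborel[OF S, symmetric])
      (use c2 o in \<open>auto intro: borel_measurable_continuous_onI\<close>)
  finally show ?thesis by simp
qed

text \<open>Off a negligible set a measurable function is a pointwise limit of continuous ones.
  Clipping these to [-C, C] keeps the limit and supplies the uniform bound for dominated
  convergence.\<close>

lemma bounded_measurable_continuous_approx:
  fixes u :: "'a::euclidean_space \<Rightarrow> real"
  assumes "S \<in> sets lebesgue" "u \<in> borel_measurable (lebesgue_on S)" and "\<And>x. x \<in> S \<Longrightarrow> \<bar>u x\<bar> \<le> C"
    and "C \<ge> 0"
  obtains g where "\<forall>n. continuous_on UNIV (g n)" and "\<forall>n x. \<bar>g n x\<bar> \<le> C"
    and "AE x in lebesgue_on S. (\<lambda>n. g n x) \<longlonglongrightarrow> u x"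
proof -
  have "u measurable_on S" using assms by (simp add: measurable_on_iff_borel_measurable)
  then obtain N g where N: "negligible N" and g: "\<And>n. continuous_on UNIV (g n)"
    and lim: "\<And>x. x \<notin> N \<Longrightarrow> (\<lambda>n. g n x) \<longlonglongrightarrow> (if x \<in> S then u x else 0)"
    unfolding measurable_on_def by blast
  define g' where "g' n x = max (- C) (min C (g n x))" for n :: nat and x
  show thesis
  proof
    show "\<forall>n. continuous_on UNIV (g' n)"
      unfolding g'_def by (intro allI continuous_intros g)
    show "\<forall>n x. \<bar>g' n x\<bar> \<le> C"
      using assms(4) by (auto simp: g'_def)
    have "AE x in lebesgue. x \<notin> N"
      using N by (intro AE_not_in) (simp add: negligible_iff_null_sets)
    then show "AE x in lebesgue_on S. (\<lambda>n. g' n x) \<longlonglongrightarrow> u x"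
      unfolding AE_lebesgue_on_iff[OF assms(1)]
    proof eventually_elim
      case (elim x)
      show ?case
      proof
        assume x: "x \<in> S"
        have "(\<lambda>n. g' n x) \<longlonglongrightarrow> max (- C) (min C (u x))"
          unfolding g'_def using lim[OF elim] x by (intro tendsto_intros) simp
        then show "(\<lambda>n. g' n x) \<longlonglongrightarrow> u x"
          using assms(3)[OF x] by (simp add: max_def min_def abs_le_iff split: if_splits)
      qed
    qed
  qed
qed

section \<open>Weak gradients and uniqueness of weak solutions\<close>

lemma integrable_mult_compact_support:
  fixes h :: "'a::euclidean_space \<Rightarrow> real" and q :: "'a \<Rightarrow> real"
  assumes S: "\<Omega> \<in> sets lebesgue" and h: "locally_integrable \<Omega> h"
    and q: "continuous_on UNIV q" "compact K" "K \<subseteq> \<Omega>" "\<And>x. x \<notin> K \<Longrightarrow> q x = 0"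
  shows "integrable (lebesgue_on \<Omega>) (\<lambda>x. h x * q x)"
proof (rule integrable_lebesgue_on_superset[OF q(3) _ S])
  show K: "K \<in> sets lebesgue" using q(2) by (simp add: compact_imp_closed)
  show "h x * q x = 0" if "x \<in> \<Omega> - K" for x using that q(4) by simp
  have hK: "integrable (lebesgue_on K) h" using h q(2,3) by (simp add: locally_integrable_def)
  have "bounded (q ` K)"
    by (rule compact_imp_bounded[OF compact_continuous_image[OF continuous_on_subset[OF q(1)] q(2)]]) simp
  then obtain C where C: "\<And>x. x \<in> K \<Longrightarrow> \<bar>q x\<bar> \<le> C"
    unfolding bounded_iff by auto
  show "integrable (lebesgue_on K) (\<lambda>x. h x * q x)"
  proof (rule Bochner_Integration.integrable_bound)
    show "integrable (lebesgue_on K) (\<lambda>x. C * h x)" using hK by (rule integrable_mult_right)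
    show "(\<lambda>x. h x * q x) \<in> borel_measurable (lebesgue_on K)"
      using borel_measurable_integrable[OF hK]
        continuous_imp_measurable_on_sets_lebesgue[OF continuous_on_subset[OF q(1) subset_UNIV] K]
      by measurable
    show "AE x in lebesgue_on K. norm (h x * q x) \<le> norm (C * h x)"
    proof (intro AE_I2)
      fix x assume "x \<in> space (lebesgue_on K)"
      then have "\<bar>h x\<bar> * \<bar>q x\<bar> \<le> \<bar>h x\<bar> * \<bar>C\<bar>"
        by (intro mult_left_mono order_trans[OF C abs_ge_self]) auto
      then show "norm (h x * q x) \<le> norm (C * h x)" by (simp add: abs_mult mult.commute)
    qed
  qed
qed

lemma locally_integrable_inner:
  assumes "locally_integrable \<Omega> G"
  shows "locally_integrable \<Omega> (\<lambda>x. G x \<bullet> b)"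
  using assms unfolding locally_integrable_def by (auto intro: integrable_inner_left)

lemma test_mult_integrable:
  fixes h :: "'a::euclidean_space \<Rightarrow> real"
  assumes "\<Omega> \<in> sets lebesgue" "locally_integrable \<Omega> h" "\<psi> \<in> test_functions \<Omega>"
  shows "integrable (lebesgue_on \<Omega>) (\<lambda>x. h x * \<psi> x)"
    and "integrable (lebesgue_on \<Omega>) (\<lambda>x. h x * (gradient \<psi> x \<bullet> b))"
proof -
  obtain K where K_: "compact K" "K \<subseteq> \<Omega>" "\<forall>x. x \<notin> K \<longrightarrow> \<psi> x = 0"
    by (rule test_functionsE[OF assms(3)])
    note K = K_(1,2) K_(3)[rule_format]
  show "integrable (lebesgue_on \<Omega>) (\<lambda>x. h x * \<psi> x)"
    by (rule integrable_mult_compact_support[OF assms(1,2) Ck_imp_continuous[OF test_functions_Ck[OF assms(3)]] K])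
  have "continuous_on UNIV (\<lambda>x. gradient \<psi> x \<bullet> b)"
    by (intro continuous_intros continuous_on_gradient[OF test_functions_Ck[OF assms(3), of "Suc 0"]])
  then show "integrable (lebesgue_on \<Omega>) (\<lambda>x. h x * (gradient \<psi> x \<bullet> b))"
    by (rule integrable_mult_compact_support[OF assms(1,2) _ K(1,2)])
      (simp add: gradient_eq_0_outside[OF compact_imp_closed[OF K(1)] K(3)])
qed

lemma real_polynomial_function_norm_sq:
  "real_polynomial_function (\<lambda>x :: 'a::euclidean_space. (norm x)\<^sup>2)"
proof -
  have "real_polynomial_function (\<lambda>x :: 'a. \<Sum>b\<in>Basis. (x \<bullet> b) * (x \<bullet> b))"
    by (intro real_polynomial_function_sum real_polynomial_function.intros(1,4)
        bounded_linear_inner_left) auto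
  moreover have "(\<lambda>x :: 'a. \<Sum>b\<in>Basis. (x \<bullet> b) * (x \<bullet> b)) = (\<lambda>x. (norm x)\<^sup>2)"
    by (simp add: power2_norm_eq_inner euclidean_inner[symmetric])
  ultimately show ?thesis by simp
qed

text \<open>The flat exponential vanishes once the norm reaches \<open>\<rho>\<close>, so the
  support lies in a closed ball strictly inside radius \<open>R\<close>. The squared norm keeps the
  argument a polynomial in x.\<close>

lemma cutoff_polynomial_test_function:
  fixes p :: "'a::euclidean_space \<Rightarrow> real"
  assumes p: "real_polynomial_function p" and \<rho>: "\<rho> < R" and "c > 0" "\<rho> > 0"
  shows "(\<lambda>x. flat_exp 1 (c * (\<rho>\<^sup>2 - (norm x)\<^sup>2)) * p x) \<in> test_functions (ball 0 R)"
proof (rule test_functionsI)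
  have "real_polynomial_function (\<lambda>x :: 'a. c * (\<rho>\<^sup>2 + (- 1) * (norm x)\<^sup>2))"
    by (intro real_polynomial_function.intros(2,3,4) real_polynomial_function_norm_sq)
  then have s: "Ck k (\<lambda>x :: 'a. c * (\<rho>\<^sup>2 - (norm x)\<^sup>2))" for k
    using Ck_real_polynomial_function[of _ k] by fastforce
  show "Ck k (\<lambda>x. flat_exp 1 (c * (\<rho>\<^sup>2 - (norm x)\<^sup>2)) * p x)" for k
    by (rule Ck_mult[OF Ck_flat_exp[OF s] Ck_real_polynomial_function[OF p]])
  show "compact (cball 0 \<rho> :: 'a set)" by simp
  show "(cball 0 \<rho> :: 'a set) \<subseteq> ball 0 R" using \<rho> by auto
  show "flat_exp 1 (c * (\<rho>\<^sup>2 - (norm x)\<^sup>2)) * p x = 0" if "x \<notin> cball 0 \<rho>" for x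
  proof -
    have "\<rho>\<^sup>2 \<le> (norm x)\<^sup>2" using that \<open>\<rho> > 0\<close> by (intro power_mono) auto
    then show ?thesis using \<open>c > 0\<close> by (simp add: flat_exp_def mult_le_0_iff)
  qed
qed

lemma flat_exp_1: "s > 0 \<Longrightarrow> flat_exp 1 s = exp (- (1 / s))"
  by (simp add: flat_exp_def)

lemma flat_exp_1_bounds: "0 \<le> flat_exp 1 s" "flat_exp 1 s \<le> 1"
  by (auto simp: flat_exp_def)

text \<open>The argument tends to infinity, where exp(-1/s) tends to 1. The shift \<open>c\<close>
  serves two cut-offs: 0 for a fixed support, 1 for supports that grow with k.\<close>

lemma flat_exp_1_tendsto_1:
  assumes "s > 0"
  shows "(\<lambda>k. flat_exp 1 (real (Suc k) * s - c)) \<longlonglongrightarrow> 1"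
proof -
  have lim: "filterlim (\<lambda>k. real (Suc k) * s - c) at_top sequentially"
    unfolding diff_conv_add_uminus add.commute[of _ "- c"]
    by (rule filterlim_tendsto_add_at_top[OF tendsto_const filterlim_at_top_mult_tendsto_pos[OF tendsto_const assms
        filterlim_compose[OF filterlim_real_sequentially filterlim_Suc]]])
  have "(\<lambda>k. exp (- (1 / (real (Suc k) * s - c)))) \<longlonglongrightarrow> exp (- 0)"
    by (intro tendsto_intros tendsto_divide_0[OF tendsto_const] filterlim_at_top_imp_at_infinity lim)
  moreover have "eventually (\<lambda>k. exp (- (1 / (real (Suc k) * s - c))) = flat_exp 1 (real (Suc k) * s - c)) sequentially"
    using eventually_compose_filterlim[OF eventually_gt_at_top[of 0] lim]
    by eventually_elim (simp add: flat_exp_1)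
  ultimately show ?thesis by (auto intro: Lim_transform_eventually)
qed

text \<open>The products of polynomials and cut-offs are enough: polynomials are uniformly dense in the
  continuous functions on a ball, and these approximate the sign of \<open>h\<close> almost everywhere.\<close>
lemma AE_zero_if_orthogonal_to_test_functions:
  fixes h :: "'a::euclidean_space \<Rightarrow> real"
  assumes h: "locally_integrable (ball 0 R) h"
    and orth: "\<And>\<psi>. \<psi> \<in> test_functions (ball 0 R) \<Longrightarrow> (LINT x|lebesgue_on (ball 0 R). h x * \<psi> x) = 0"
  shows "AE x in lebesgue_on (ball 0 R). h x = 0"
proof -
  \<comment> \<open>Integrability of \<open>h\<close> is only local, so the argument runs on
    strictly smaller balls, which are exhausted at the end.\<close>
  have ball: "AE x in lebesgue_on (ball 0 \<rho>). h x = 0" if \<rho>: "0 < \<rho>" "\<rho> < R" for \<rho>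
  proof -
    let ?B = "ball 0 \<rho> :: 'a set"
    have BR: "?B \<subseteq> ball 0 R" by (rule subset_ball[OF less_imp_le[OF \<rho>(2)]])
    have hB: "integrable (lebesgue_on ?B) h"
    proof (rule integrable_lebesgue_on_mono[OF _ ball_subset_cball])
      have "cball 0 \<rho> \<subseteq> (ball 0 R :: 'a set)" using \<rho>(2) by (simp add: subset_iff)
      then show "integrable (lebesgue_on (cball 0 \<rho>)) h"
        using h unfolding locally_integrable_def by (metis compact_cball)
    qed auto
    note hm = borel_measurable_integrable[OF hB]
    have cm: "q \<in> borel_measurable (lebesgue_on ?B)" if "continuous_on UNIV q" for q :: "'a \<Rightarrow> real"
      using continuous_imp_measurable_on_sets_lebesgue[OF continuous_on_subset[OF that subset_UNIV]] by auto
    have cb: "\<exists>C\<ge>0. \<forall>x\<in>cball 0 \<rho>. \<bar>q x\<bar> \<le> C" if "continuous_on UNIV q" for q :: "'a \<Rightarrow> real"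
    proof -
      have "bounded (q ` cball 0 \<rho>)"
        by (rule compact_imp_bounded[OF compact_continuous_image[OF continuous_on_subset[OF that]]]) simp_all
      then obtain C where "\<forall>y\<in>q ` cball 0 \<rho>. norm y \<le> C" unfolding bounded_iff by blast
      then show ?thesis
        by (intro exI[of _ "\<bar>C\<bar>"] conjI ballI abs_ge_zero order_trans[OF _ abs_ge_self]) simp
    qed
    have dom: "(\<lambda>k. LINT x|lebesgue_on ?B. h x * q k x) \<longlonglongrightarrow> (LINT x|lebesgue_on ?B. h x * q' x)"
      if "\<And>k. q k \<in> borel_measurable (lebesgue_on ?B)" "q' \<in> borel_measurable (lebesgue_on ?B)"
        "\<And>k x. x \<in> ?B \<Longrightarrow> \<bar>q k x\<bar> \<le> C" "AE x in lebesgue_on ?B. (\<lambda>k. q k x) \<longlonglongrightarrow> q' x" 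
      for q q' and C :: real
    proof (rule integral_dominated_convergence[where w="\<lambda>x. C * \<bar>h x\<bar>"])
      show "(\<lambda>x. h x * q' x) \<in> borel_measurable (lebesgue_on ?B)"
        "(\<lambda>x. h x * q k x) \<in> borel_measurable (lebesgue_on ?B)" for k
        using hm that(1)[of k] that(2) by measurable
      show "integrable (lebesgue_on ?B) (\<lambda>x. C * \<bar>h x\<bar>)" using hB by auto
      show "AE x in lebesgue_on ?B. (\<lambda>k. h x * q k x) \<longlonglongrightarrow> h x * q' x"
        using that(4) by eventually_elim (intro tendsto_intros)
      show "AE x in lebesgue_on ?B. norm (h x * q k x) \<le> C * \<bar>h x\<bar>" for k
        using that(3) by (intro AE_I2) (auto simp: abs_mult mult.commute[of C] intro: mult_left_mono)
    qed
    have poly: "(LINT x|lebesgue_on ?B. h x * p x) = 0" if p: "real_polynomial_function p" for p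
    proof -
      \<comment> \<open>These cut-offs vanish off the smaller ball and tend to 1 inside it, so
        orthogonality on the large ball yields orthogonality to \<open>p\<close> on the small
        one.\<close>
      define q where "q k x = flat_exp 1 (real (Suc k) * (\<rho>\<^sup>2 - (norm x)\<^sup>2)) * p x" for k x
      have qt: "q k \<in> test_functions (ball 0 R)" for k
        unfolding q_def[abs_def] by (rule cutoff_polynomial_test_function[OF p \<rho>(2) _ \<rho>(1)]) simp
      have pc: "continuous_on UNIV p" using Ck_imp_continuous[OF Ck_real_polynomial_function[OF p, of 0]] .
      obtain C where C: "C \<ge> 0" "\<And>x. x \<in> cball 0 \<rho> \<Longrightarrow> \<bar>p x\<bar> \<le> C" using cb[OF pc] by blast
      have "(LINT x|lebesgue_on ?B. h x * q k x) = (LINT x|lebesgue_on (ball 0 R). h x * q k x)" for k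
      proof (rule integral_lebesgue_on_subset[symmetric, OF BR])
        fix x assume "x \<in> ball 0 R - ball (0::'a) \<rho>"
        then have "\<rho>\<^sup>2 \<le> (norm x)\<^sup>2" using \<rho> by (intro power_mono) auto
        then have "real (Suc k) * (\<rho>\<^sup>2 - (norm x)\<^sup>2) \<le> 0" by (intro mult_nonneg_nonpos) auto
        then show "h x * q k x = 0" by (simp add: q_def flat_exp_def)
      qed auto
      then have z: "(LINT x|lebesgue_on ?B. h x * q k x) = 0" for k using orth[OF qt] by simp
      have "(\<lambda>k. LINT x|lebesgue_on ?B. h x * q k x) \<longlonglongrightarrow> (LINT x|lebesgue_on ?B. h x * p x)"
      proof (rule dom[of _ _ C])
        show "q k \<in> borel_measurable (lebesgue_on ?B)" for k
          by (rule cm[OF Ck_imp_continuous[OF test_functions_Ck[OF qt, of 0]]])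
        show "p \<in> borel_measurable (lebesgue_on ?B)" by (rule cm[OF pc])
        show "\<bar>q k x\<bar> \<le> C" if "x \<in> ?B" for k x
        proof -
          have "\<bar>q k x\<bar> \<le> 1 * C"
            unfolding q_def abs_mult using flat_exp_1_bounds C that by (intro mult_mono) auto
          then show ?thesis by simp
        qed
        show "AE x in lebesgue_on ?B. (\<lambda>k. q k x) \<longlonglongrightarrow> p x"
        proof (intro AE_I2)
          fix x assume "x \<in> space (lebesgue_on ?B)"
          then have "norm x < \<rho>" by simp
          then have "\<rho>\<^sup>2 - (norm x)\<^sup>2 > 0" using power_strict_mono[of "norm x" \<rho> 2] by simp
          from flat_exp_1_tendsto_1[OF this, of 0] have "(\<lambda>k. q k x) \<longlonglongrightarrow> 1 * p x"
            unfolding q_def by (intro tendsto_intros) simp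
          then show "(\<lambda>k. q k x) \<longlonglongrightarrow> p x" by simp
        qed
      qed
      then have "(\<lambda>k. 0) \<longlonglongrightarrow> (LINT x|lebesgue_on ?B. h x * p x)" by (simp only: z)
      then show ?thesis by (simp only: LIMSEQ_const_iff)
    qed
    have cont: "(LINT x|lebesgue_on ?B. h x * g x) = 0" if g: "continuous_on UNIV g" for g
    proof -
      have "\<exists>p. real_polynomial_function p \<and> (\<forall>x\<in>cball 0 \<rho>. \<bar>g x - p x\<bar> < inverse (real (Suc k)))" for k
      proof -
        obtain p where "real_polynomial_function p" "\<And>x. x \<in> cball 0 \<rho> \<Longrightarrow> \<bar>g x - p x\<bar> < inverse (real (Suc k))"
          by (rule Stone_Weierstrass_real_polynomial_function[of "cball 0 \<rho>" g "inverse (real (Suc k))"])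
            (use g in \<open>auto intro: continuous_on_subset[OF g]\<close>)
        then show ?thesis by blast
      qed
      then obtain p where p: "\<And>k. real_polynomial_function (p k)"
        "\<And>k x. x \<in> cball 0 \<rho> \<Longrightarrow> \<bar>g x - p k x\<bar> < inverse (real (Suc k))" by metis
      obtain C where C: "C \<ge> 0" "\<And>x. x \<in> cball 0 \<rho> \<Longrightarrow> \<bar>g x\<bar> \<le> C" using cb[OF g] by blast
      have "(\<lambda>k. LINT x|lebesgue_on ?B. h x * p k x) \<longlonglongrightarrow> (LINT x|lebesgue_on ?B. h x * g x)"
      proof (rule dom[of _ _ "C + 1"])
        show "p k \<in> borel_measurable (lebesgue_on ?B)" for k
          by (rule cm[OF Ck_imp_continuous[OF Ck_real_polynomial_function[OF p(1), of 0]]])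
        show "g \<in> borel_measurable (lebesgue_on ?B)" by (rule cm[OF g])
        show "\<bar>p k x\<bar> \<le> C + 1" if "x \<in> ?B" for k x
        proof -
          have "\<bar>g x - p k x\<bar> < inverse (real (Suc k))" "\<bar>g x\<bar> \<le> C" using that p(2) C by auto
          moreover have "inverse (real (Suc k)) \<le> 1" by (simp add: field_simps)
          ultimately show ?thesis by linarith
        qed
        show "AE x in lebesgue_on ?B. (\<lambda>k. p k x) \<longlonglongrightarrow> g x"
        proof (intro AE_I2)
          fix x assume "x \<in> space (lebesgue_on ?B)"
          then have x: "x \<in> cball 0 \<rho>" by simp
          have "(\<lambda>k. g x - p k x) \<longlonglongrightarrow> 0"
            by (rule Lim_null_comparison[OF _ LIMSEQ_inverse_real_of_nat])
              (use p(2)[OF x] in \<open>auto intro!: always_eventually less_imp_le\<close>)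
          from tendsto_diff[OF tendsto_const[of "g x"] this] show "(\<lambda>k. p k x) \<longlonglongrightarrow> g x" by simp
        qed
      qed
      then have "(\<lambda>k. 0) \<longlonglongrightarrow> (LINT x|lebesgue_on ?B. h x * g x)" by (simp only: poly[OF p(1)])
      then show ?thesis by (simp only: LIMSEQ_const_iff)
    qed
    \<comment> \<open>Since h times its sign is |h|, orthogonality to the sign forces the L1 norm of
      \<open>h\<close> to vanish.\<close>
    have sm: "(\<lambda>x. sgn (h x)) \<in> borel_measurable (lebesgue_on ?B)" using hm by measurable
    have sb: "\<bar>sgn (h x)\<bar> \<le> 1" if "x \<in> ?B" for x by (simp add: sgn_if)
    have SB: "?B \<in> sets lebesgue" by auto
    obtain g where g_: "\<forall>n. continuous_on UNIV (g n)" "\<forall>n x. \<bar>g n x\<bar> \<le> 1"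
      "AE x in lebesgue_on ?B. (\<lambda>n. g n x) \<longlonglongrightarrow> sgn (h x)"
      by (rule bounded_measurable_continuous_approx[OF SB sm sb zero_le_one])
    note g = g_(1,2)[rule_format] g_(3)
    have "(\<lambda>n. LINT x|lebesgue_on ?B. h x * g n x) \<longlonglongrightarrow> (LINT x|lebesgue_on ?B. h x * sgn (h x))"
      by (rule dom[of _ _ 1, OF cm[OF g(1)] sm g(2,3)])
    then have "(\<lambda>n. 0) \<longlonglongrightarrow> (LINT x|lebesgue_on ?B. h x * sgn (h x))" by (simp only: cont[OF g(1)])
    then have "(LINT x|lebesgue_on ?B. \<bar>h x\<bar>) = 0" by (simp only: LIMSEQ_const_iff abs_sgn)
    then have "AE x in lebesgue_on ?B. \<bar>h x\<bar> = 0"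
      using integral_nonneg_eq_0_iff_AE[of "lebesgue_on ?B" "\<lambda>x. \<bar>h x\<bar>"] hB by auto
    then show ?thesis by simp
  qed
  show ?thesis
  proof (cases "R > 0")
    case True
    \<comment> \<open>Radii below \<open>R\<close> that tend to \<open>R\<close>; the offset 2 makes
      already the first one positive.\<close>
    define \<rho> where "\<rho> k = R * (1 - inverse (real (k + 2)))" for k
    have \<rho>: "0 < \<rho> k" "\<rho> k < R" for k
    proof -
      have "inverse (real (k + 2)) < 1" "inverse (real (k + 2)) > 0" by (simp_all add: field_simps)
      then show "0 < \<rho> k" "\<rho> k < R"
        unfolding \<rho>_def using True mult_strict_left_mono[of "1 - inverse (real (k + 2))" 1 R] by auto
    qed
    have "AE x in lebesgue. \<forall>k. x \<in> ball 0 (\<rho> k) \<longrightarrow> h x = 0"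
      unfolding AE_all_countable using ball[OF \<rho>] by (simp add: AE_lebesgue_on_iff)
    then have "AE x in lebesgue. x \<in> ball 0 R \<longrightarrow> h x = 0"
    proof eventually_elim
      case (elim x)
      show ?case
      proof
        assume "x \<in> ball 0 R"
        have "\<rho> \<longlonglongrightarrow> R * (1 - 0)"
          unfolding \<rho>_def using LIMSEQ_inverse_real_of_nat_add[of 0]
          by (intro tendsto_intros LIMSEQ_ignore_initial_segment[OF lim_inverse_n', unfolded inverse_eq_divide[symmetric]]) 
        then have "eventually (\<lambda>k. norm x < \<rho> k) sequentially"
          using \<open>x \<in> ball 0 R\<close> by (intro order_tendstoD(1)) auto
        then obtain k where "norm x < \<rho> k" using eventually_happens by fastforce
        then show "h x = 0" using elim by auto
      qed
    qed
    then show ?thesis by (simp add: AE_lebesgue_on_iff)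
  next
    case False
    then have "ball 0 R = ({} :: 'a set)" by simp
    then show ?thesis by (simp only:) (intro AE_I2, simp)
  qed
qed

text \<open>Component by component, the difference of two weak gradients is orthogonal to all test
  functions.\<close>

lemma weak_gradient_unique:
  fixes u :: "'a::euclidean_space \<Rightarrow> real"
  assumes "has_weak_gradient (ball 0 R) u G" and "has_weak_gradient (ball 0 R) u G'"
  shows "AE x in lebesgue_on (ball 0 R). G x = G' x"
proof -
  have ae: "AE x in lebesgue_on (ball 0 R). (G x - G' x) \<bullet> b = 0" if b: "b \<in> Basis" for b
  proof (rule AE_zero_if_orthogonal_to_test_functions)
    have G: "locally_integrable (ball 0 R) G" "locally_integrable (ball 0 R) G'"
      using assms by (simp_all add: has_weak_gradient_def)
    then show "locally_integrable (ball 0 R) (\<lambda>x. (G x - G' x) \<bullet> b)"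
      unfolding locally_integrable_def by (auto intro!: integrable_inner_left Bochner_Integration.integrable_diff)
    fix \<psi> :: "'a \<Rightarrow> real" assume \<psi>: "\<psi> \<in> test_functions (ball 0 R)"
    have e: "(LINT x|lebesgue_on (ball 0 R). (G x \<bullet> b) * \<psi> x) = (LINT x|lebesgue_on (ball 0 R). (G' x \<bullet> b) * \<psi> x)"
      using assms \<psi> b unfolding has_weak_gradient_def by fastforce
    have "(LINT x|lebesgue_on (ball 0 R). ((G x - G' x) \<bullet> b) * \<psi> x)
        = (LINT x|lebesgue_on (ball 0 R). (G x \<bullet> b) * \<psi> x - (G' x \<bullet> b) * \<psi> x)"
      by (simp only: inner_diff_left left_diff_distrib)
    also have "\<dots> = 0"
      using e Bochner_Integration.integral_diff[OF test_mult_integrable(1)[OF _ locally_integrable_inner[OF G(1)] \<psi>]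
          test_mult_integrable(1)[OF _ locally_integrable_inner[OF G(2)] \<psi>]] by simp
    finally show "(LINT x|lebesgue_on (ball 0 R). ((G x - G' x) \<bullet> b) * \<psi> x) = 0" .
  qed
  have "AE x in lebesgue_on (ball 0 R). \<forall>b\<in>Basis. (G x - G' x) \<bullet> b = 0"
    by (rule AE_finite_allI) (auto intro: ae)
  then show ?thesis
    by eventually_elim (rule euclidean_eqI, simp add: inner_diff_left)
qed

section \<open>The space \<open>H10\<close> as a closure: limits, differences, Poincare inequality,
  uniqueness\<close>

text \<open>The limit \<open>G\<close> of the gradients is kept as explicit data, so that
  differences are formed in both entries at once; that it is a weak gradient is derived in
  \<open>H10_pair_weak_gradient\<close>.\<close>

definition H10_pair :: "'a::euclidean_space set \<Rightarrow> ('a \<Rightarrow> real) \<Rightarrow> ('a \<Rightarrow> 'a) \<Rightarrow> bool" where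
  "H10_pair \<Omega> u G \<longleftrightarrow> u \<in> L2 \<Omega> \<and> G \<in> L2 \<Omega> \<and>
     (\<exists>\<psi> :: nat \<Rightarrow> 'a \<Rightarrow> real. (\<forall>k. \<psi> k \<in> test_functions \<Omega>) \<and>
        (\<lambda>k. (LINT x|lebesgue_on \<Omega>. (u x - \<psi> k x)\<^sup>2) +
             (LINT x|lebesgue_on \<Omega>. (norm (G x - gradient (\<psi> k) x))\<^sup>2)) \<longlonglongrightarrow> 0)"

lemma H10_pairE:
  assumes "H10_pair \<Omega> u G"
  obtains \<psi> where "u \<in> L2 \<Omega>" "G \<in> L2 \<Omega>" "\<forall>k. \<psi> k \<in> test_functions \<Omega>"
    "(\<lambda>k. LINT x|lebesgue_on \<Omega>. (norm (u x - \<psi> k x))\<^sup>2) \<longlonglongrightarrow> 0"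
    "(\<lambda>k. LINT x|lebesgue_on \<Omega>. (norm (G x - gradient (\<psi> k) x))\<^sup>2) \<longlonglongrightarrow> 0"
proof -
  obtain \<psi> where \<psi>: "u \<in> L2 \<Omega>" "G \<in> L2 \<Omega>" "\<forall>k. \<psi> k \<in> test_functions \<Omega>"
    and lim: "(\<lambda>k. (LINT x|lebesgue_on \<Omega>. (u x - \<psi> k x)\<^sup>2) +
             (LINT x|lebesgue_on \<Omega>. (norm (G x - gradient (\<psi> k) x))\<^sup>2)) \<longlonglongrightarrow> 0"
    using assms unfolding H10_pair_def by blast
  have n: "0 \<le> (LINT x|lebesgue_on \<Omega>. (u x - \<psi> k x)\<^sup>2)"
    "0 \<le> (LINT x|lebesgue_on \<Omega>. (norm (G x - gradient (\<psi> k) x))\<^sup>2)" for k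
    by (rule integral_nonneg_AE, simp)+
  have l1: "(\<lambda>k. LINT x|lebesgue_on \<Omega>. (u x - \<psi> k x)\<^sup>2) \<longlonglongrightarrow> 0"
    by (rule tendsto_sandwich[OF _ _ tendsto_const lim]) (use n in \<open>auto intro!: always_eventually\<close>)
  have l2: "(\<lambda>k. LINT x|lebesgue_on \<Omega>. (norm (G x - gradient (\<psi> k) x))\<^sup>2) \<longlonglongrightarrow> 0"
    by (rule tendsto_sandwich[OF _ _ tendsto_const lim]) (use n in \<open>auto intro!: always_eventually\<close>)
  have "(\<lambda>k. LINT x|lebesgue_on \<Omega>. (norm (u x - \<psi> k x))\<^sup>2) \<longlonglongrightarrow> 0"
    using l1 by (simp only: real_norm_def power2_abs)
  from that[OF \<psi> this l2] show ?thesis .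
qed

text \<open>Integration by parts holds for each approximating test function, and both of its sides
  are L2 inner products with a fixed function, hence survive the limit.\<close>

lemma H10_pair_weak_gradient:
  assumes "H10_pair \<Omega> u G" and S: "\<Omega> \<in> sets lebesgue"
  shows "has_weak_gradient \<Omega> u G"
  unfolding has_weak_gradient_def
proof (intro conjI ballI)
  obtain \<psi> where \<psi>_: "u \<in> L2 \<Omega>" "G \<in> L2 \<Omega>" "\<forall>k. \<psi> k \<in> test_functions \<Omega>"
    "(\<lambda>k. LINT x|lebesgue_on \<Omega>. (norm (u x - \<psi> k x))\<^sup>2) \<longlonglongrightarrow> 0"
    "(\<lambda>k. LINT x|lebesgue_on \<Omega>. (norm (G x - gradient (\<psi> k) x))\<^sup>2) \<longlonglongrightarrow> 0"
    by (rule H10_pairE[OF assms(1)])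
    note \<psi> = \<psi>_(1,2) \<psi>_(3)[rule_format] \<psi>_(4,5)
  show "locally_integrable \<Omega> u" "locally_integrable \<Omega> G"
    using \<psi>(1,2) S by (auto intro: L2_locally_integrable)
  fix q :: "'a \<Rightarrow> real" and b :: 'a assume q: "q \<in> test_functions \<Omega>" and "b \<in> Basis"
  have gq: "(\<lambda>x. gradient q x \<bullet> b) \<in> L2 \<Omega>" and qb: "(\<lambda>x. q x *\<^sub>R b) \<in> L2 \<Omega>"
  proof -
    obtain K where K_: "compact K" "K \<subseteq> \<Omega>" "\<forall>x. x \<notin> K \<longrightarrow> q x = 0"
      by (rule test_functionsE[OF q])
      note K = K_(1,2) K_(3)[rule_format]
    show "(\<lambda>x. gradient q x \<bullet> b) \<in> L2 \<Omega>"
      by (rule L2_compact_support[OF _ K(1) _ S])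
        (auto intro!: continuous_intros continuous_on_gradient[OF test_functions_Ck[OF q, of "Suc 0"]]
          simp: gradient_eq_0_outside[OF compact_imp_closed[OF K(1)] K(3)])
    show "(\<lambda>x. q x *\<^sub>R b) \<in> L2 \<Omega>"
      by (rule L2_compact_support[OF _ K(1) _ S])
        (auto intro!: continuous_intros Ck_imp_continuous[OF test_functions_Ck[OF q, of "Suc 0"]] simp: K(3))
  qed
  have "(\<lambda>k. LINT x|lebesgue_on \<Omega>. \<psi> k x * (gradient q x \<bullet> b)) \<longlonglongrightarrow> (LINT x|lebesgue_on \<Omega>. u x * (gradient q x \<bullet> b))"
    using L2_tendsto_inner[OF \<psi>(1) test_functions_L2(1)[OF \<psi>(3) S] gq \<psi>(4)] by simp
  moreover have "(LINT x|lebesgue_on \<Omega>. \<psi> k x * (gradient q x \<bullet> b)) = - (LINT x|lebesgue_on \<Omega>. gradient (\<psi> k) x \<bullet> (q x *\<^sub>R b))" for k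
    using integral_by_parts_test_function[OF S q test_functions_Ck[OF \<psi>(3)[of k]], where b=b] by (simp add: mult.commute)
  moreover have "(\<lambda>k. - (LINT x|lebesgue_on \<Omega>. gradient (\<psi> k) x \<bullet> (q x *\<^sub>R b))) \<longlonglongrightarrow> - (LINT x|lebesgue_on \<Omega>. G x \<bullet> (q x *\<^sub>R b))"
    by (intro tendsto_intros L2_tendsto_inner[OF \<psi>(2) test_functions_L2(2)[OF \<psi>(3) S] qb \<psi>(5)])
  ultimately have "(LINT x|lebesgue_on \<Omega>. u x * (gradient q x \<bullet> b)) = - (LINT x|lebesgue_on \<Omega>. G x \<bullet> (q x *\<^sub>R b))"
    using LIMSEQ_unique by simp
  then show "(LINT x|lebesgue_on \<Omega>. u x * (gradient q x \<bullet> b)) = - (LINT x|lebesgue_on \<Omega>. (G x \<bullet> b) * q x)"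
    by (simp add: mult.commute)
qed

lemma H10_iff_pair:
  assumes "\<Omega> \<in> sets lebesgue"
  shows "u \<in> H10 \<Omega> \<longleftrightarrow> (\<exists>G. H10_pair \<Omega> u G)"
  using H10_pair_weak_gradient[OF _ assms] unfolding H10_def H10_pair_def by blast

lemma L2_norm_sq_add_le:
  assumes "u \<in> L2 S" "v \<in> L2 S"
  shows "(LINT x|lebesgue_on S. (norm (u x + v x))\<^sup>2)
    \<le> 2 * (LINT x|lebesgue_on S. (norm (u x))\<^sup>2) + 2 * (LINT x|lebesgue_on S. (norm (v x))\<^sup>2)"
proof -
  have "(LINT x|lebesgue_on S. (norm (u x + v x))\<^sup>2)
      \<le> (LINT x|lebesgue_on S. 2 * (norm (u x))\<^sup>2 + 2 * (norm (v x))\<^sup>2)"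
  proof (rule integral_mono)
    show "integrable (lebesgue_on S) (\<lambda>x. (norm (u x + v x))\<^sup>2)"
      by (rule L2_integrable_norm_sq[OF L2_add[OF assms]])
    show "integrable (lebesgue_on S) (\<lambda>x. 2 * (norm (u x))\<^sup>2 + 2 * (norm (v x))\<^sup>2)"
      using assms by (intro Bochner_Integration.integrable_add integrable_mult_right L2_integrable_norm_sq)
    show "(norm (u x + v x))\<^sup>2 \<le> 2 * (norm (u x))\<^sup>2 + 2 * (norm (v x))\<^sup>2" for x
    proof -
      have "(norm (u x + v x))\<^sup>2 \<le> (norm (u x) + norm (v x))\<^sup>2"
        by (intro power_mono norm_triangle_ineq) simp
      also have "\<dots> \<le> 2 * (norm (u x))\<^sup>2 + 2 * (norm (v x))\<^sup>2"
        using sum_squares_bound[of "norm (u x)" "norm (v x)"] by (simp add: power2_sum)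
      finally show ?thesis .
    qed
  qed
  also have "\<dots> = 2 * (LINT x|lebesgue_on S. (norm (u x))\<^sup>2) + 2 * (LINT x|lebesgue_on S. (norm (v x))\<^sup>2)"
    using assms by (simp add: L2_integrable_norm_sq)
  finally show ?thesis .
qed

lemma Ck_diff: "Ck k f \<Longrightarrow> Ck k g \<Longrightarrow> Ck k (\<lambda>x. f x - g x)"
  using Ck_add[of k f "\<lambda>x. - 1 * g x", OF _ Ck_mult[OF Ck_const]] by simp

lemma test_functions_diff:
  assumes "p \<in> test_functions \<Omega>" "q \<in> test_functions \<Omega>"
  shows "(\<lambda>x. p x - q x) \<in> test_functions \<Omega>"
proof -
  obtain K where K_: "compact K" "K \<subseteq> \<Omega>" "\<forall>x. x \<notin> K \<longrightarrow> p x = 0"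
    by (rule test_functionsE[OF assms(1)])
    note K = K_(1,2) K_(3)[rule_format]
  obtain L where L_: "compact L" "L \<subseteq> \<Omega>" "\<forall>x. x \<notin> L \<longrightarrow> q x = 0"
    by (rule test_functionsE[OF assms(2)])
    note L = L_(1,2) L_(3)[rule_format]
  show ?thesis
    by (rule test_functionsI[OF Ck_diff[OF assms[THEN test_functions_Ck]] compact_Un[OF K(1) L(1)]])
      (use K(2,3) L(2,3) in auto)
qed

lemma gradient_diff:
  assumes "Ck (Suc 0) p" and "Ck (Suc 0) q"
  shows "gradient (\<lambda>x. p x - q x) x = gradient p x - gradient q x"
proof (rule gradient_eqI)
  show "((\<lambda>x. p x - q x) has_derivative (\<lambda>v. (gradient p x - gradient q x) \<bullet> v)) (at x)"
    unfolding inner_diff_left by (intro has_derivative_diff has_derivative_gradient[of 0] assms)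
qed

lemma H10_pair_diff:
  assumes "H10_pair \<Omega> u G" "H10_pair \<Omega> v H" and S: "\<Omega> \<in> sets lebesgue"
  shows "H10_pair \<Omega> (\<lambda>x. u x - v x) (\<lambda>x. G x - H x)"
proof -
  obtain p where p_: "u \<in> L2 \<Omega>" "G \<in> L2 \<Omega>" "\<forall>k. p k \<in> test_functions \<Omega>"
    "(\<lambda>k. LINT x|lebesgue_on \<Omega>. (norm (u x - p k x))\<^sup>2) \<longlonglongrightarrow> 0"
    "(\<lambda>k. LINT x|lebesgue_on \<Omega>. (norm (G x - gradient (p k) x))\<^sup>2) \<longlonglongrightarrow> 0"
    by (rule H10_pairE[OF assms(1)])
    note p = p_(1,2) p_(3)[rule_format] p_(4,5)
  obtain q where q_: "v \<in> L2 \<Omega>" "H \<in> L2 \<Omega>" "\<forall>k. q k \<in> test_functions \<Omega>"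
    "(\<lambda>k. LINT x|lebesgue_on \<Omega>. (norm (v x - q k x))\<^sup>2) \<longlonglongrightarrow> 0"
    "(\<lambda>k. LINT x|lebesgue_on \<Omega>. (norm (H x - gradient (q k) x))\<^sup>2) \<longlonglongrightarrow> 0"
    by (rule H10_pairE[OF assms(2)])
    note q = q_(1,2) q_(3)[rule_format] q_(4,5)
  \<comment> \<open>Stated for a general codomain, as it serves the functions and their gradients
    alike.\<close>
  have main: "(\<lambda>k. LINT x|lebesgue_on \<Omega>. (norm ((f x - g x) - (fk k x - gk k x)))\<^sup>2) \<longlonglongrightarrow> 0"
    if "f \<in> L2 \<Omega>" "g \<in> L2 \<Omega>" "\<And>k. fk k \<in> L2 \<Omega>" "\<And>k. gk k \<in> L2 \<Omega>"
      and lim: "(\<lambda>k. LINT x|lebesgue_on \<Omega>. (norm (f x - fk k x))\<^sup>2) \<longlonglongrightarrow> 0"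
        "(\<lambda>k. LINT x|lebesgue_on \<Omega>. (norm (g x - gk k x))\<^sup>2) \<longlonglongrightarrow> 0"
    for f g :: "'a \<Rightarrow> 'b::euclidean_space" and fk gk
  proof (rule tendsto_sandwich[OF _ _ tendsto_const])
    show "(\<lambda>k. 2 * (LINT x|lebesgue_on \<Omega>. (norm (f x - fk k x))\<^sup>2) + 2 * (LINT x|lebesgue_on \<Omega>. (norm (g x - gk k x))\<^sup>2)) \<longlonglongrightarrow> 0"
      using tendsto_add[OF tendsto_mult_right_zero[OF lim(1), of 2] tendsto_mult_right_zero[OF lim(2), of 2]] by simp
    show "eventually (\<lambda>k. 0 \<le> (LINT x|lebesgue_on \<Omega>. (norm ((f x - g x) - (fk k x - gk k x)))\<^sup>2)) sequentially"
      by (intro always_eventually allI integral_nonneg_AE) simp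
    have "(LINT x|lebesgue_on \<Omega>. (norm ((f x - g x) - (fk k x - gk k x)))\<^sup>2)
        \<le> 2 * (LINT x|lebesgue_on \<Omega>. (norm (f x - fk k x))\<^sup>2) + 2 * (LINT x|lebesgue_on \<Omega>. (norm (g x - gk k x))\<^sup>2)" for k
    proof -
      have "(\<lambda>x. norm ((f x - fk k x) + (gk k x - g x))) = (\<lambda>x. norm ((f x - g x) - (fk k x - gk k x)))"
        by (simp add: algebra_simps)
      moreover have "(\<lambda>x. norm (gk k x - g x)) = (\<lambda>x. norm (g x - gk k x))"
        by (simp add: norm_minus_commute)
      ultimately show ?thesis
        using L2_norm_sq_add_le[OF L2_diff[OF that(1) that(3)] L2_diff[OF that(4) that(2)], of k k]
        by (simp add: fun_eq_iff)
    qed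
    then show "eventually (\<lambda>k. (LINT x|lebesgue_on \<Omega>. (norm ((f x - g x) - (fk k x - gk k x)))\<^sup>2)
        \<le> 2 * (LINT x|lebesgue_on \<Omega>. (norm (f x - fk k x))\<^sup>2) + 2 * (LINT x|lebesgue_on \<Omega>. (norm (g x - gk k x))\<^sup>2)) sequentially"
      by (intro always_eventually allI)
  qed
  have g: "gradient (\<lambda>x. p k x - q k x) = (\<lambda>x. gradient (p k) x - gradient (q k) x)" for k
    using gradient_diff[OF test_functions_Ck[OF p(3)] test_functions_Ck[OF q(3)]] by blast
  note l1 = main[OF p(1) q(1) test_functions_L2(1)[OF p(3) S] test_functions_L2(1)[OF q(3) S] p(4) q(4)]
  note l2 = main[OF p(2) q(2) test_functions_L2(2)[OF p(3) S] test_functions_L2(2)[OF q(3) S] p(5) q(5)]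
  show ?thesis
    unfolding H10_pair_def
  proof (intro conjI exI[of _ "\<lambda>k x. p k x - q k x"] allI)
    show "(\<lambda>x. u x - v x) \<in> L2 \<Omega>" "(\<lambda>x. G x - H x) \<in> L2 \<Omega>"
      using p q by (auto intro: L2_diff)
    show "(\<lambda>x. p k x - q k x) \<in> test_functions \<Omega>" for k
      by (rule test_functions_diff[OF p(3) q(3)])
    show "(\<lambda>k. (LINT x|lebesgue_on \<Omega>. (u x - v x - (p k x - q k x))\<^sup>2) +
          (LINT x|lebesgue_on \<Omega>. (norm (G x - H x - gradient (\<lambda>x. p k x - q k x) x))\<^sup>2)) \<longlonglongrightarrow> 0"
      unfolding g using tendsto_add[OF l1 l2] by simp
  qed
qed

text \<open>Obtained by integrating \<open>\<partial>\<^sub>b (\<psi>\<^sup>2)\<close> against the coordinate \<open>x \<bullet> b\<close>.\<close>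
lemma poincare_test_functions:
  fixes \<psi> :: "'a::euclidean_space \<Rightarrow> real"
  assumes \<psi>: "\<psi> \<in> test_functions (ball 0 R)"
  shows "(LINT x|lebesgue_on (ball 0 R). (norm (\<psi> x))\<^sup>2)
    \<le> 4 * R\<^sup>2 * (LINT x|lebesgue_on (ball 0 R). (norm (gradient \<psi> x))\<^sup>2)"
proof -
  let ?B = "ball 0 R :: 'a set"
  obtain b :: 'a where b: "b \<in> Basis" using nonempty_Basis by blast
  note ck = test_functions_Ck[OF \<psi>]
  have lin: "Ck k (\<lambda>x. x \<bullet> b)" for k by (rule Ck_bounded_linear[OF bounded_linear_inner_left])
  have gl: "gradient (\<lambda>x. x \<bullet> b) x = b" for x
    by (rule gradient_eqI) (auto intro!: derivative_eq_intros simp: inner_commute)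
  note l2 = test_functions_L2[OF \<psi>, of ?B]
  have L: "(\<lambda>x. (2 * (x \<bullet> b)) *\<^sub>R gradient \<psi> x) \<in> L2 ?B"
  proof (rule L2_bounded_mult[where C="2 * R"])
    show "(\<lambda>x. 2 * (x \<bullet> b)) \<in> borel_measurable (lebesgue_on ?B)"
      by (intro continuous_imp_measurable_on_sets_lebesgue continuous_intros) auto
    show "\<bar>2 * (x \<bullet> b)\<bar> \<le> 2 * R" if "x \<in> ?B" for x
      using that Basis_le_norm[OF b, of x] by simp
  qed (use l2 in auto)
  have "(LINT x|lebesgue_on ?B. (norm (\<psi> x))\<^sup>2) = - (LINT x|lebesgue_on ?B. (x \<bullet> b) * (gradient (\<lambda>x. \<psi> x * \<psi> x) x \<bullet> b))"
    using integral_by_parts_test_function[of ?B, OF _ test_functions_mult[OF \<psi> ck] lin, of b] b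
    by (simp add: gl power2_eq_square)
  also have "\<dots> = - (LINT x|lebesgue_on ?B. (\<psi> x *\<^sub>R b) \<bullet> ((2 * (x \<bullet> b)) *\<^sub>R gradient \<psi> x))"
    by (intro arg_cong[where f=uminus] Bochner_Integration.integral_cong)
      (simp_all add: gradient_mult[OF ck ck] inner_add_left inner_commute[of b])
  also have "\<dots> \<le> (LINT x|lebesgue_on ?B. (1/2) * (norm (\<psi> x))\<^sup>2 + (2 * R\<^sup>2) * (norm (gradient \<psi> x))\<^sup>2)"
    unfolding integral_minus[symmetric]
  proof (rule integral_mono)
    have "(\<lambda>x. \<psi> x *\<^sub>R b) \<in> L2 ?B"
      using L2_measurable[OF l2(1)] L2_integrable_norm_sq[OF l2(1)] b by (simp add: L2_def power_mult_distrib)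
    from L2_inner_integrable[OF this L]
    show "integrable (lebesgue_on ?B) (\<lambda>x. - (\<psi> x *\<^sub>R b \<bullet> (2 * (x \<bullet> b)) *\<^sub>R gradient \<psi> x))" 
      by (rule Bochner_Integration.integrable_minus)
    show "integrable (lebesgue_on ?B) (\<lambda>x. (1/2) * (norm (\<psi> x))\<^sup>2 + (2 * R\<^sup>2) * (norm (gradient \<psi> x))\<^sup>2)"
      using l2 by (intro Bochner_Integration.integrable_add integrable_mult_right L2_integrable_norm_sq) auto
    fix x assume "x \<in> space (lebesgue_on ?B)"
    then have x: "norm x < R" by simp
    define s t w where "s = \<psi> x" and "t = gradient \<psi> x \<bullet> b" and "w = x \<bullet> b"
    have t: "t\<^sup>2 \<le> (norm (gradient \<psi> x))\<^sup>2"
      using power_mono[OF Basis_le_norm[OF b, of "gradient \<psi> x"], of 2] by (simp add: t_def)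
    have w: "w\<^sup>2 \<le> R\<^sup>2"
      using power_mono[OF order_trans[OF Basis_le_norm[OF b, of x] less_imp_le[OF x]], of 2] by (simp add: w_def)
    \<comment> \<open>Completing the square leaves one half of the square of \<open>\<psi>\<close>,
      to be absorbed on the left; this doubles 2 R^2 to the final constant 4 R^2.\<close>
    have "0 \<le> (s + 2 * w * t)\<^sup>2 / 2" by simp
    also have "\<dots> = s\<^sup>2 / 2 + 2 * s * w * t + 2 * (w\<^sup>2 * t\<^sup>2)"
      by (simp add: power2_eq_square algebra_simps add_divide_distrib)
    also have "w\<^sup>2 * t\<^sup>2 \<le> R\<^sup>2 * (norm (gradient \<psi> x))\<^sup>2" using w t by (intro mult_mono) auto
    finally have "- (2 * s * w * t) \<le> s\<^sup>2 / 2 + 2 * (R\<^sup>2 * (norm (gradient \<psi> x))\<^sup>2)" by simp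
    then show "- (\<psi> x *\<^sub>R b \<bullet> (2 * (x \<bullet> b)) *\<^sub>R gradient \<psi> x) \<le> (1/2) * (norm (\<psi> x))\<^sup>2 + (2 * R\<^sup>2) * (norm (gradient \<psi> x))\<^sup>2"
      by (simp add: s_def t_def w_def inner_commute mult_ac)
  qed
  also have "\<dots> = (1/2) * (LINT x|lebesgue_on ?B. (norm (\<psi> x))\<^sup>2) + (2 * R\<^sup>2) * (LINT x|lebesgue_on ?B. (norm (gradient \<psi> x))\<^sup>2)"
    using l2 by (simp only: Bochner_Integration.integral_add integrable_mult_right L2_integrable_norm_sq
        integral_mult_right_zero sets_completionI_sets sets_lborel borel_open open_ball)
  finally show ?thesis by simp
qed

text \<open>By the Poincare inequality the approximating test functions are controlled by their
  gradients, and these tend to \<open>G\<close>, that is, to zero.\<close>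

lemma H10_pair_zero:
  assumes "H10_pair (ball 0 R) v G" and "AE x in lebesgue_on (ball 0 R). G x = 0"
  shows "AE x in lebesgue_on (ball 0 R). v x = 0"
proof -
  let ?B = "ball 0 R :: 'a set"
  have S: "?B \<in> sets lebesgue" by auto
  obtain \<psi> where \<psi>_: "v \<in> L2 ?B" "G \<in> L2 ?B" "\<forall>k. \<psi> k \<in> test_functions ?B"
    "(\<lambda>k. LINT x|lebesgue_on ?B. (norm (v x - \<psi> k x))\<^sup>2) \<longlonglongrightarrow> 0"
    "(\<lambda>k. LINT x|lebesgue_on ?B. (norm (G x - gradient (\<psi> k) x))\<^sup>2) \<longlonglongrightarrow> 0"
    by (rule H10_pairE[OF assms(1)])
    note \<psi> = \<psi>_(1,2) \<psi>_(3)[rule_format] \<psi>_(4,5)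
  note l2 = test_functions_L2[OF \<psi>(3) S]
  have g: "(LINT x|lebesgue_on ?B. (norm (G x - gradient (\<psi> k) x))\<^sup>2) = (LINT x|lebesgue_on ?B. (norm (gradient (\<psi> k) x))\<^sup>2)" for k
  proof (rule integral_lebesgue_on_cong_AE[OF S])
    show "(\<lambda>x. (norm (G x - gradient (\<psi> k) x))\<^sup>2) \<in> borel_measurable (lebesgue_on ?B)"
      using L2_measurable[OF L2_diff[OF \<psi>(2) l2(2)]] by measurable
    show "AE x in lebesgue_on ?B. (norm (G x - gradient (\<psi> k) x))\<^sup>2 = (norm (gradient (\<psi> k) x))\<^sup>2"
      using assms(2) by eventually_elim simp
  qed
  have lim: "(\<lambda>k. 2 * (LINT x|lebesgue_on ?B. (norm (v x - \<psi> k x))\<^sup>2) + 2 * (4 * R\<^sup>2 * (LINT x|lebesgue_on ?B. (norm (gradient (\<psi> k) x))\<^sup>2)))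
      \<longlonglongrightarrow> 2 * 0 + 2 * (4 * R\<^sup>2 * 0)"
    using \<psi>(4,5) unfolding g by (intro tendsto_intros)
  have le: "(LINT x|lebesgue_on ?B. (norm (v x))\<^sup>2) \<le> 2 * (LINT x|lebesgue_on ?B. (norm (v x - \<psi> k x))\<^sup>2) + 2 * (4 * R\<^sup>2 * (LINT x|lebesgue_on ?B. (norm (gradient (\<psi> k) x))\<^sup>2))" for k
    using L2_norm_sq_add_le[OF L2_diff[OF \<psi>(1) l2(1)] l2(1), of k k] poincare_test_functions[OF \<psi>(3), of k] by simp
  have "(LINT x|lebesgue_on ?B. (norm (v x))\<^sup>2) \<le> 2 * 0 + 2 * (4 * R\<^sup>2 * 0)"
    by (rule LIMSEQ_le_const[OF lim]) (use le in blast)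
  then have "(LINT x|lebesgue_on ?B. (norm (v x))\<^sup>2) \<le> 0" by simp
  moreover have "0 \<le> (LINT x|lebesgue_on ?B. (norm (v x))\<^sup>2)" by (rule integral_nonneg_AE) simp
  ultimately have "(LINT x|lebesgue_on ?B. (norm (v x))\<^sup>2) = 0" by (rule antisym)
  then have "AE x in lebesgue_on ?B. (norm (v x))\<^sup>2 = 0"
    using integral_nonneg_eq_0_iff_AE[OF L2_integrable_norm_sq[OF \<psi>(1)]] by simp
  then show ?thesis by simp
qed

text \<open>Testing both equations with u - v shows that the squared norm of its gradient has
  integral 0. The gradients in the equations and those from the closure are chosen independently, so
  they are first identified almost everywhere.\<close>

lemma weak_solution_unique:
  assumes "weak_solution (ball 0 R) (\<lambda>x. 1) f u" and "weak_solution (ball 0 R) (\<lambda>x. 1) f v"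
  shows "AE x in lebesgue_on (ball 0 R). u x = v x"
proof -
  let ?B = "ball 0 R :: 'a set"
  have S: "?B \<in> sets lebesgue" by auto
  obtain Gu where Gu: "has_weak_gradient ?B u Gu" "\<And>w Gw. w \<in> H10 ?B \<Longrightarrow> has_weak_gradient ?B w Gw \<Longrightarrow>
      (LINT x|lebesgue_on ?B. Gu x \<bullet> Gw x) = (LINT x|lebesgue_on ?B. f x * w x)" and "u \<in> H10 ?B"
    using assms(1) unfolding weak_solution_def mult_1 by blast
  obtain Gv where Gv: "has_weak_gradient ?B v Gv" "\<And>w Gw. w \<in> H10 ?B \<Longrightarrow> has_weak_gradient ?B w Gw \<Longrightarrow>
      (LINT x|lebesgue_on ?B. Gv x \<bullet> Gw x) = (LINT x|lebesgue_on ?B. f x * w x)" and "v \<in> H10 ?B"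
    using assms(2) unfolding weak_solution_def mult_1 by blast
  obtain U V where U: "H10_pair ?B u U" and V: "H10_pair ?B v V"
    using \<open>u \<in> H10 ?B\<close> \<open>v \<in> H10 ?B\<close> H10_iff_pair[OF S] by blast
  note UV = H10_pair_diff[OF U V S]
  note w = H10_pair_weak_gradient[OF UV S]
  have wH: "(\<lambda>x. u x - v x) \<in> H10 ?B" using UV H10_iff_pair[OF S] by blast
  have L2: "U \<in> L2 ?B" "V \<in> L2 ?B" "(\<lambda>x. U x - V x) \<in> L2 ?B"
    using U V UV unfolding H10_pair_def by blast+
  have "(LINT x|lebesgue_on ?B. U x \<bullet> (U x - V x)) = (LINT x|lebesgue_on ?B. Gu x \<bullet> (U x - V x))"
  proof (rule integral_lebesgue_on_cong_AE[OF S borel_measurable_integrable[OF L2_inner_integrable[OF L2(1,3)]]])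
    show "AE x in lebesgue_on ?B. U x \<bullet> (U x - V x) = Gu x \<bullet> (U x - V x)"
      using weak_gradient_unique[OF H10_pair_weak_gradient[OF U S] Gu(1)] by eventually_elim simp
  qed
  also have "\<dots> = (LINT x|lebesgue_on ?B. Gv x \<bullet> (U x - V x))"
    using Gu(2)[OF wH w] Gv(2)[OF wH w] by simp
  also have "\<dots> = (LINT x|lebesgue_on ?B. V x \<bullet> (U x - V x))"
  proof (rule integral_lebesgue_on_cong_AE[OF S borel_measurable_integrable[OF L2_inner_integrable[OF L2(2,3)]], symmetric])
    show "AE x in lebesgue_on ?B. V x \<bullet> (U x - V x) = Gv x \<bullet> (U x - V x)"
      using weak_gradient_unique[OF H10_pair_weak_gradient[OF V S] Gv(1)] by eventually_elim simp
  qed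
  finally have "(LINT x|lebesgue_on ?B. U x \<bullet> (U x - V x) - V x \<bullet> (U x - V x)) = 0"
    using Bochner_Integration.integral_diff[OF L2_inner_integrable[OF L2(1,3)] L2_inner_integrable[OF L2(2,3)]] by simp
  then have "(LINT x|lebesgue_on ?B. (norm (U x - V x))\<^sup>2) = 0"
    by (simp only: inner_diff_left[symmetric] power2_norm_eq_inner)
  then have "AE x in lebesgue_on ?B. (norm (U x - V x))\<^sup>2 = 0"
    using integral_nonneg_eq_0_iff_AE[OF L2_integrable_norm_sq[OF L2(3)]] by simp
  then have "AE x in lebesgue_on ?B. U x - V x = 0" by simp
  from H10_pair_zero[OF UV this] show ?thesis by simp
qed

section \<open>Polar coordinates and the flux of a radial density\<close>

text \<open>Finite measures on the line are determined by the rays above t. There the left side is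
  the volume of the shell between radii t and R, and the right side is the integral of the
  derivative of that volume.\<close>

lemma distr_norm_ball:
  assumes R: "R > 0"
  shows "distr (restrict_space lborel (ball (0 :: 'a::euclidean_space) R)) borel norm =
    density lborel (\<lambda>t. ennreal (real DIM('a) * unit_ball_vol (real DIM('a)) * t ^ (DIM('a) - 1)
      * indicator {0<..<R} t))"
    (is "?M = ?N")
proof (rule measure_eqI_lessThan)
  define n where "n = DIM('a)"
  define c where "c = unit_ball_vol (real n)"
  have n: "n > 0" and c: "c > 0" by (simp_all add: n_def c_def)
  let ?B = "ball (0 :: 'a) R"
  show "sets ?M = sets borel" "sets ?N = sets borel" by simp_all
  have nm: "norm \<in> measurable (restrict_space lborel ?B) borel"
    by (rule measurable_restrict_space1) simp
  have M: "emeasure ?M {t<..} = emeasure lborel {x \<in> ?B. t < norm x}" for t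
  proof -
    have "emeasure ?M {t<..} = emeasure (restrict_space lborel ?B) (norm -` {t<..} \<inter> space (restrict_space lborel ?B))"
      by (rule emeasure_distr[OF nm]) simp
    also have "norm -` {t<..} \<inter> space (restrict_space lborel ?B) = {x \<in> ?B. t < norm x}"
      by (auto simp: space_restrict_space)
    also have "emeasure (restrict_space lborel ?B) {x \<in> ?B. t < norm x} = emeasure lborel {x \<in> ?B. t < norm x}"
      by (rule emeasure_restrict_space) auto
    finally show ?thesis .
  qed
  have "emeasure lborel {x \<in> ?B. t < norm x} \<le> emeasure lborel ?B" for t
    by (rule emeasure_mono) auto
  then show "emeasure ?M {t<..} < \<infinity>" for t
    unfolding M by (rule le_less_trans) (rule emeasure_lborel_ball_finite)
  fix t :: real
  have "emeasure ?N {t<..} = (\<integral>\<^sup>+s. ennreal (real n * c * s ^ (n - 1) * indicator {0<..<R} s) * indicator {t<..} s \<partial>lborel)"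
    unfolding n_def c_def by (rule emeasure_density) auto
  \<comment> \<open>For negative t the whole ball is counted, whence the lower radius
    \<open>max 0 t\<close>.\<close>
  also have "\<dots> = (if t < R then ennreal (c * R ^ n - c * max 0 t ^ n) else 0)"
  proof (cases "t < R")
    case True
    let ?a = "max 0 t"
    have "(\<integral>\<^sup>+s. ennreal (real n * c * s ^ (n - 1) * indicator {0<..<R} s) * indicator {t<..} s \<partial>lborel)
      = (\<integral>\<^sup>+s. ennreal (if s \<in> {?a..R} then real n * c * s ^ (n - 1) else 0) * indicator {?a..R} s \<partial>lborel)"
    proof (rule nn_integral_cong_AE)
      show "AE s in lborel. ennreal (real n * c * s ^ (n - 1) * indicator {0<..<R} s) * indicator {t<..} s =
          ennreal (if s \<in> {?a..R} then real n * c * s ^ (n - 1) else 0) * indicator {?a..R} s"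
        using AE_lborel_singleton[of ?a] AE_lborel_singleton[of R]
        by eventually_elim (auto split: split_indicator)
    qed
    also have "\<dots> = ennreal (c * R ^ n - c * ?a ^ n)"
    proof (rule nn_integral_FTC_Icc)
      show "((\<lambda>s. c * s ^ n) has_real_derivative (if s \<in> {?a..R} then real n * c * s ^ (n - 1) else 0)) (at s)"
        if "s \<in> {?a..R}" for s
        using that by (auto intro!: derivative_eq_intros)
    qed (use c True R in auto)
    finally show ?thesis using True by simp
  next
    case False
    then have "(\<lambda>s. ennreal (real n * c * s ^ (n - 1) * indicator {0<..<R} s) * indicator {t<..} s) = (\<lambda>s. 0)"
      by (intro ext) (auto split: split_indicator)
    then show ?thesis using False by simp
  qed
  also have "\<dots> = emeasure lborel {x \<in> ?B. t < norm x}"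
  proof -
    consider "t < 0" | "0 \<le> t" "t < R" | "R \<le> t" by linarith
    then show ?thesis
    proof cases
      case 1
      then have "{x \<in> ?B. t < norm x} = ?B" using norm_ge_zero less_le_trans by blast
      then show ?thesis using 1 R n emeasure_ball[of R "0 :: 'a"] by (simp add: n_def[symmetric] c_def[symmetric] zero_power)
    next
      case 2
      then have "{x \<in> ?B. t < norm x} = ?B - cball 0 t" by auto
      moreover have "emeasure lborel (?B - cball 0 t) = emeasure lborel ?B - emeasure lborel (cball (0::'a) t)"
        using emeasure_lborel_cball_finite[of "0 :: 'a" t] 2
        by (intro emeasure_Diff) (auto simp: subset_iff)
      ultimately show ?thesis
        using 2 R c emeasure_ball[of R "0 :: 'a"] emeasure_cball[of t "0 :: 'a"]
        by (simp add: n_def[symmetric] c_def[symmetric] ennreal_minus)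
    next
      case 3
      then have e: "{x \<in> ?B. t < norm x} = {}" by auto
      show ?thesis unfolding e using 3 by simp
    qed
  qed
  finally show "emeasure ?M {t<..} = emeasure ?N {t<..}" by (simp only: M)
qed

text \<open>The polar weight is positive exactly on ]0, R[, so the image of the measure on the ball
  has the same null sets as Lebesgue measure on that interval.\<close>

lemma AE_ball_norm_iff:
  assumes R: "R > 0" and P: "{t. P t} \<in> sets borel"
  shows "(AE x in lebesgue_on (ball (0 :: 'a::euclidean_space) R). P (norm x))
    \<longleftrightarrow> (AE t in lborel. t \<in> {0<..<R} \<longrightarrow> P t)"
proof -
  let ?B = "ball (0 :: 'a) R"
  have nm: "norm \<in> measurable (restrict_space lborel ?B) borel"
    by (rule measurable_restrict_space1) simp
  have "(AE x in lebesgue_on ?B. P (norm x)) \<longleftrightarrow> (AE x in restrict_space lborel ?B. P (norm x))"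
    by (simp add: AE_lebesgue_on_iff AE_restrict_space_iff AE_completion_iff)
  also have "\<dots> \<longleftrightarrow> (AE t in distr (restrict_space lborel ?B) borel norm. P t)"
    by (rule AE_distr_iff[symmetric, OF nm]) (use P in simp)
  also have "\<dots> \<longleftrightarrow> (AE t in lborel. 0 < ennreal (real DIM('a) * unit_ball_vol (real DIM('a)) * t ^ (DIM('a) - 1)
      * indicator {0<..<R} t) \<longrightarrow> P t)"
    unfolding distr_norm_ball[OF R] by (rule AE_density) simp
  also have "(\<lambda>t. 0 < ennreal (real DIM('a) * unit_ball_vol (real DIM('a)) * t ^ (DIM('a) - 1)
      * indicator {0<..<R} t) \<longrightarrow> P t) = (\<lambda>t. t \<in> {0<..<R} \<longrightarrow> P t)"
    by (intro ext) (auto simp: ennreal_zero_less_mult_iff split: split_indicator)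
  finally show ?thesis .
qed

text \<open>For arbitrary \<open>P\<close> the exceptional set is enclosed in a Borel null set, to
  which the preceding equivalence applies.\<close>

lemma AE_ball_normI:
  assumes R: "R > 0" and P: "AE t in lborel. t \<in> {0<..<R} \<longrightarrow> P t"
  shows "AE x in lebesgue_on (ball (0 :: 'a::euclidean_space) R). P (norm x)"
proof -
  obtain N where N: "{t \<in> space lborel. \<not> (t \<in> {0<..<R} \<longrightarrow> P t)} \<subseteq> N" "emeasure lborel N = 0" "N \<in> sets lborel"
    using AE_E[OF P] by blast
  have S: "ball (0 :: 'a) R \<in> sets lebesgue" by auto
  have "AE t in lborel. t \<notin> N" using N by (intro AE_not_in) auto
  \<comment> \<open>The centre is excluded too, so that the norm lands in the open interval.\<close>
  then have "AE t in lborel. t \<in> {0<..<R} \<longrightarrow> t \<notin> N \<and> t \<noteq> 0" by eventually_elim auto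
  then have "AE x in lebesgue_on (ball (0 :: 'a) R). norm x \<notin> N \<and> norm x \<noteq> 0"
    using N(3) by (subst AE_ball_norm_iff[OF R, of "\<lambda>t. t \<notin> N \<and> t \<noteq> 0"]) auto
  then show ?thesis
    unfolding AE_lebesgue_on_iff[OF S]
  proof eventually_elim
    case (elim x)
    show ?case
    proof
      assume "x \<in> ball 0 R"
      then have "norm x \<notin> N" "norm x \<in> {0<..<R}" using elim by auto
      then show "P (norm x)" using subsetD[OF N(1), of "norm x"] by auto
    qed
  qed
qed

text \<open>On ]0, R[ the polar weight is at most a constant times R^(n-1), so integrability with
  respect to dt is enough on the ball.\<close>

lemma integrable_ball_norm:
  assumes R: "R > 0" and h: "integrable lborel h"
  shows "integrable (lebesgue_on (ball (0 :: 'a::euclidean_space) R)) (\<lambda>x. h (norm x) :: real)"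
proof -
  let ?B = "ball (0 :: 'a) R"
  define k where "k = real DIM('a) * unit_ball_vol (real DIM('a))"
  have hm: "h \<in> borel_measurable borel" using h by auto
  have nm: "norm \<in> measurable (restrict_space lborel ?B) borel"
    by (rule measurable_restrict_space1) simp
  have "integrable lborel (\<lambda>t. (k * t ^ (DIM('a) - 1) * indicator {0<..<R} t) *\<^sub>R h t)"
  proof (rule Bochner_Integration.integrable_bound)
    show "integrable lborel (\<lambda>t. (k * R ^ (DIM('a) - 1)) * h t)" using h by (rule integrable_mult_right)
    show "AE t in lborel. norm ((k * t ^ (DIM('a) - 1) * indicator {0<..<R} t) *\<^sub>R h t)
        \<le> norm ((k * R ^ (DIM('a) - 1)) * h t)"
      using R by (intro AE_I2) (auto simp: k_def abs_mult power_abs split: split_indicator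
          intro!: mult_mono power_mono)
  qed (use hm in auto)
  then have "integrable (density lborel (\<lambda>t. ennreal (k * t ^ (DIM('a) - 1) * indicator {0<..<R} t))) h"
    by (subst integrable_density) (use hm in \<open>auto simp: k_def split: split_indicator\<close>)
  then have "integrable (restrict_space lborel ?B) (\<lambda>x. h (norm x))"
    using distr_norm_ball[OF R, where 'a='a] integrable_distr_eq[OF nm hm] by (simp add: k_def)
  then have "integrable lborel (\<lambda>x. indicator ?B x *\<^sub>R h (norm x))"
    by (simp add: integrable_restrict_space)
  from integrable_lebesgue_on_lborel[OF this, of ?B]
  have "integrable (lebesgue_on ?B) (\<lambda>x. indicator ?B x *\<^sub>R h (norm x))" by simp
  then show ?thesis
    by (rule Bochner_Integration.integrable_cong[THEN iffD1, OF refl, rotated]) simp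
qed

section \<open>Mass and flux of a radial density as integrals in one variable\<close>

text \<open>This is the integral of F(|x|) over the ball of radius t, divided by the area of the
  unit sphere. With n = 1 it is the unweighted integral, in which role it bounds the flux in every
  dimension.\<close>

definition radial_mass :: "nat \<Rightarrow> (real \<Rightarrow> real) \<Rightarrow> real \<Rightarrow> real" where
  "radial_mass n F t = (LBINT s. indicator {0<..<t} s * s ^ (n - 1) * F s)"

text \<open>\<open>flux n F t\<close> solves \<open>(t\<^sup>n\<^sup>-\<^sup>1 P)' = t\<^sup>n\<^sup>-\<^sup>1 F\<close>, so that \<open>- flux n F\<close> is the radial derivative
  of the solution of \<open>-\<Delta>\<phi> = F\<close>.\<close>
definition flux :: "nat \<Rightarrow> (real \<Rightarrow> real) \<Rightarrow> real \<Rightarrow> real" where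
  "flux n F t = radial_mass n F t / t ^ (n - 1)"

text \<open>Extension by zero turns all integrals of profiles into integrals over the line, and it
  bounds the weight s^(n-1) by R^(n-1) wherever it matters.\<close>

definition radial_density :: "real \<Rightarrow> (real \<Rightarrow> real) \<Rightarrow> bool" where
  "radial_density R F \<longleftrightarrow> integrable lborel F \<and> (\<forall>t. t \<notin> {0<..<R} \<longrightarrow> F t = 0)"

lemma radial_densityD:
  assumes "radial_density R F"
  shows "integrable lborel F" "F \<in> borel_measurable borel" "t \<notin> {0<..<R} \<Longrightarrow> F t = 0"
  using assms borel_measurable_integrable[of lborel F] by (auto simp: radial_density_def)

lemma radial_mass_integrand_bound:
  fixes F :: "real \<Rightarrow> real"
  assumes "\<And>t. t \<notin> {0<..<R} \<Longrightarrow> F t = 0"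
  shows "\<bar>indicator {0<..<t} s * s ^ (n - 1) * F s\<bar> \<le> R ^ (n - 1) * \<bar>F s\<bar>"
proof (cases "s \<in> {0<..<R}")
  case True
  then have "s ^ (n - 1) * \<bar>F s\<bar> \<le> R ^ (n - 1) * \<bar>F s\<bar>" by (intro mult_right_mono power_mono) auto
  then show ?thesis using True by (auto simp: abs_mult split: split_indicator)
qed (simp add: assms)

lemma radial_mass_integrable:
  assumes F: "radial_density R F"
  shows "integrable lborel (\<lambda>s. indicator {0<..<t} s * s ^ (n - 1) * F s)"
proof (rule Bochner_Integration.integrable_bound)
  note D = radial_densityD[OF F]
  show "integrable lborel (\<lambda>s. R ^ (n - 1) * F s)" using D(1) by (rule integrable_mult_right)
  show "(\<lambda>s. indicator {0<..<t} s * s ^ (n - 1) * F s) \<in> borel_measurable lborel" using D(2) by measurable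
  show "AE s in lborel. norm (indicator {0<..<t} s * s ^ (n - 1) * F s) \<le> norm (R ^ (n - 1) * F s)"
  proof (intro AE_I2)
    fix s
    have "\<bar>indicator {0<..<t} s * s ^ (n - 1) * F s\<bar> \<le> R ^ (n - 1) * \<bar>F s\<bar>"
      by (rule radial_mass_integrand_bound[OF D(3)])
    also have "\<dots> \<le> \<bar>R ^ (n - 1) * F s\<bar>" unfolding abs_mult by (intro mult_right_mono) auto
    finally show "norm (indicator {0<..<t} s * s ^ (n - 1) * F s) \<le> norm (R ^ (n - 1) * F s)" by simp
  qed
qed

lemma radial_density_abs: "radial_density R F \<Longrightarrow> radial_density R (\<lambda>t. \<bar>F t\<bar>)"
  by (auto simp: radial_density_def)

lemma radial_mass_tendsto:
  assumes "\<And>k. radial_density R (Fk k)" and "radial_density R F" and H: "integrable lborel H"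
    and "\<And>k s. \<bar>Fk k s\<bar> \<le> H s" and lim: "AE s in lborel. (\<lambda>k. Fk k s) \<longlonglongrightarrow> F s"
  shows "(\<lambda>k. radial_mass n (Fk k) t) \<longlonglongrightarrow> radial_mass n F t"
  unfolding radial_mass_def
proof (rule integral_dominated_convergence)
  note D = radial_densityD[OF assms(1)] radial_densityD[OF assms(2)]
  show "(\<lambda>s. indicator {0<..<t} s * s ^ (n - 1) * F s) \<in> borel_measurable lborel"
    "(\<lambda>s. indicator {0<..<t} s * s ^ (n - 1) * Fk k s) \<in> borel_measurable lborel" for k
    using D(2)[of k] D(5) by measurable
  show "integrable lborel (\<lambda>s. \<bar>R\<bar> ^ (n - 1) * H s)" using H by (rule integrable_mult_right)
  show "AE s in lborel. (\<lambda>k. indicator {0<..<t} s * s ^ (n - 1) * Fk k s) \<longlonglongrightarrow> indicator {0<..<t} s * s ^ (n - 1) * F s"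
    using lim by eventually_elim (intro tendsto_intros)
  show "AE s in lborel. norm (indicator {0<..<t} s * s ^ (n - 1) * Fk k s) \<le> \<bar>R\<bar> ^ (n - 1) * H s" for k
  proof (intro AE_I2)
    fix s
    have "\<bar>indicator {0<..<t} s * s ^ (n - 1) * Fk k s\<bar> \<le> R ^ (n - 1) * \<bar>Fk k s\<bar>"
      by (rule radial_mass_integrand_bound[OF D(3)])
    also have "\<dots> \<le> \<bar>R\<bar> ^ (n - 1) * H s"
      using assms(4)[of k s] by (intro mult_mono) (auto simp: power_abs[symmetric])
    finally show "norm (indicator {0<..<t} s * s ^ (n - 1) * Fk k s) \<le> \<bar>R\<bar> ^ (n - 1) * H s" by simp
  qed
qed

lemma continuous_on_radial_mass:
  assumes F: "radial_density R F"
  shows "continuous_on UNIV (radial_mass n F)"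
  unfolding continuous_on_sequentially
proof (intro allI ballI impI, elim conjE)
  fix x t assume x: "x \<longlonglongrightarrow> (t :: real)"
  note D = radial_densityD[OF F]
  show "(radial_mass n F \<circ> x) \<longlonglongrightarrow> radial_mass n F t"
    unfolding comp_def radial_mass_def
  proof (rule integral_dominated_convergence)
    show "(\<lambda>s. indicator {0<..<t} s * s ^ (n - 1) * F s) \<in> borel_measurable lborel"
      "(\<lambda>s. indicator {0<..<x k} s * s ^ (n - 1) * F s) \<in> borel_measurable lborel" for k
      using D(2) by measurable
    show "integrable lborel (\<lambda>s. R ^ (n - 1) * \<bar>F s\<bar>)" using D(1) by auto
    show "AE s in lborel. norm (indicator {0<..<x k} s * s ^ (n - 1) * F s) \<le> R ^ (n - 1) * \<bar>F s\<bar>" for k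
      unfolding real_norm_def by (intro AE_I2 radial_mass_integrand_bound[OF D(3)])
    show "AE s in lborel. (\<lambda>k. indicator {0<..<x k} s * s ^ (n - 1) * F s) \<longlonglongrightarrow> indicator {0<..<t} s * s ^ (n - 1) * F s"
      using AE_lborel_singleton[of t]
    proof eventually_elim
      case (elim s)
      have "eventually (\<lambda>k. s < x k \<longleftrightarrow> s < t) sequentially"
        using order_tendstoD[OF x, of s] elim by (cases "s < t") (auto elim!: eventually_mono)
      then have "eventually (\<lambda>k. indicator {0<..<x k} s * s ^ (n - 1) * F s = indicator {0<..<t} s * s ^ (n - 1) * F s) sequentially"
        by eventually_elim (auto simp: indicator_def)
      then show ?case by (rule tendsto_eventually)
    qed
  qed
qed

text \<open>For s < t the weight s^(n-1) is at most t^(n-1), which cancels the denominator of the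
  flux. The resulting bound does not depend on the dimension and tends to 0 with t.\<close>

lemma flux_abs_le:
  assumes F: "radial_density R F"
  shows "\<bar>flux n F t\<bar> \<le> radial_mass 1 (\<lambda>s. \<bar>F s\<bar>) t"
proof (cases "t > 0")
  case True
  have "\<bar>radial_mass n F t\<bar> \<le> (LBINT s. \<bar>indicator {0<..<t} s * s ^ (n - 1) * F s\<bar>)"
    unfolding radial_mass_def by (rule integral_abs_bound)
  also have "\<dots> \<le> (LBINT s. t ^ (n - 1) * (indicator {0<..<t} s * s ^ (1 - 1) * \<bar>F s\<bar>))"
  proof (rule integral_mono)
    show "integrable lborel (\<lambda>s. \<bar>indicator {0<..<t} s * s ^ (n - 1) * F s\<bar>)"
      using radial_mass_integrable[OF F] by (rule integrable_abs)
    show "integrable lborel (\<lambda>s. t ^ (n - 1) * (indicator {0<..<t} s * s ^ (1 - 1) * \<bar>F s\<bar>))"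
      by (intro integrable_mult_right radial_mass_integrable[OF radial_density_abs[OF F]])
    show "\<bar>indicator {0<..<t} s * s ^ (n - 1) * F s\<bar> \<le> t ^ (n - 1) * (indicator {0<..<t} s * s ^ (1 - 1) * \<bar>F s\<bar>)" for s
      by (auto simp: abs_mult split: split_indicator intro!: mult_right_mono power_mono)
  qed
  also have "\<dots> = t ^ (n - 1) * radial_mass 1 (\<lambda>s. \<bar>F s\<bar>) t"
    unfolding radial_mass_def by simp
  finally have le: "\<bar>radial_mass n F t\<bar> \<le> t ^ (n - 1) * radial_mass 1 (\<lambda>s. \<bar>F s\<bar>) t" .
  have "\<bar>flux n F t\<bar> = \<bar>radial_mass n F t\<bar> / t ^ (n - 1)"
    unfolding flux_def abs_divide using True by simp
  also have "\<dots> \<le> t ^ (n - 1) * radial_mass 1 (\<lambda>s. \<bar>F s\<bar>) t / t ^ (n - 1)"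
    by (rule divide_right_mono[OF le]) (use True in simp)
  also have "\<dots> = radial_mass 1 (\<lambda>s. \<bar>F s\<bar>) t" using True by simp
  finally show ?thesis .
next
  case False
  then have "{0<..<t} = {}" by auto
  then show ?thesis by (simp add: flux_def radial_mass_def)
qed

lemma radial_mass_abs_le:
  assumes F: "radial_density R F"
  shows "radial_mass 1 (\<lambda>s. \<bar>F s\<bar>) t \<le> (LBINT s. \<bar>F s\<bar>)"
  unfolding radial_mass_def
proof (rule integral_mono)
  show "integrable lborel (\<lambda>s. indicator {0<..<t} s * s ^ (1 - 1) * \<bar>F s\<bar>)"
    by (intro radial_mass_integrable[OF radial_density_abs[OF F]])
  show "integrable lborel (\<lambda>s. \<bar>F s\<bar>)" using radial_densityD(1)[OF F] by auto
qed (auto split: split_indicator)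

lemma flux_0: "flux n F 0 = 0"
  by (simp add: flux_def radial_mass_def)

lemma flux_nonneg:
  assumes "\<And>s. F s \<ge> 0" and "t \<ge> 0"
  shows "flux n F t \<ge> 0"
  unfolding flux_def radial_mass_def using assms
  by (intro divide_nonneg_nonneg integral_nonneg_AE AE_I2) (auto split: split_indicator)

lemma continuous_on_flux:
  assumes F: "radial_density R F"
  shows "continuous_on {0..} (flux n F)"
  unfolding continuous_on_eq_continuous_within
proof
  fix t :: real assume "t \<in> {0..}"
  have rm: "isCont (radial_mass k G) t" if "radial_density R G" for k G t
    using continuous_on_radial_mass[OF that] by (simp add: continuous_on_eq_continuous_at)
  show "continuous (at t within {0..}) (flux n F)"
  proof (cases "t = 0")
    case True
    \<comment> \<open>At the centre the quotient defining the flux degenerates; continuity is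
      obtained by squeezing it under the unweighted mass.\<close>
    have "(radial_mass 1 (\<lambda>s. \<bar>F s\<bar>) \<longlongrightarrow> radial_mass 1 (\<lambda>s. \<bar>F s\<bar>) 0) (at 0 within {0..})"
      using continuous_at_imp_continuous_at_within[OF rm[OF radial_density_abs[OF F]]]
      unfolding continuous_within .
    then have "(radial_mass 1 (\<lambda>s. \<bar>F s\<bar>) \<longlongrightarrow> 0) (at 0 within {0..})"
      by (simp add: radial_mass_def)
    then have "(flux n F \<longlongrightarrow> 0) (at 0 within {0..})"
      by (rule Lim_null_comparison[rotated]) (intro always_eventually allI, simp only: real_norm_def flux_abs_le[OF F])
    then show ?thesis using True by (simp add: continuous_within flux_0)
  next
    case False
    then have "isCont (flux n F) t"
      unfolding flux_def[abs_def] using rm[OF F] by (intro continuous_intros) auto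
    then show ?thesis by (rule continuous_at_imp_continuous_at_within)
  qed
qed

lemma borel_measurable_flux:
  assumes F: "radial_density R F"
  shows "flux n F \<in> borel_measurable borel"
proof -
  have "radial_mass n F \<in> borel_measurable borel"
    by (rule borel_measurable_continuous_onI[OF continuous_on_radial_mass[OF F]])
  then show ?thesis unfolding flux_def[abs_def] by measurable
qed

text \<open>For the radial solution of -div(A grad u) = F(|x|) one has A grad u = -
  \<open>flux_field F\<close>. At the origin the field is 0, in accordance with the limit of the
  flux.\<close>

definition flux_field :: "(real \<Rightarrow> real) \<Rightarrow> 'a::euclidean_space \<Rightarrow> 'a" where
  "flux_field F x = (flux DIM('a) F (norm x) / norm x) *\<^sub>R x"

lemma norm_flux_field:
  assumes "radial_density R F"
  shows "norm (flux_field F x) \<le> (LBINT s. \<bar>F s\<bar>)"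
proof -
  have "norm (flux_field F x) \<le> \<bar>flux DIM('a) F (norm x)\<bar>"
    by (cases "x = 0") (simp_all add: flux_field_def)
  also have "\<dots> \<le> (LBINT s. \<bar>F s\<bar>)"
    using flux_abs_le[OF assms] radial_mass_abs_le[OF assms] by (rule order_trans)
  finally show ?thesis .
qed

lemma borel_measurable_flux_field:
  assumes "radial_density R F"
  shows "(flux_field F :: 'a::euclidean_space \<Rightarrow> 'a) \<in> borel_measurable borel"
proof -
  have "(\<lambda>x :: 'a. flux DIM('a) F (norm x)) \<in> borel_measurable borel"
    by (rule measurable_compose[OF _ borel_measurable_flux[OF assms]]) simp
  then show ?thesis
    unfolding flux_field_def[abs_def] by (intro borel_measurable_scaleR borel_measurable_divide) simp_all
qed

section \<open>The divergence of the flux field\<close>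

text \<open>The weak form of the statement that \<open>flux_field F\<close> has divergence F(|x|).
  The type argument records the dimension, which the type of \<open>F\<close> does not
  mention.\<close>

definition flux_identity :: "'a::euclidean_space itself \<Rightarrow> real \<Rightarrow> (real \<Rightarrow> real) \<Rightarrow> bool" where
  "flux_identity _ R F \<longleftrightarrow> (\<forall>\<psi>\<in>test_functions (ball (0 :: 'a) R).
     (LINT x|lebesgue_on (ball 0 R). flux_field F x \<bullet> gradient \<psi> x)
     = - (LINT x|lebesgue_on (ball 0 R). F (norm x) * \<psi> x))"

lemma test_function_bounded:
  fixes \<psi> :: "'a::euclidean_space \<Rightarrow> real"
  assumes "\<psi> \<in> test_functions \<Omega>"
  obtains C where "\<forall>x. \<bar>\<psi> x\<bar> \<le> C" and "\<forall>x. norm (gradient \<psi> x) \<le> C"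
proof -
  obtain K where K_: "compact K" "K \<subseteq> \<Omega>" "\<forall>x. x \<notin> K \<longrightarrow> \<psi> x = 0"
    by (rule test_functionsE[OF assms])
  note K = K_(1,2) K_(3)[rule_format]
  note ck = test_functions_Ck[OF assms, of "Suc 0"]
  have bd: "\<exists>C. \<forall>x\<in>K. norm (q x) \<le> C" if "continuous_on UNIV q" for q :: "'a \<Rightarrow> 'b::real_normed_vector"
  proof -
    have "bounded (q ` K)"
      by (rule compact_imp_bounded[OF compact_continuous_image[OF continuous_on_subset[OF that] K(1)]]) simp
    then show ?thesis unfolding bounded_iff by simp
  qed
  obtain C1 where C1: "\<And>x. x \<in> K \<Longrightarrow> norm (\<psi> x) \<le> C1" using bd[OF Ck_imp_continuous[OF ck]] by blast
  obtain C2 where C2: "\<And>x. x \<in> K \<Longrightarrow> norm (gradient \<psi> x) \<le> C2" using bd[OF continuous_on_gradient[OF ck]] by blast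
  define C where "C = max 0 (max C1 C2)"
  have "\<bar>\<psi> x\<bar> \<le> C" for x
    using C1[of x] K(3)[of x] by (cases "x \<in> K") (auto simp: C_def)
  moreover have "norm (gradient \<psi> x) \<le> C" for x
    using C2[of x] gradient_eq_0_outside[OF compact_imp_closed[OF K(1)] K(3), where x=x]
    by (cases "x \<in> K") (auto simp: C_def)
  ultimately show ?thesis using that by blast
qed

text \<open>The majorant \<open>H\<close> bounds all flux fields by its integral and all densities
  by H(|x|), so both sides pass to the limit. Every enlargement of the class of densities goes
  through this lemma.\<close>

lemma flux_identity_limit:
  assumes R: "R > 0" and Fk: "\<And>k. radial_density R (Fk k)" and F: "radial_density R F"
    and H: "integrable lborel H" and bd: "\<And>k s. \<bar>Fk k s\<bar> \<le> H s"
    and lim: "AE s in lborel. (\<lambda>k. Fk k s) \<longlonglongrightarrow> F s"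
    and eq: "\<And>k. flux_identity TYPE('a::euclidean_space) R (Fk k)"
  shows "flux_identity TYPE('a) R F"
  unfolding flux_identity_def
proof
  let ?B = "ball (0 :: 'a) R"
  fix \<psi> :: "'a \<Rightarrow> real" assume \<psi>: "\<psi> \<in> test_functions ?B"
  obtain C where C: "\<forall>x. \<bar>\<psi> x\<bar> \<le> C" "\<forall>x. norm (gradient \<psi> x) \<le> C" by (rule test_function_bounded[OF \<psi>])
  have C0: "C \<ge> 0" using C(1)[rule_format, of 0] abs_ge_zero[of "\<psi> 0"] by linarith
  have S: "?B \<in> sets lebesgue" and L: "?B \<in> lmeasurable" by auto
  note l2 = test_functions_L2[OF \<psi> S]
  have H0: "H s \<ge> 0" for s using bd[of 0 s] abs_ge_zero[of "Fk 0 s"] by linarith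
  have vm: "flux_field G \<in> borel_measurable (lebesgue_on ?B)" if "radial_density R G" for G
    using borel_measurable_flux_field[OF that, where 'a='a]
    by (intro measurable_restrict_space1 measurable_completion) simp
  have fm: "(\<lambda>x. G (norm x)) \<in> borel_measurable (lebesgue_on ?B)" if "radial_density R G" for G
    using borel_measurable_integrable[OF integrable_ball_norm[OF R radial_densityD(1)[OF that]]] .
  have "(\<lambda>k. LINT x|lebesgue_on ?B. flux_field (Fk k) x \<bullet> gradient \<psi> x)
      \<longlonglongrightarrow> (LINT x|lebesgue_on ?B. flux_field F x \<bullet> gradient \<psi> x)"
  proof (rule integral_dominated_convergence)
    show "(\<lambda>x. flux_field F x \<bullet> gradient \<psi> x) \<in> borel_measurable (lebesgue_on ?B)"
      "(\<lambda>x. flux_field (Fk k) x \<bullet> gradient \<psi> x) \<in> borel_measurable (lebesgue_on ?B)" for k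
      by (intro borel_measurable_inner vm F Fk L2_measurable[OF l2(2)])+
    show "integrable (lebesgue_on ?B) (\<lambda>x. (LBINT s. H s) * C)"
      by (rule integrable_lebesgue_on_bounded[OF L, where C="\<bar>(LBINT s. H s) * C\<bar>"]) auto
    show "AE x in lebesgue_on ?B. norm (flux_field (Fk k) x \<bullet> gradient \<psi> x) \<le> (LBINT s. H s) * C" for k
    proof (intro AE_I2)
      fix x :: 'a
      have "(LBINT s. \<bar>Fk k s\<bar>) \<le> (LBINT s. H s)"
        using radial_densityD(1)[OF Fk] H bd by (intro integral_mono) auto
      then have "norm (flux_field (Fk k) x) \<le> (LBINT s. H s)"
        using norm_flux_field[OF Fk] order_trans by blast
      then have "norm (flux_field (Fk k) x) * norm (gradient \<psi> x) \<le> (LBINT s. H s) * C"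
        using C by (intro mult_mono order_trans[OF norm_ge_zero]) auto
      then show "norm (flux_field (Fk k) x \<bullet> gradient \<psi> x) \<le> (LBINT s. H s) * C"
        using Cauchy_Schwarz_ineq2[of "flux_field (Fk k) x" "gradient \<psi> x"] by simp
    qed
    show "AE x in lebesgue_on ?B. (\<lambda>k. flux_field (Fk k) x \<bullet> gradient \<psi> x) \<longlonglongrightarrow> flux_field F x \<bullet> gradient \<psi> x"
    proof (intro AE_I2)
      fix x :: 'a
      show "(\<lambda>k. flux_field (Fk k) x \<bullet> gradient \<psi> x) \<longlonglongrightarrow> flux_field F x \<bullet> gradient \<psi> x"
      proof (cases "x = 0")
        case False
        then show ?thesis
          unfolding flux_field_def flux_def
          by (intro tendsto_intros radial_mass_tendsto[OF Fk F H bd lim]) auto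
      qed (simp add: flux_field_def)
    qed
  qed
  moreover have "(\<lambda>k. - (LINT x|lebesgue_on ?B. Fk k (norm x) * \<psi> x)) \<longlonglongrightarrow> - (LINT x|lebesgue_on ?B. F (norm x) * \<psi> x)"
  proof (intro tendsto_minus integral_dominated_convergence[where w="\<lambda>x. C * H (norm x)"])
    show "(\<lambda>x. F (norm x) * \<psi> x) \<in> borel_measurable (lebesgue_on ?B)"
      "(\<lambda>x. Fk k (norm x) * \<psi> x) \<in> borel_measurable (lebesgue_on ?B)" for k
      by (intro borel_measurable_times fm F Fk L2_measurable[OF l2(1)])+
    show "integrable (lebesgue_on ?B) (\<lambda>x. C * H (norm x))"
      by (intro integrable_mult_right integrable_ball_norm[OF R H])
    show "AE x in lebesgue_on ?B. norm (Fk k (norm x) * \<psi> x) \<le> C * H (norm x)" for k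
      using C bd C0 H0 by (intro AE_I2) (auto simp: abs_mult mult.commute[of C] intro!: mult_mono)
    have "AE x in lebesgue_on ?B. (\<lambda>k. Fk k (norm x)) \<longlonglongrightarrow> F (norm x)"
      by (rule AE_ball_normI[OF R]) (use lim in eventually_elim, simp)
    then show "AE x in lebesgue_on ?B. (\<lambda>k. Fk k (norm x) * \<psi> x) \<longlonglongrightarrow> F (norm x) * \<psi> x"
      by eventually_elim (intro tendsto_intros)
  qed
  moreover have "(LINT x|lebesgue_on ?B. flux_field (Fk k) x \<bullet> gradient \<psi> x) = - (LINT x|lebesgue_on ?B. Fk k (norm x) * \<psi> x)" for k
    using eq[of k] \<psi> unfolding flux_identity_def by blast
  ultimately show "(LINT x|lebesgue_on ?B. flux_field F x \<bullet> gradient \<psi> x) = - (LINT x|lebesgue_on ?B. F (norm x) * \<psi> x)"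
    using LIMSEQ_unique by simp
qed

lemma integrable_indicator_continuous:
  fixes g :: "real \<Rightarrow> real"
  assumes "continuous_on UNIV g"
  shows "integrable lborel (\<lambda>t. indicator {0<..<R} t * g t)"
proof -
  have "integrable lborel (\<lambda>t. indicator {0..R} t *\<^sub>R g t)"
    by (rule borel_integrable_compact[OF compact_Icc continuous_on_subset[OF assms subset_UNIV]])
  from integrable_mult_indicator[OF _ this, of "{0<..<R}"]
  have "integrable lborel (\<lambda>t. indicator {0<..<R} t *\<^sub>R indicator {0..R} t *\<^sub>R g t)" by simp
  moreover have "(\<lambda>t. indicator {0<..<R} t *\<^sub>R indicator {0..R} t *\<^sub>R g t) = (\<lambda>t. indicator {0<..<R} t * g t)"
    by (auto simp: fun_eq_iff split: split_indicator)
  ultimately show ?thesis by (simp only:)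
qed

lemma radial_density_indicator:
  assumes "continuous_on UNIV g"
  shows "radial_density R (\<lambda>t. indicator {0<..<R} t * g t)"
  using integrable_indicator_continuous[OF assms] by (auto simp: radial_density_def)

text \<open>Integrating s^(2i+n-1) and dividing by t^(n-1) and by t leaves t^(2i)/(2i+n). This is an
  even power, so the field has polynomial components.\<close>

lemma flux_field_even_monomial_sum:
  fixes x :: "'a::euclidean_space"
  assumes x: "norm x < R"
  shows "flux_field (\<lambda>t. indicator {0<..<R} t * (\<Sum>i\<le>m. a i * (t\<^sup>2) ^ i)) x =
    (\<Sum>i\<le>m. a i / real (2 * i + DIM('a)) * ((norm x)\<^sup>2) ^ i) *\<^sub>R x"
proof (cases "x = 0")
  case False
  define n where "n = DIM('a)"
  have n: "n > 0" by (simp add: n_def)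
  define t where "t = norm x"
  have t: "t > 0" "t < R" using False x by (simp_all add: t_def)
  have "radial_mass n (\<lambda>t. indicator {0<..<R} t * (\<Sum>i\<le>m. a i * (t\<^sup>2) ^ i)) t
      = (LBINT s. indicator {0..t} s * (\<Sum>i\<le>m. a i * s ^ (2 * i + n - 1)))"
    unfolding radial_mass_def
  proof (rule integral_cong_AE)
    show "AE s in lborel. indicator {0<..<t} s * s ^ (n - 1) * (indicator {0<..<R} s * (\<Sum>i\<le>m. a i * (s\<^sup>2) ^ i))
        = indicator {0..t} s * (\<Sum>i\<le>m. a i * s ^ (2 * i + n - 1))"
      using AE_lborel_singleton[of t] AE_lborel_singleton[of 0]
    proof eventually_elim
      case (elim s)
      have e: "s ^ (n - 1) * (a i * (s\<^sup>2) ^ i) = a i * s ^ (2 * i + n - 1)" for i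
      proof -
        have "s ^ (n - 1) * (s\<^sup>2) ^ i = s ^ (n - 1 + 2 * i)" by (simp add: power_mult power_add)
        also have "n - 1 + 2 * i = 2 * i + n - 1" using n by simp
        finally show ?thesis by (simp add: mult.left_commute)
      qed
      have "s ^ (n - 1) * (\<Sum>i\<le>m. a i * (s\<^sup>2) ^ i) = (\<Sum>i\<le>m. a i * s ^ (2 * i + n - 1))"
        by (simp only: sum_distrib_left e)
      then show ?case using t elim by (auto split: split_indicator)
    qed
  qed auto
  also have "\<dots> = (\<Sum>i\<le>m. a i / real (2 * i + n) * t ^ (2 * i + n)) - (\<Sum>i\<le>m. a i / real (2 * i + n) * 0 ^ (2 * i + n))"
  proof (subst mult.commute, rule integral_FTC_Icc_real)
    show "((\<lambda>s. \<Sum>i\<le>m. a i / real (2 * i + n) * s ^ (2 * i + n)) has_real_derivative (\<Sum>i\<le>m. a i * s ^ (2 * i + n - 1))) (at s)" for s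
    proof (rule DERIV_sum)
      fix i
      show "((\<lambda>s. a i / real (2 * i + n) * s ^ (2 * i + n)) has_real_derivative a i * s ^ (2 * i + n - 1)) (at s)"
        using n by (auto intro!: derivative_eq_intros)
    qed
  qed (use t in \<open>auto intro!: continuous_intros\<close>)
  also have "\<dots> = (\<Sum>i\<le>m. a i / real (2 * i + n) * (t\<^sup>2) ^ i) * t ^ n"
    using n by (simp add: power_add power_mult sum_distrib_right mult.assoc zero_power)
  finally have "flux n (\<lambda>t. indicator {0<..<R} t * (\<Sum>i\<le>m. a i * (t\<^sup>2) ^ i)) t / t
      = (\<Sum>i\<le>m. a i / real (2 * i + n) * (t\<^sup>2) ^ i) * (t ^ n / (t ^ (n - 1) * t))"
    by (simp add: flux_def)
  also have "t ^ (n - 1) * t = t ^ n" using n by (simp add: power_eq_if)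
  finally show ?thesis using t by (simp add: flux_field_def n_def t_def)
qed (simp add: flux_field_def)

lemma Ck_norm_sq_power: "Ck k (\<lambda>x :: 'a::euclidean_space. ((norm x)\<^sup>2) ^ i)"
  by (intro Ck_real_polynomial_function real_polynomial_function_power real_polynomial_function_norm_sq)

text \<open>The field |x|^(2i) x has divergence (2i+n) |x|^(2i), and the factor cancels the
  denominator in the flux field.\<close>

lemma flux_identity_even_polynomial:
  assumes R: "R > 0"
  shows "flux_identity TYPE('a::euclidean_space) R (\<lambda>t. indicator {0<..<R} t * (\<Sum>i\<le>m. a i * (t\<^sup>2) ^ i))"
  unfolding flux_identity_def
proof
  let ?B = "ball (0 :: 'a) R"
  fix \<psi> :: "'a \<Rightarrow> real" assume \<psi>: "\<psi> \<in> test_functions ?B"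
  have S: "?B \<in> sets lebesgue" by auto
  note l2 = test_functions_L2[OF \<psi> S]
  \<comment> \<open>The components of that field; integration by parts is applied to each
    coordinate.\<close>
  define q where "q i b x = ((norm x)\<^sup>2) ^ i * (x \<bullet> b)" for i and b x :: 'a
  have ckq: "Ck k (q i b)" for k i b
    unfolding q_def[abs_def] by (intro Ck_mult Ck_norm_sq_power Ck_bounded_linear bounded_linear_inner_left)
  have gq: "(\<Sum>b\<in>Basis. gradient (q i b) x \<bullet> b) = real (2 * i + DIM('a)) * ((norm x)\<^sup>2) ^ i" for i x
  proof -
    have "gradient (q i b) x \<bullet> b = 2 * real i * ((x \<bullet> b) * (x \<bullet> b)) * ((norm x)\<^sup>2) ^ (i - 1) + ((norm x)\<^sup>2) ^ i"
      if "b \<in> Basis" for b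
    proof -
      have "(q i b has_derivative (\<lambda>v. real i * (2 * (x \<bullet> v)) * (x \<bullet> x) ^ (i - 1) * (x \<bullet> b) + (x \<bullet> x) ^ i * (v \<bullet> b))) (at x)"
        unfolding q_def[abs_def] power2_norm_eq_inner
        by (auto intro!: derivative_eq_intros simp: inner_commute algebra_simps)
      from frechet_derivative_at[OF this]
      have "frechet_derivative (q i b) (at x) b = real i * (2 * (x \<bullet> b)) * (x \<bullet> x) ^ (i - 1) * (x \<bullet> b) + (x \<bullet> x) ^ i * (b \<bullet> b)"
        by (rule fun_cong[OF sym])
      then show ?thesis
        unfolding gradient_inner[OF ckq[of "Suc 0"]] power2_norm_eq_inner using that by (simp add: inner_Basis)
    qed
    then have "(\<Sum>b\<in>Basis. gradient (q i b) x \<bullet> b)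
        = 2 * real i * (\<Sum>b\<in>Basis. (x \<bullet> b) * (x \<bullet> b)) * ((norm x)\<^sup>2) ^ (i - 1) + real DIM('a) * ((norm x)\<^sup>2) ^ i"
      by (simp add: sum.distrib sum_distrib_left sum_distrib_right)
    also have "(\<Sum>b\<in>Basis. (x \<bullet> b) * (x \<bullet> b)) = (norm x)\<^sup>2"
      by (simp add: power2_norm_eq_inner euclidean_inner[symmetric])
    \<comment> \<open>For i = 0 the truncated exponent i - 1 is harmless, since its factor i is
      0.\<close>
    finally show ?thesis by (cases i) (simp_all add: algebra_simps)
  qed
  have li: "locally_integrable ?B (q i b)" for i b
    unfolding locally_integrable_def
    by (auto intro!: integrable_lebesgue_on_compact continuous_on_subset[OF Ck_imp_continuous[OF ckq[of 0]]])
  have lg: "locally_integrable ?B (\<lambda>x. gradient (q i b) x \<bullet> b)" for i b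
    unfolding locally_integrable_def
    by (intro allI impI integrable_lebesgue_on_compact continuous_intros
        continuous_on_subset[OF continuous_on_gradient[OF ckq[of "Suc 0"]]]) auto
  have mono: "integrable (lebesgue_on ?B) (\<lambda>x. ((norm x)\<^sup>2) ^ i * (x \<bullet> gradient \<psi> x))" 
    "(LINT x|lebesgue_on ?B. ((norm x)\<^sup>2) ^ i * (x \<bullet> gradient \<psi> x))
      = - (real (2 * i + DIM('a)) * (LINT x|lebesgue_on ?B. ((norm x)\<^sup>2) ^ i * \<psi> x))" for i
  proof -
    have e: "((norm x)\<^sup>2) ^ i * (x \<bullet> gradient \<psi> x) = (\<Sum>b\<in>Basis. q i b x * (gradient \<psi> x \<bullet> b))" for x
      unfolding q_def euclidean_inner[of x "gradient \<psi> x"] by (simp add: sum_distrib_left mult.assoc)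
    note i1 = test_mult_integrable(2)[OF S li \<psi>] and i2 = test_mult_integrable(1)[OF S lg \<psi>]
    show "integrable (lebesgue_on ?B) (\<lambda>x. ((norm x)\<^sup>2) ^ i * (x \<bullet> gradient \<psi> x))"
      unfolding e by (rule Bochner_Integration.integrable_sum[OF i1])
    have "(LINT x|lebesgue_on ?B. ((norm x)\<^sup>2) ^ i * (x \<bullet> gradient \<psi> x))
        = (\<Sum>b\<in>Basis. LINT x|lebesgue_on ?B. q i b x * (gradient \<psi> x \<bullet> b))"
      unfolding e by (rule Bochner_Integration.integral_sum[OF i1])
    also have "\<dots> = - (\<Sum>b\<in>Basis. LINT x|lebesgue_on ?B. (gradient (q i b) x \<bullet> b) * \<psi> x)"
      by (simp only: integral_by_parts_test_function[OF S \<psi> ckq] sum_negf)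
    also have "(\<Sum>b\<in>Basis. LINT x|lebesgue_on ?B. (gradient (q i b) x \<bullet> b) * \<psi> x)
        = (LINT x|lebesgue_on ?B. (\<Sum>b\<in>Basis. (gradient (q i b) x \<bullet> b) * \<psi> x))"
      by (rule Bochner_Integration.integral_sum[OF i2, symmetric])
    also have "\<dots> = (LINT x|lebesgue_on ?B. real (2 * i + DIM('a)) * (((norm x)\<^sup>2) ^ i * \<psi> x))"
      by (simp only: sum_distrib_right[symmetric] gq mult.assoc)
    finally show "(LINT x|lebesgue_on ?B. ((norm x)\<^sup>2) ^ i * (x \<bullet> gradient \<psi> x))
      = - (real (2 * i + DIM('a)) * (LINT x|lebesgue_on ?B. ((norm x)\<^sup>2) ^ i * \<psi> x))"
      by (simp only: integral_mult_right_zero)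
  qed
  have lp: "locally_integrable ?B (\<lambda>x. ((norm x)\<^sup>2) ^ i)" for i
    unfolding locally_integrable_def
    by (auto intro!: integrable_lebesgue_on_compact continuous_intros)
  let ?F = "\<lambda>t. indicator {0<..<R} t * (\<Sum>i\<le>m. a i * (t\<^sup>2) ^ i)"
  have "(LINT x|lebesgue_on ?B. flux_field ?F x \<bullet> gradient \<psi> x)
      = (LINT x|lebesgue_on ?B. (\<Sum>i\<le>m. a i / real (2 * i + DIM('a)) * (((norm x)\<^sup>2) ^ i * (x \<bullet> gradient \<psi> x))))"
    by (rule Bochner_Integration.integral_cong)
      (simp_all add: flux_field_even_monomial_sum sum_distrib_right mult.assoc)
  also have "\<dots> = (\<Sum>i\<le>m. a i / real (2 * i + DIM('a)) * (LINT x|lebesgue_on ?B. ((norm x)\<^sup>2) ^ i * (x \<bullet> gradient \<psi> x)))"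
    by (subst Bochner_Integration.integral_sum) (auto intro!: integrable_mult_right mono(1))
  also have "\<dots> = - (\<Sum>i\<le>m. a i * (LINT x|lebesgue_on ?B. ((norm x)\<^sup>2) ^ i * \<psi> x))"
  proof -
    have "real (2 * i + DIM('a)) \<noteq> 0" for i
      unfolding of_nat_eq_0_iff using DIM_positive[where 'a='a] by linarith
    then show ?thesis unfolding mono(2) sum_negf[symmetric] by (intro sum.cong) (auto simp: field_simps)
  qed
  also have "(\<Sum>i\<le>m. a i * (LINT x|lebesgue_on ?B. ((norm x)\<^sup>2) ^ i * \<psi> x))
      = (LINT x|lebesgue_on ?B. (\<Sum>i\<le>m. a i * (((norm x)\<^sup>2) ^ i * \<psi> x)))"
    by (subst Bochner_Integration.integral_sum) (auto intro!: integrable_mult_right test_mult_integrable(1)[OF S lp \<psi>])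
  also have "\<dots> = (LINT x|lebesgue_on ?B. ?F (norm x) * \<psi> x)"
  proof (rule integral_lebesgue_on_cong_AE[OF S])
    show "(\<lambda>x. \<Sum>i\<le>m. a i * (((norm x)\<^sup>2) ^ i * \<psi> x)) \<in> borel_measurable (lebesgue_on ?B)"
      by (intro borel_measurable_integrable Bochner_Integration.integrable_sum integrable_mult_right
          test_mult_integrable(1)[OF S lp \<psi>])
    have "AE x in lebesgue_on ?B. norm x \<in> {0<..<R}"
      by (rule AE_ball_normI[OF R]) auto
    then show "AE x in lebesgue_on ?B. (\<Sum>i\<le>m. a i * (((norm x)\<^sup>2) ^ i * \<psi> x)) = ?F (norm x) * \<psi> x"
      by eventually_elim (simp add: sum_distrib_right mult.assoc)
  qed
  finally show "(LINT x|lebesgue_on ?B. flux_field ?F x \<bullet> gradient \<psi> x) = - (LINT x|lebesgue_on ?B. ?F (norm x) * \<psi> x)" .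
qed

text \<open>Weierstrass approximation of g composed with sqrt on [0, R^2]; substituting t^2 leaves
  only even powers.\<close>

lemma even_polynomial_approx:
  fixes g :: "real \<Rightarrow> real"
  assumes "continuous_on {0..R} g" and "R > 0" and "e > 0"
  obtains a m where "\<forall>t\<in>{0..R}. \<bar>g t - (\<Sum>i\<le>m. a i * (t\<^sup>2) ^ i)\<bar> < e"
proof -
  have "continuous_on {0..R\<^sup>2} (g \<circ> sqrt)"
  proof (rule continuous_on_compose)
    show "continuous_on {0..R\<^sup>2} sqrt" by (intro continuous_intros)
    have "sqrt ` {0..R\<^sup>2} \<subseteq> {0..R}" using assms(2) by (auto simp: real_le_lsqrt)
    then show "continuous_on (sqrt ` {0..R\<^sup>2}) g" by (rule continuous_on_subset[OF assms(1)])
  qed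
  then obtain p where p: "real_polynomial_function p" "\<And>x. x \<in> {0..R\<^sup>2} \<Longrightarrow> \<bar>(g \<circ> sqrt) x - p x\<bar> < e"
    using Stone_Weierstrass_real_polynomial_function[OF compact_Icc _ assms(3)] by metis
  obtain a m where am: "p = (\<lambda>x. \<Sum>i\<le>m. a i * x ^ i)"
    using p(1) real_polynomial_function_iff_sum by metis
  have "\<bar>g t - (\<Sum>i\<le>m. a i * (t\<^sup>2) ^ i)\<bar> < e" if "t \<in> {0..R}" for t
    using p(2)[of "t\<^sup>2"] that by (simp add: am power_mono)
  then show ?thesis using that by blast
qed

lemma flux_identity_continuous:
  assumes R: "R > 0" and g: "continuous_on UNIV g"
  shows "flux_identity TYPE('a::euclidean_space) R (\<lambda>t. indicator {0<..<R} t * g t)"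
proof -
  have "\<exists>a m. \<forall>t\<in>{0..R}. \<bar>g t - (\<Sum>i\<le>m. a i * (t\<^sup>2) ^ i)\<bar> < inverse (real (Suc k))" for k
    by (rule even_polynomial_approx[OF continuous_on_subset[OF g subset_UNIV] R, of "inverse (real (Suc k))"]) auto
  then obtain a m where am: "\<And>k t. t \<in> {0..R} \<Longrightarrow> \<bar>g t - (\<Sum>i\<le>m k. a k i * (t\<^sup>2) ^ i)\<bar> < inverse (real (Suc k))"
    by metis
  define p where "p k t = (\<Sum>i\<le>m k. a k i * (t\<^sup>2) ^ i)" for k t
  have pc: "continuous_on UNIV (p k)" for k unfolding p_def by (intro continuous_intros)
  show ?thesis
  proof (rule flux_identity_limit[OF R])
    show "radial_density R (\<lambda>t. indicator {0<..<R} t * p k t)" for k by (rule radial_density_indicator[OF pc])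
    show "radial_density R (\<lambda>t. indicator {0<..<R} t * g t)" by (rule radial_density_indicator[OF g])
    show "flux_identity TYPE('a) R (\<lambda>t. indicator {0<..<R} t * p k t)" for k
      unfolding p_def by (rule flux_identity_even_polynomial[OF R])
    \<comment> \<open>All approximation errors are at most 1, whence the majorant |g| + 1.\<close>
    have "continuous_on UNIV (\<lambda>t. \<bar>g t\<bar> + 1)" using g by (intro continuous_intros)
    then show "integrable lborel (\<lambda>t. indicator {0<..<R} t * (\<bar>g t\<bar> + 1))" by (rule integrable_indicator_continuous)
    show "\<bar>indicator {0<..<R} s * p k s\<bar> \<le> indicator {0<..<R} s * (\<bar>g s\<bar> + 1)" for k s
    proof (cases "s \<in> {0<..<R}")
      case True
      have "inverse (real (Suc k)) \<le> 1" by (simp add: field_simps)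
      then have "\<bar>p k s\<bar> \<le> \<bar>g s\<bar> + 1" using am[of s k] True by (auto simp: p_def[symmetric])
      then show ?thesis using True by simp
    qed simp
    show "AE s in lborel. (\<lambda>k. indicator {0<..<R} s * p k s) \<longlonglongrightarrow> indicator {0<..<R} s * g s"
    proof (intro AE_I2)
      fix s
      show "(\<lambda>k. indicator {0<..<R} s * p k s) \<longlonglongrightarrow> indicator {0<..<R} s * g s"
      proof (cases "s \<in> {0<..<R}")
        case True
        have "(\<lambda>k. g s - p k s) \<longlonglongrightarrow> 0"
          by (rule Lim_null_comparison[OF _ LIMSEQ_inverse_real_of_nat])
            (use am[of s] True in \<open>auto intro!: always_eventually less_imp_le simp: p_def\<close>)
        from tendsto_diff[OF tendsto_const[of "g s"] this] show ?thesis using True by simp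
      qed simp
    qed
  qed
qed

lemma flux_identity_bounded:
  assumes R: "R > 0" and F: "radial_density R F" and bd: "\<And>t. \<bar>F t\<bar> \<le> C"
  shows "flux_identity TYPE('a::euclidean_space) R F"
proof -
  have C0: "C \<ge> 0" using bd[of 0] abs_ge_zero[of "F 0"] by linarith
  have S: "{0<..<R} \<in> sets lebesgue" by auto
  have Fm: "F \<in> borel_measurable (lebesgue_on {0<..<R})"
    using radial_densityD(2)[OF F] by (intro measurable_restrict_space1 measurable_completion) simp
  obtain g where g_: "\<forall>k. continuous_on UNIV (g k)" "\<forall>k x. \<bar>g k x\<bar> \<le> C"
    "AE x in lebesgue_on {0<..<R}. (\<lambda>k. g k x) \<longlonglongrightarrow> F x"
    by (rule bounded_measurable_continuous_approx[OF S Fm bd C0])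
  note g = g_(1,2)[rule_format] g_(3)
  show ?thesis
  proof (rule flux_identity_limit[OF R radial_density_indicator[OF g(1)] F])
    show "integrable lborel (\<lambda>t. indicator {0<..<R} t * C)"
      by (rule integrable_indicator_continuous) simp
    show "\<bar>indicator {0<..<R} s * g k s\<bar> \<le> indicator {0<..<R} s * C" for k s
      using g(2) by (auto split: split_indicator)
    have "AE s in lborel. s \<in> {0<..<R} \<longrightarrow> (\<lambda>k. g k s) \<longlonglongrightarrow> F s"
      using g(3) unfolding AE_lebesgue_on_iff[OF S] AE_completion_iff .
    then show "AE s in lborel. (\<lambda>k. indicator {0<..<R} s * g k s) \<longlonglongrightarrow> F s"
    proof eventually_elim
      case (elim s)
      then show ?case using radial_densityD(3)[OF F, of s] by (cases "s \<in> {0<..<R}") simp_all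
    qed
    show "flux_identity TYPE('a) R (\<lambda>t. indicator {0<..<R} t * g k t)" for k
      by (rule flux_identity_continuous[OF R g(1)])
  qed
qed

text \<open>Truncation at height k reduces to bounded densities, with |F| as majorant.\<close>

lemma flux_identity_radial_density:
  assumes R: "R > 0" and F: "radial_density R F"
  shows "flux_identity TYPE('a::euclidean_space) R F"
proof -
  note D = radial_densityD[OF F]
  define Fk where "Fk k t = max (- real k) (min (real k) (F t))" for k t
  have le: "\<bar>Fk k t\<bar> \<le> \<bar>F t\<bar>" "\<bar>Fk k t\<bar> \<le> real k" for k t by (auto simp: Fk_def)
  have Fk: "radial_density R (Fk k)" for k
  proof -
    have "integrable lborel (Fk k)"
      by (rule Bochner_Integration.integrable_bound[OF D(1)]) (use D(2) le in \<open>auto simp: Fk_def[abs_def]\<close>)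
    then show ?thesis using D(3) by (auto simp: radial_density_def Fk_def)
  qed
  show ?thesis
  proof (rule flux_identity_limit[OF R Fk F])
    show "integrable lborel (\<lambda>t. \<bar>F t\<bar>)" using D(1) by auto
    show "flux_identity TYPE('a) R (Fk k)" for k by (rule flux_identity_bounded[OF R Fk le(2)])
    show "AE s in lborel. (\<lambda>k. Fk k s) \<longlonglongrightarrow> F s"
    proof (intro AE_I2 tendsto_eventually)
      fix s
      obtain N where "\<bar>F s\<bar> \<le> real N" using real_arch_simple by blast
      then show "eventually (\<lambda>k. Fk k s = F s) sequentially"
        unfolding eventually_sequentially by (intro exI[of _ N]) (auto simp: Fk_def)
    qed
  qed (use le in auto)
qed

section \<open>Explicit radial weak solutions\<close>

text \<open>With y = 1/s the quantity is (y + y^2) exp(-y). The polynomial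
  \<open>[:0, 0, 1:]\<close> stands for the derivative of \<open>flat_exp 1\<close>, and the weight
  s + 1 is the scaled gap R^2 - |x|^2 that meets this derivative in
  \<open>H10_pair_radial\<close>.\<close>

lemma flat_exp_quadratic_bounds:
  assumes "s > 0"
  shows "0 \<le> (s + 1) * flat_exp [:0, 0, 1:] s" "(s + 1) * flat_exp [:0, 0, 1:] s \<le> 2"
    "(s + 1) * flat_exp [:0, 0, 1:] s \<le> 1 / s + (1 / s)\<^sup>2"
proof -
  define y where "y = 1 / s"
  have y: "y > 0" using assms by (simp add: y_def)
  have e: "(s + 1) * flat_exp [:0, 0, 1:] s = (y + y\<^sup>2) * exp (- y)"
    using assms by (simp add: flat_exp_def y_def field_simps power2_eq_square)
  show "0 \<le> (s + 1) * flat_exp [:0, 0, 1:] s" unfolding e using y by simp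
  have "1 + y + y\<^sup>2 / 2 \<le> exp y" by (rule exp_lower_Taylor_quadratic) (use y in simp)
  then have "y + y\<^sup>2 \<le> 2 * exp y" using y by simp
  then have "(y + y\<^sup>2) * exp (- y) \<le> 2 * exp y * exp (- y)" by (intro mult_right_mono) auto
  then show "(s + 1) * flat_exp [:0, 0, 1:] s \<le> 2" unfolding e by (simp add: mult.assoc flip: exp_add)
  have "(y + y\<^sup>2) * exp (- y) \<le> (y + y\<^sup>2) * 1" using y by (intro mult_left_mono) auto
  then show "(s + 1) * flat_exp [:0, 0, 1:] s \<le> 1 / s + (1 / s)\<^sup>2" unfolding e y_def by simp
qed

lemma flat_exp_quadratic_le:
  "0 \<le> (s + 1) * flat_exp [:0, 0, 1:] s" "(s + 1) * flat_exp [:0, 0, 1:] s \<le> 2"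
  using flat_exp_quadratic_bounds[of s] by (cases "s > 0"; simp add: flat_exp_def)+

lemma flat_exp_quadratic_tendsto_0:
  assumes lim: "filterlim s at_top sequentially"
  shows "(\<lambda>k. (s k + 1) * flat_exp [:0, 0, 1:] (s k)) \<longlonglongrightarrow> 0"
proof (rule tendsto_sandwich[OF _ _ tendsto_const])
  have "(\<lambda>k. 1 / s k) \<longlonglongrightarrow> 0"
    by (intro tendsto_divide_0[OF tendsto_const] filterlim_at_top_imp_at_infinity lim)
  then have "(\<lambda>k. 1 / s k + (1 / s k)\<^sup>2) \<longlonglongrightarrow> 0 + 0\<^sup>2" by (intro tendsto_intros)
  then show "(\<lambda>k. 1 / s k + (1 / s k)\<^sup>2) \<longlonglongrightarrow> 0" by simp
  show "eventually (\<lambda>k. 0 \<le> (s k + 1) * flat_exp [:0, 0, 1:] (s k)) sequentially"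
    by (intro always_eventually allI flat_exp_quadratic_le)
  show "eventually (\<lambda>k. (s k + 1) * flat_exp [:0, 0, 1:] (s k) \<le> 1 / s k + (1 / s k)\<^sup>2) sequentially"
    using eventually_compose_filterlim[OF eventually_gt_at_top[of 0] lim]
    by eventually_elim (rule flat_exp_quadratic_bounds(3))
qed

text \<open>W(t)/t may be unbounded near 0, so the divisor is \<open>max \<delta> t\<close> instead.
  From \<open>\<delta>\<close> on nothing changes, and below it both W and its replacement are small
  because \<open>W 0 = 0\<close>.\<close>

lemma odd_polynomial_approx:
  fixes W :: "real \<Rightarrow> real"
  assumes W: "continuous_on {0..R} W" and W0: "W 0 = 0" and R: "R > 0" and e: "e > 0"
  obtains a m where "\<forall>t\<in>{0..R}. \<bar>W t - 2 * t * (\<Sum>i\<le>m. a i * (t\<^sup>2) ^ i)\<bar> < e"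
proof -
  obtain \<delta> where \<delta>: "\<delta> > 0" "\<And>t. t \<in> {0..R} \<Longrightarrow> dist t 0 < \<delta> \<Longrightarrow> dist (W t) (W 0) < e / 2"
    using W R e unfolding continuous_on_iff by (metis atLeastAtMost_iff half_gt_zero less_eq_real_def)
  define \<omega> where "\<omega> t = W t / (2 * max \<delta> t)" for t
  have "continuous_on {0..R} \<omega>"
    unfolding \<omega>_def using W \<delta>(1) by (intro continuous_intros) auto
  \<comment> \<open>This error is later multiplied by 2t, at most 2R, and becomes e/2.\<close>
  then obtain a m where am: "\<forall>t\<in>{0..R}. \<bar>\<omega> t - (\<Sum>i\<le>m. a i * (t\<^sup>2) ^ i)\<bar> < e / (4 * R)"
    by (rule even_polynomial_approx[OF _ R, of \<omega> "e / (4 * R)"]) (use R e in auto)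
  have "\<bar>W t - 2 * t * (\<Sum>i\<le>m. a i * (t\<^sup>2) ^ i)\<bar> < e" if t: "t \<in> {0..R}" for t
  proof -
    define p where "p = (\<Sum>i\<le>m. a i * (t\<^sup>2) ^ i)"
    have "\<bar>2 * t * \<omega> t - 2 * t * p\<bar> = 2 * t * \<bar>\<omega> t - p\<bar>"
      using t by (simp add: abs_mult right_diff_distrib[symmetric])
    also have "\<dots> \<le> 2 * R * (e / (4 * R))"
      using am[rule_format, OF t] t R unfolding p_def by (intro mult_mono) auto
    also have "\<dots> = e / 2" using R by simp
    finally have 1: "\<bar>2 * t * \<omega> t - 2 * t * p\<bar> \<le> e / 2" .
    have 2: "\<bar>W t - 2 * t * \<omega> t\<bar> < e / 2"
    proof (cases "t < \<delta>")
      case True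
      have "W t - 2 * t * \<omega> t = W t * (1 - t / \<delta>)"
        using True \<delta>(1) by (simp add: \<omega>_def field_simps)
      moreover have "\<bar>1 - t / \<delta>\<bar> \<le> 1" using True t \<delta>(1) by simp
      ultimately have "\<bar>W t - 2 * t * \<omega> t\<bar> \<le> \<bar>W t\<bar> * 1"
        by (simp only: abs_mult) (intro mult_left_mono, auto)
      moreover have "\<bar>W t\<bar> < e / 2" using \<delta>(2)[OF t] True t W0 by (simp add: dist_real_def)
      ultimately show ?thesis by simp
    next
      case False
      then show ?thesis using \<delta>(1) e by (simp add: \<omega>_def max_def)
    qed
    show ?thesis using 1 2 unfolding p_def[symmetric] by linarith
  qed
  then show ?thesis using that by blast
qed

lemma continuous_on_Icc_bounded:
  fixes h :: "real \<Rightarrow> real"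
  assumes "continuous_on {a..b} h"
  obtains M where "\<forall>t\<in>{a..b}. \<bar>h t\<bar> \<le> M"
proof -
  have "bounded (h ` {a..b})" by (rule compact_imp_bounded[OF compact_continuous_image[OF assms compact_Icc]])
  then obtain M where "\<forall>y\<in>h ` {a..b}. norm y \<le> M" unfolding bounded_iff by blast
  then show ?thesis using that by simp
qed

lemma continuous_on_norm_compose:
  fixes h :: "real \<Rightarrow> real"
  assumes "continuous_on {0..R} h"
  shows "continuous_on (cball (0 :: 'a::euclidean_space) R) (\<lambda>x. h (norm x))"
  by (rule continuous_on_compose2[OF assms]) (auto intro: continuous_intros)

lemma continuous_on_radial_potential:
  assumes "continuous_on {0..R} (W :: real \<Rightarrow> real)"
  shows "continuous_on {0..R} (\<lambda>t. integral {t..R} W)"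
  by (rule DERIV_continuous_on[OF integral_has_real_derivative'[OF assms]])

text \<open>The gradient of a radial function with profile derivative \<open>- W\<close> is approximated by replacing
  \<open>W\<close> with an odd polynomial, which makes the profile a polynomial in \<open>\<parallel>x\<parallel>\<^sup>2\<close>, and cutting off near the
  sphere; the cut-off is harmless because the profile vanishes there to first order.\<close>
lemma H10_pair_radial:
  fixes W :: "real \<Rightarrow> real"
  assumes R: "R > 0" and W: "continuous_on {0..R} W" and W0: "W 0 = 0"
  shows "H10_pair (ball (0 :: 'a::euclidean_space) R) (\<lambda>x. integral {norm x..R} W)
    (\<lambda>x. - (W (norm x) / norm x) *\<^sub>R x)"
proof -
  let ?B = "ball (0 :: 'a) R"
  have S: "?B \<in> sets lebesgue" and L: "?B \<in> lmeasurable" by auto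
  define U where "U t = integral {t..R} W" for t
  define G where "G x = - (W (norm x) / norm x) *\<^sub>R x" for x :: 'a
  have "\<exists>a m. \<forall>t\<in>{0..R}. \<bar>W t - 2 * t * (\<Sum>i\<le>m. a i * (t\<^sup>2) ^ i)\<bar> < inverse (real (Suc k))" for k
    by (rule odd_polynomial_approx[OF W W0 R, of "inverse (real (Suc k))"]) auto
  then obtain a m where am: "\<And>k t. t \<in> {0..R} \<Longrightarrow> \<bar>W t - 2 * t * (\<Sum>i\<le>m k. a k i * (t\<^sup>2) ^ i)\<bar> < inverse (real (Suc k))"
    by metis
  define p where "p k \<tau> = (\<Sum>i\<le>m k. a k i * \<tau> ^ i)" for k \<tau>
  \<comment> \<open>The antiderivative of -p that vanishes at R^2: q(t^2) is the integral of 2 s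
    p(s^2) from t to R and so approximates \<open>U t\<close>.\<close>
  define q where "q k \<tau> = (\<Sum>i\<le>m k. a k i / real (Suc i) * ((R\<^sup>2) ^ Suc i - \<tau> ^ Suc i))" for k \<tau>
  have p: "\<bar>W t - 2 * t * p k (t\<^sup>2)\<bar> < inverse (real (Suc k))" if "t \<in> {0..R}" for k t
    using am[OF that] by (simp add: p_def)
  have dq: "(q k has_real_derivative - p k \<tau>) (at \<tau>)" for k \<tau>
  proof -
    have "(q k has_real_derivative (\<Sum>i\<le>m k. - (a k i * \<tau> ^ i))) (at \<tau>)"
      unfolding q_def[abs_def]
    proof (rule DERIV_sum)
      fix i
      have "((\<lambda>\<tau>. a k i / real (Suc i) * ((R\<^sup>2) ^ Suc i - \<tau> ^ Suc i)) has_real_derivative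
          a k i / real (Suc i) * (0 - real (Suc i) * \<tau> ^ i)) (at \<tau>)"
        by (rule derivative_eq_intros refl | simp)+
      then show "((\<lambda>\<tau>. a k i / real (Suc i) * ((R\<^sup>2) ^ Suc i - \<tau> ^ Suc i)) has_real_derivative
          - (a k i * \<tau> ^ i)) (at \<tau>)"
        by (rule DERIV_cong) (simp add: field_simps)
    qed
    then show ?thesis by (simp add: p_def sum_negf)
  qed
  have dqt: "((\<lambda>t. q k (t\<^sup>2)) has_real_derivative - (2 * t * p k (t\<^sup>2))) (at t)" for k t
    by (rule DERIV_cong[OF DERIV_chain'[OF _ dq]]) (auto intro!: derivative_eq_intros)
  have qR: "q k (R\<^sup>2) = 0" for k by (simp add: q_def)
  obtain M where M_: "\<forall>t\<in>{0..R}. \<bar>W t\<bar> \<le> M" by (rule continuous_on_Icc_bounded[OF W])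
  note M = M_[rule_format]
  have M0: "M \<ge> 0" using M[of 0] R abs_ge_zero[of "W 0"] by force
  \<comment> \<open>Bounds W and, as the approximation errors are at most 1, also all the odd
    polynomials.\<close>
  define C where "C = M + 1"
  have C0: "C > 0" using M0 by (simp add: C_def)
  have pC: "\<bar>2 * t * p k (t\<^sup>2)\<bar> \<le> C" if "t \<in> {0..R}" for k t
  proof -
    have "inverse (real (Suc k)) \<le> 1" by (simp add: field_simps)
    then show ?thesis using p[OF that, of k] M[OF that] unfolding C_def by linarith
  qed
  \<comment> \<open>First-order vanishing at the sphere, uniformly in k; this compensates the
    growing derivative of the cut-off.\<close>
  have qC: "\<bar>q k (t\<^sup>2)\<bar> \<le> C * (R - t)" if t: "t \<in> {0..<R}" for k t
  proof -
    obtain z where z: "t < z" "z < R" "q k (R\<^sup>2) - q k (t\<^sup>2) = (R - t) * - (2 * z * p k (z\<^sup>2))"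
      using MVT2[of t R "\<lambda>t. q k (t\<^sup>2)" "\<lambda>t. - (2 * t * p k (t\<^sup>2))"] dqt t by auto
    then have "\<bar>q k (t\<^sup>2)\<bar> = \<bar>2 * z * p k (z\<^sup>2)\<bar> * (R - t)"
      using t by (simp add: qR abs_mult)
    also have "\<dots> \<le> C * (R - t)" using z t by (intro mult_right_mono pC) auto
    finally show ?thesis .
  qed
  have dU: "(U has_real_derivative - W t) (at t within {0..R})" if "t \<in> {0..R}" for t
    unfolding U_def[abs_def] by (rule integral_has_real_derivative'[OF W that])
  have Ucont: "continuous_on {0..R} U" by (rule DERIV_continuous_on[OF dU])
  have UR: "U R = 0" by (simp add: U_def)
  have qU: "\<bar>q k (t\<^sup>2) - U t\<bar> \<le> inverse (real (Suc k)) * R" if t: "t \<in> {0..<R}" for k t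
  proof -
    have "\<exists>z\<in>{t<..<R}. (q k (R\<^sup>2) - U R) - (q k (t\<^sup>2) - U t) = (- (2 * z * p k (z\<^sup>2)) - - W z) * (R - t)"
    proof (rule mvt_simple[of t R "\<lambda>t. q k (t\<^sup>2) - U t" "\<lambda>z. (*) (- (2 * z * p k (z\<^sup>2)) - - W z)"])
      show "t < R" using t by simp
      fix z assume z: "t \<le> z" "z \<le> R"
      have "((\<lambda>t. q k (t\<^sup>2) - U t) has_real_derivative - (2 * z * p k (z\<^sup>2)) - - W z) (at z within {t..R})"
        using t z by (intro DERIV_diff has_field_derivative_at_within[OF dqt] DERIV_subset[OF dU]) auto
      then show "((\<lambda>t. q k (t\<^sup>2) - U t) has_derivative (*) (- (2 * z * p k (z\<^sup>2)) - - W z)) (at z within {t..R})"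
        by (simp only: has_field_derivative_def)
    qed
    then obtain z where z: "z \<in> {t<..<R}" and e: "- (q k (t\<^sup>2) - U t) = (W z - 2 * z * p k (z\<^sup>2)) * (R - t)"
      by (auto simp: qR UR)
    have "\<bar>q k (t\<^sup>2) - U t\<bar> = \<bar>W z - 2 * z * p k (z\<^sup>2)\<bar> * (R - t)"
      using t arg_cong[OF e, of abs] by (simp only: abs_minus_cancel abs_mult) auto
    also have "\<dots> \<le> inverse (real (Suc k)) * R"
      using z t by (intro mult_mono less_imp_le[OF p]) auto
    finally show ?thesis .
  qed
  \<comment> \<open>Positive exactly for \<open>\<tau>\<close> below R^2 - 1/(k+1): the -1 keeps
    each support inside the open ball, while the supports exhaust the ball.\<close>
  define \<sigma> where "\<sigma> k \<tau> = real (Suc k) * (R\<^sup>2 - \<tau>) - 1" for k \<tau>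
  \<comment> \<open>The derivative in \<open>\<tau>\<close> of the product of the cut-off and
    \<open>q k\<close>.\<close>
  define s' where "s' k \<tau> = - real (Suc k) * flat_exp [:0, 0, 1:] (\<sigma> k \<tau>) * q k \<tau> - flat_exp 1 (\<sigma> k \<tau>) * p k \<tau>" for k \<tau>
  define \<psi> where "\<psi> k x = flat_exp 1 (\<sigma> k ((norm x)\<^sup>2)) * q k ((norm x)\<^sup>2)" for k and x :: 'a
  have rp: "real_polynomial_function (\<lambda>x :: 'a. ((norm x)\<^sup>2) ^ j)" for j
    by (intro real_polynomial_function_power real_polynomial_function_norm_sq)
  have test: "\<psi> k \<in> test_functions ?B" for k
  proof (rule test_functionsI)
    have "real_polynomial_function (\<lambda>x :: 'a. real (Suc k) * (R\<^sup>2 - ((norm x)\<^sup>2) ^ 1) - 1)"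
      by (intro real_polynomial_function_diff real_polynomial_function.intros(4)[OF real_polynomial_function.intros(2)]
          real_polynomial_function.intros(2) rp)
    then have c1: "Ck j (\<lambda>x :: 'a. \<sigma> k ((norm x)\<^sup>2))" for j
      unfolding \<sigma>_def power_one_right by (rule Ck_real_polynomial_function)
    have "real_polynomial_function (\<lambda>x :: 'a. q k ((norm x)\<^sup>2))"
      unfolding q_def
      by (intro real_polynomial_function_sum real_polynomial_function_diff real_polynomial_function.intros(4)[OF real_polynomial_function.intros(2)]
          real_polynomial_function.intros(2) rp) auto
    then show "Ck j (\<psi> k)" for j
      unfolding \<psi>_def[abs_def] by (intro Ck_mult[OF Ck_flat_exp[OF c1]] Ck_real_polynomial_function)
    have "closed {x :: 'a. 0 \<le> \<sigma> k ((norm x)\<^sup>2)}"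
      unfolding \<sigma>_def by (intro closed_Collect_le continuous_intros)
    then show "compact (cball 0 R \<inter> {x :: 'a. 0 \<le> \<sigma> k ((norm x)\<^sup>2)})"
      by (rule compact_Int_closed[OF compact_cball])
    show "cball 0 R \<inter> {x :: 'a. 0 \<le> \<sigma> k ((norm x)\<^sup>2)} \<subseteq> ?B"
    proof
      fix x :: 'a assume x: "x \<in> cball 0 R \<inter> {x. 0 \<le> \<sigma> k ((norm x)\<^sup>2)}"
      then have "norm x \<noteq> R" by (auto simp: \<sigma>_def)
      then show "x \<in> ?B" using x by auto
    qed
    show "\<psi> k x = 0" if "x \<notin> cball 0 R \<inter> {x :: 'a. 0 \<le> \<sigma> k ((norm x)\<^sup>2)}" for x
    proof -
      have "\<sigma> k ((norm x)\<^sup>2) \<le> 0"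
      proof (cases "norm x \<le> R")
        case True
        then show ?thesis using that by auto
      next
        case False
        then have "R\<^sup>2 \<le> (norm x)\<^sup>2" using R by (intro power_mono) auto
        then have "real (Suc k) * (R\<^sup>2 - (norm x)\<^sup>2) \<le> 0" by (intro mult_nonneg_nonpos) auto
        then show ?thesis unfolding \<sigma>_def by linarith
      qed
      then show ?thesis by (simp add: \<psi>_def flat_exp_def)
    qed
  qed
  have grad: "gradient (\<psi> k) x = (2 * s' k ((norm x)\<^sup>2)) *\<^sub>R x" for k x
  proof (rule gradient_eqI)
    have d1: "(flat_exp 1 has_real_derivative flat_exp [:0, 0, 1:] s) (at s)" for s
      using flat_exp_has_derivative[of 1 s] by simp
    have ds: "(\<sigma> k has_real_derivative - real (Suc k)) (at \<tau>)" for \<tau>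
      unfolding \<sigma>_def[abs_def] by (auto intro!: derivative_eq_intros)
    have "((\<lambda>\<tau>. flat_exp 1 (\<sigma> k \<tau>) * q k \<tau>) has_real_derivative s' k \<tau>) (at \<tau>)" for \<tau>
      by (rule DERIV_cong[OF DERIV_mult[OF DERIV_chain'[OF ds d1] dq]]) (simp add: s'_def)
    moreover have "((\<lambda>x. (norm x)\<^sup>2) has_derivative (\<lambda>v. 2 * (x \<bullet> v))) (at x)"
      unfolding power2_norm_eq_inner by (auto intro!: derivative_eq_intros simp: inner_commute)
    ultimately have "(\<psi> k has_derivative (\<lambda>v. 2 * (x \<bullet> v) * s' k ((norm x)\<^sup>2))) (at x)"
      unfolding \<psi>_def[abs_def] by (rule DERIV_compose_FDERIV)
    then show "(\<psi> k has_derivative (\<lambda>v. (2 * s' k ((norm x)\<^sup>2)) *\<^sub>R x \<bullet> v)) (at x)"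
      by (rule has_derivative_eq_rhs) (auto simp: fun_eq_iff)
  qed
  have norm_diff: "norm (G x - gradient (\<psi> k) x) = \<bar>W (norm x) + 2 * norm x * s' k ((norm x)\<^sup>2)\<bar>" for k x
  proof (cases "x = 0")
    case False
    have "G x - gradient (\<psi> k) x = (- (W (norm x) + 2 * norm x * s' k ((norm x)\<^sup>2)) / norm x) *\<^sub>R x"
      unfolding grad G_def scaleR_left_diff_distrib[symmetric] using False by (intro arg_cong2[where f="(*\<^sub>R)"]) (auto simp: field_simps)
    then show ?thesis using False by (simp add: abs_minus_commute) 
  qed (simp add: G_def grad W0)
  have E: "0 \<le> flat_exp 1 s" "flat_exp 1 s \<le> 1" for s by (rule flat_exp_1_bounds)+
  \<comment> \<open>The critical term. Differentiating the cut-off costs a factor k + 1, paid for by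
    |q| at most C (R - t) and by R (R - t) at most R^2 - t^2; together they give
    \<open>\<sigma>\<close> + 1.\<close>
  have first: "\<bar>2 * t * (real (Suc k) * flat_exp [:0, 0, 1:] (\<sigma> k (t\<^sup>2)) * q k (t\<^sup>2))\<bar>
      \<le> 2 * C * ((\<sigma> k (t\<^sup>2) + 1) * flat_exp [:0, 0, 1:] (\<sigma> k (t\<^sup>2)))" if t: "t \<in> {0..<R}" for k t
  proof -
    define e where "e = flat_exp [:0, 0, 1:] (\<sigma> k (t\<^sup>2))"
    have e0: "e \<ge> 0" by (simp add: e_def flat_exp_def)
    have "R * (R - t) \<le> (R + t) * (R - t)" using t by (intro mult_right_mono) auto
    then have R2: "R * (R - t) \<le> R\<^sup>2 - t\<^sup>2" by (simp add: power2_eq_square algebra_simps)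
    have "t * \<bar>q k (t\<^sup>2)\<bar> \<le> R * (C * (R - t))"
      using t qC[OF t, of k] by (intro mult_mono) auto
    also have "\<dots> = C * (R * (R - t))" by simp
    also have "\<dots> \<le> C * (R\<^sup>2 - t\<^sup>2)" using C0 R2 by (intro mult_left_mono) auto
    finally have le: "t * \<bar>q k (t\<^sup>2)\<bar> \<le> C * (R\<^sup>2 - t\<^sup>2)" .
    have "\<bar>2 * t * (real (Suc k) * e * q k (t\<^sup>2))\<bar> = 2 * real (Suc k) * e * (t * \<bar>q k (t\<^sup>2)\<bar>)"
      using t e0 by (simp add: abs_mult)
    also have "\<dots> \<le> 2 * real (Suc k) * e * (C * (R\<^sup>2 - t\<^sup>2))"
      using e0 by (intro mult_left_mono[OF le]) auto
    also have "\<dots> = 2 * C * ((\<sigma> k (t\<^sup>2) + 1) * e)" by (simp add: \<sigma>_def)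
    finally show ?thesis unfolding e_def .
  qed
  have s'_split: "2 * t * s' k (t\<^sup>2) = - (2 * t * (real (Suc k) * flat_exp [:0, 0, 1:] (\<sigma> k (t\<^sup>2)) * q k (t\<^sup>2)))
      - flat_exp 1 (\<sigma> k (t\<^sup>2)) * (2 * t * p k (t\<^sup>2))" for k t
    by (simp add: s'_def algebra_simps)
  \<comment> \<open>C for W, 4 C for the differentiated cut-off, and C for the cut-off times the odd
    polynomial.\<close>
  have bound: "\<bar>W t + 2 * t * s' k (t\<^sup>2)\<bar> \<le> 6 * C" if t: "t \<in> {0..<R}" for k t
  proof -
    have "2 * C * ((\<sigma> k (t\<^sup>2) + 1) * flat_exp [:0, 0, 1:] (\<sigma> k (t\<^sup>2))) \<le> 2 * C * 2"
      using C0 by (intro mult_left_mono flat_exp_quadratic_le) auto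
    then have 1: "\<bar>2 * t * (real (Suc k) * flat_exp [:0, 0, 1:] (\<sigma> k (t\<^sup>2)) * q k (t\<^sup>2))\<bar> \<le> 4 * C"
      using first[OF t, of k] by linarith
    have "\<bar>flat_exp 1 (\<sigma> k (t\<^sup>2)) * (2 * t * p k (t\<^sup>2))\<bar> \<le> 1 * C"
      unfolding abs_mult[of "flat_exp 1 _"] using E pC[of t k] t by (intro mult_mono) auto
    then show ?thesis unfolding s'_split using 1 M[of t] t unfolding C_def by (auto simp: abs_le_iff)
  qed
  have \<sigma>_lim: "filterlim (\<lambda>k. \<sigma> k (t\<^sup>2)) at_top sequentially" and E_lim: "(\<lambda>k. flat_exp 1 (\<sigma> k (t\<^sup>2))) \<longlonglongrightarrow> 1"
    if t: "t \<in> {0..<R}" for t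
  proof -
    have pos: "R\<^sup>2 - t\<^sup>2 > 0" using t power_strict_mono[of t R 2] by simp
    show "(\<lambda>k. flat_exp 1 (\<sigma> k (t\<^sup>2))) \<longlonglongrightarrow> 1"
      unfolding \<sigma>_def by (rule flat_exp_1_tendsto_1[OF pos])
    have "filterlim (\<lambda>k. - 1 + real (Suc k) * (R\<^sup>2 - t\<^sup>2)) at_top sequentially"
      by (rule filterlim_tendsto_add_at_top[OF tendsto_const filterlim_at_top_mult_tendsto_pos[OF tendsto_const pos
        filterlim_compose[OF filterlim_real_sequentially filterlim_Suc]]])
    then show "filterlim (\<lambda>k. \<sigma> k (t\<^sup>2)) at_top sequentially"
      unfolding \<sigma>_def by (simp add: add.commute)
  qed
  have lim0: "(\<lambda>k. inverse (real (Suc k))) \<longlonglongrightarrow> 0" by (rule LIMSEQ_inverse_real_of_nat)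
  have conv: "(\<lambda>k. W t + 2 * t * s' k (t\<^sup>2)) \<longlonglongrightarrow> 0" if t: "t \<in> {0..<R}" for t
  proof -
    have "(\<lambda>k. 2 * C * ((\<sigma> k (t\<^sup>2) + 1) * flat_exp [:0, 0, 1:] (\<sigma> k (t\<^sup>2)))) \<longlonglongrightarrow> 2 * C * 0"
      by (intro tendsto_mult tendsto_const flat_exp_quadratic_tendsto_0[OF \<sigma>_lim[OF t]])
    then have "(\<lambda>k. 2 * C * ((\<sigma> k (t\<^sup>2) + 1) * flat_exp [:0, 0, 1:] (\<sigma> k (t\<^sup>2)))) \<longlonglongrightarrow> 0" by simp
    then have 1: "(\<lambda>k. 2 * t * (real (Suc k) * flat_exp [:0, 0, 1:] (\<sigma> k (t\<^sup>2)) * q k (t\<^sup>2))) \<longlonglongrightarrow> 0"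
      by (rule Lim_null_comparison[rotated]) (intro always_eventually allI, simp only: real_norm_def first[OF t])
    have "(\<lambda>k. W t - 2 * t * p k (t\<^sup>2)) \<longlonglongrightarrow> 0"
      by (rule Lim_null_comparison[OF _ lim0]) (use p[of t] t in \<open>auto intro!: always_eventually less_imp_le\<close>)
    from tendsto_diff[OF tendsto_const[of "W t"] this] have 2: "(\<lambda>k. 2 * t * p k (t\<^sup>2)) \<longlonglongrightarrow> W t" by simp
    have "(\<lambda>k. W t + (- (2 * t * (real (Suc k) * flat_exp [:0, 0, 1:] (\<sigma> k (t\<^sup>2)) * q k (t\<^sup>2)))
      - flat_exp 1 (\<sigma> k (t\<^sup>2)) * (2 * t * p k (t\<^sup>2)))) \<longlonglongrightarrow> W t + (- 0 - 1 * W t)"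
      by (intro tendsto_add tendsto_diff tendsto_minus tendsto_mult[OF E_lim[OF t] 2] 1 tendsto_const)
    then show ?thesis unfolding s'_split by simp
  qed
  have \<psi>_conv: "(\<lambda>k. U (norm x) - \<psi> k x) \<longlonglongrightarrow> 0" if x: "x \<in> ?B" for x
  proof -
    have t: "norm x \<in> {0..<R}" using x by simp
    have "(\<lambda>k. inverse (real (Suc k)) * R) \<longlonglongrightarrow> 0 * R" by (intro tendsto_intros lim0)
    then have "(\<lambda>k. inverse (real (Suc k)) * R) \<longlonglongrightarrow> 0" by simp
    then have "(\<lambda>k. q k ((norm x)\<^sup>2) - U (norm x)) \<longlonglongrightarrow> 0"
      by (rule Lim_null_comparison[rotated]) (intro always_eventually allI, simp only: real_norm_def qU[OF t])
    from tendsto_add[OF this tendsto_const[of "U (norm x)"]] have "(\<lambda>k. q k ((norm x)\<^sup>2)) \<longlonglongrightarrow> U (norm x)" by simp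
    then have "(\<lambda>k. U (norm x) - \<psi> k x) \<longlonglongrightarrow> U (norm x) - 1 * U (norm x)"
      unfolding \<psi>_def by (intro tendsto_diff tendsto_const tendsto_mult E_lim[OF t])
    then show ?thesis by simp
  qed
  obtain D where D_: "\<forall>t\<in>{0..R}. \<bar>U t\<bar> \<le> D" by (rule continuous_on_Icc_bounded[OF Ucont])
  note D = D_[rule_format]
  have \<psi>_bound: "\<bar>U (norm x) - \<psi> k x\<bar> \<le> D + C * R" if x: "x \<in> ?B" for k x
  proof -
    have t: "norm x \<in> {0..<R}" using x by simp
    have "\<bar>q k ((norm x)\<^sup>2)\<bar> \<le> C * R"
      by (rule order_trans[OF qC[OF t, of k]]) (use C0 in simp)
    then have "\<bar>\<psi> k x\<bar> \<le> 1 * (C * R)"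
      unfolding \<psi>_def abs_mult using E by (intro mult_mono) auto
    then show ?thesis using D[of "norm x"] t by (auto simp: abs_le_iff)
  qed
  have um: "(\<lambda>x. U (norm x)) \<in> borel_measurable (lebesgue_on ?B)"
    by (rule continuous_imp_measurable_on_sets_lebesgue[OF continuous_on_subset[OF continuous_on_norm_compose[OF Ucont] ball_subset_cball] S])
  have Wm: "(\<lambda>x. W (norm x)) \<in> borel_measurable (lebesgue_on ?B)"
    by (rule continuous_imp_measurable_on_sets_lebesgue[OF continuous_on_subset[OF continuous_on_norm_compose[OF W] ball_subset_cball] S])
  have idm: "(\<lambda>x. x) \<in> borel_measurable (lebesgue_on ?B)"
    by (rule continuous_imp_measurable_on_sets_lebesgue[OF continuous_on_id S])
  have nm: "norm \<in> borel_measurable (lebesgue_on ?B)"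
    by (rule continuous_imp_measurable_on_sets_lebesgue[OF continuous_on_norm_id S])
  have Gm: "G \<in> borel_measurable (lebesgue_on ?B)"
    unfolding G_def[abs_def]
    by (intro borel_measurable_scaleR borel_measurable_uminus borel_measurable_divide Wm nm idm)
  note l2 = test_functions_L2[OF test S]
  have Gn: "norm (G x) \<le> M" if "x \<in> ?B" for x
  proof -
    have "norm (G x) \<le> \<bar>W (norm x)\<bar>" by (cases "x = 0") (simp_all add: G_def)
    then show ?thesis using M[of "norm x"] that by simp
  qed
  have lim1: "(\<lambda>k. LINT x|lebesgue_on ?B. (U (norm x) - \<psi> k x)\<^sup>2) \<longlonglongrightarrow> (LINT x|lebesgue_on ?B. 0)"
  proof (rule integral_dominated_convergence)
    show "(\<lambda>x. (U (norm x) - \<psi> k x)\<^sup>2) \<in> borel_measurable (lebesgue_on ?B)" for k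
      by (intro borel_measurable_power borel_measurable_diff um L2_measurable[OF l2(1)])
    show "integrable (lebesgue_on ?B) (\<lambda>x. (D + C * R)\<^sup>2)"
      by (rule integrable_lebesgue_on_bounded[OF L, where C="\<bar>(D + C * R)\<^sup>2\<bar>"]) auto
    show "AE x in lebesgue_on ?B. (\<lambda>k. (U (norm x) - \<psi> k x)\<^sup>2) \<longlonglongrightarrow> 0"
    proof (intro AE_I2)
      fix x assume "x \<in> space (lebesgue_on ?B)"
      then have "x \<in> ?B" by simp
      from tendsto_power[OF \<psi>_conv[OF this], of 2] show "(\<lambda>k. (U (norm x) - \<psi> k x)\<^sup>2) \<longlonglongrightarrow> 0" by simp
    qed
    show "AE x in lebesgue_on ?B. norm ((U (norm x) - \<psi> k x)\<^sup>2) \<le> (D + C * R)\<^sup>2" for k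
    proof (intro AE_I2)
      fix x assume "x \<in> space (lebesgue_on ?B)"
      then have "x \<in> ?B" by simp
      from power_mono[OF \<psi>_bound[OF this] abs_ge_zero, of k 2]
      show "norm ((U (norm x) - \<psi> k x)\<^sup>2) \<le> (D + C * R)\<^sup>2" by simp
    qed
  qed simp
  have lim2: "(\<lambda>k. LINT x|lebesgue_on ?B. (norm (G x - gradient (\<psi> k) x))\<^sup>2) \<longlonglongrightarrow> (LINT x|lebesgue_on ?B. 0)"
  proof (rule integral_dominated_convergence)
    show "(\<lambda>x. (norm (G x - gradient (\<psi> k) x))\<^sup>2) \<in> borel_measurable (lebesgue_on ?B)" for k
      using borel_measurable_diff[OF Gm L2_measurable[OF l2(2)[of k]]] by measurable
    show "integrable (lebesgue_on ?B) (\<lambda>x. (6 * C)\<^sup>2)"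
      by (rule integrable_lebesgue_on_bounded[OF L, where C="\<bar>(6 * C)\<^sup>2\<bar>"]) auto
    show "AE x in lebesgue_on ?B. (\<lambda>k. (norm (G x - gradient (\<psi> k) x))\<^sup>2) \<longlonglongrightarrow> 0"
    proof (intro AE_I2)
      fix x assume "x \<in> space (lebesgue_on ?B)"
      then have "norm x \<in> {0..<R}" by simp
      from tendsto_power[OF conv[OF this], of 2] show "(\<lambda>k. (norm (G x - gradient (\<psi> k) x))\<^sup>2) \<longlonglongrightarrow> 0"
        unfolding norm_diff power2_abs by simp
    qed
    show "AE x in lebesgue_on ?B. norm ((norm (G x - gradient (\<psi> k) x))\<^sup>2) \<le> (6 * C)\<^sup>2" for k
    proof (intro AE_I2)
      fix x assume "x \<in> space (lebesgue_on ?B)"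
      then have "norm x \<in> {0..<R}" by simp
      from power_mono[OF bound[OF this] abs_ge_zero, of k 2]
      show "norm ((norm (G x - gradient (\<psi> k) x))\<^sup>2) \<le> (6 * C)\<^sup>2" unfolding norm_diff by simp
    qed
  qed simp
  have "H10_pair ?B (\<lambda>x. U (norm x)) G"
    unfolding H10_pair_def
  proof (intro conjI exI[of _ \<psi>] allI test)
    show "(\<lambda>x. U (norm x)) \<in> L2 ?B"
      by (rule L2_bounded[OF L um, of D]) (use D in auto)
    show "G \<in> L2 ?B" by (rule L2_bounded[OF L Gm Gn])
    show "(\<lambda>k. (LINT x|lebesgue_on ?B. (U (norm x) - \<psi> k x)\<^sup>2)
        + (LINT x|lebesgue_on ?B. (norm (G x - gradient (\<psi> k) x))\<^sup>2)) \<longlonglongrightarrow> 0"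
      using tendsto_add[OF lim1 lim2] by simp
  qed
  then show ?thesis by (simp only: U_def G_def[abs_def])
qed

text \<open>The coefficient cancels: A times the gradient is minus \<open>flux_field F\<close>,
  whatever \<open>\<alpha>\<close> is. The equation is then the divergence identity, extended from
  test functions to \<open>H10\<close> by L2 limits.\<close>

lemma weak_solution_radial:
  fixes f A :: "'a::euclidean_space \<Rightarrow> real" and \<alpha> :: "real \<Rightarrow> real"
  assumes R: "R > 0" and F: "radial_density R F"
    and f: "f \<in> L2 (ball 0 R)" and fF: "AE x in lebesgue_on (ball 0 R). f x = F (norm x)"
    and \<alpha>: "continuous_on {0..R} \<alpha>" "\<And>t. t \<in> {0..R} \<Longrightarrow> \<alpha> t > 0"
    and A: "\<And>x. x \<in> ball 0 R \<Longrightarrow> A x = \<alpha> (norm x)"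
  shows "weak_solution (ball 0 R) A f (\<lambda>x. integral {norm x..R} (\<lambda>t. flux DIM('a) F t / \<alpha> t))"
proof -
  let ?B = "ball (0 :: 'a) R"
  have S: "?B \<in> sets lebesgue" and L: "?B \<in> lmeasurable" by auto
  define W where "W t = flux DIM('a) F t / \<alpha> t" for t
  have W: "continuous_on {0..R} W"
    unfolding W_def using \<alpha> by (intro continuous_intros continuous_on_subset[OF continuous_on_flux[OF F]]) force+
  have W0: "W 0 = 0" by (simp add: W_def flux_0)
  note pair = H10_pair_radial[OF R W W0, where 'a='a]
  have V: "flux_field F \<in> L2 ?B"
    by (rule L2_bounded[OF L _ norm_flux_field[OF F]])
      (use borel_measurable_flux_field[OF F, where 'a='a] in \<open>intro measurable_restrict_space1 measurable_completion, simp\<close>)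
  have "(LINT x|lebesgue_on ?B. A x * (- (W (norm x) / norm x) *\<^sub>R x \<bullet> Gv x)) = (LINT x|lebesgue_on ?B. f x * v x)"
    if v: "v \<in> H10 ?B" and Gv: "has_weak_gradient ?B v Gv" for v Gv
  proof -
    obtain G where G: "H10_pair ?B v G" using v H10_iff_pair[OF S] by blast
    obtain \<psi> where \<psi>_: "v \<in> L2 ?B" "G \<in> L2 ?B" "\<forall>k. \<psi> k \<in> test_functions ?B"
      "(\<lambda>k. LINT x|lebesgue_on ?B. (norm (v x - \<psi> k x))\<^sup>2) \<longlonglongrightarrow> 0"
      "(\<lambda>k. LINT x|lebesgue_on ?B. (norm (G x - gradient (\<psi> k) x))\<^sup>2) \<longlonglongrightarrow> 0"
      by (rule H10_pairE[OF G])
    note \<psi> = \<psi>_(1,2) \<psi>_(3)[rule_format] \<psi>_(4,5)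
    have "(\<lambda>k. LINT x|lebesgue_on ?B. gradient (\<psi> k) x \<bullet> flux_field F x) \<longlonglongrightarrow> (LINT x|lebesgue_on ?B. G x \<bullet> flux_field F x)"
      by (rule L2_tendsto_inner[OF \<psi>(2) test_functions_L2(2)[OF \<psi>(3) S] V \<psi>(5)])
    moreover have "(LINT x|lebesgue_on ?B. gradient (\<psi> k) x \<bullet> flux_field F x) = - (LINT x|lebesgue_on ?B. \<psi> k x \<bullet> f x)" for k
    proof -
      have "(LINT x|lebesgue_on ?B. flux_field F x \<bullet> gradient (\<psi> k) x) = - (LINT x|lebesgue_on ?B. F (norm x) * \<psi> k x)"
        using flux_identity_radial_density[OF R F, where 'a='a] \<psi>(3)[of k] unfolding flux_identity_def by blast
      moreover have "(LINT x|lebesgue_on ?B. f x * \<psi> k x) = (LINT x|lebesgue_on ?B. F (norm x) * \<psi> k x)"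
      proof (rule integral_lebesgue_on_cong_AE[OF S])
        show "(\<lambda>x. f x * \<psi> k x) \<in> borel_measurable (lebesgue_on ?B)"
          by (intro borel_measurable_times L2_measurable[OF f] L2_measurable[OF test_functions_L2(1)[OF \<psi>(3) S]])
        show "AE x in lebesgue_on ?B. f x * \<psi> k x = F (norm x) * \<psi> k x"
          using fF by eventually_elim simp
      qed
      ultimately show ?thesis by (simp add: inner_commute mult.commute)
    qed
    moreover have "(\<lambda>k. - (LINT x|lebesgue_on ?B. \<psi> k x \<bullet> f x)) \<longlonglongrightarrow> - (LINT x|lebesgue_on ?B. v x \<bullet> f x)"
      by (intro tendsto_minus L2_tendsto_inner[OF \<psi>(1) test_functions_L2(1)[OF \<psi>(3) S] f \<psi>(4)])
    ultimately have "(LINT x|lebesgue_on ?B. G x \<bullet> flux_field F x) = - (LINT x|lebesgue_on ?B. v x \<bullet> f x)"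
      using LIMSEQ_unique by simp
    \<comment> \<open>\<open>G\<close> comes from the approximating sequence and \<open>Gv\<close>
      is an arbitrary weak gradient of v; they agree almost everywhere.\<close>
    moreover have "(LINT x|lebesgue_on ?B. G x \<bullet> flux_field F x) = (LINT x|lebesgue_on ?B. Gv x \<bullet> flux_field F x)"
    proof (rule integral_lebesgue_on_cong_AE[OF S borel_measurable_integrable[OF L2_inner_integrable[OF \<psi>(2) V]]])
      show "AE x in lebesgue_on ?B. G x \<bullet> flux_field F x = Gv x \<bullet> flux_field F x"
        using weak_gradient_unique[OF H10_pair_weak_gradient[OF G S] Gv] by eventually_elim simp
    qed
    moreover have "(LINT x|lebesgue_on ?B. A x * (- (W (norm x) / norm x) *\<^sub>R x \<bullet> Gv x)) = (LINT x|lebesgue_on ?B. - (Gv x \<bullet> flux_field F x))"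
    proof (rule Bochner_Integration.integral_cong[OF refl])
      fix x assume "x \<in> space (lebesgue_on ?B)"
      then have x: "x \<in> ?B" by simp
      then have "\<alpha> (norm x) > 0" using \<alpha>(2)[of "norm x"] by simp
      then show "A x * (- (W (norm x) / norm x) *\<^sub>R x \<bullet> Gv x) = - (Gv x \<bullet> flux_field F x)"
        unfolding A[OF x] W_def flux_field_def by (simp add: inner_commute)
    qed
    ultimately show ?thesis by (simp add: mult.commute)
  qed
  then show ?thesis
    unfolding weak_solution_def W_def[symmetric]
    using pair H10_pair_weak_gradient[OF pair S] H10_iff_pair[OF S] by blast
qed

lemma L2_radial_continuous:
  assumes R: "R > 0" and U: "continuous_on {0..R} (U :: real \<Rightarrow> real)"
  shows "(\<lambda>x :: 'a::euclidean_space. U (norm x)) \<in> L2_radial R"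
proof -
  obtain D where D_: "\<forall>t\<in>{0..R}. \<bar>U t\<bar> \<le> D" by (rule continuous_on_Icc_bounded[OF U])
  note D = D_[rule_format]
  have "(\<lambda>x :: 'a. U (norm x)) \<in> L2 (ball 0 R)"
  proof (rule L2_bounded[of _ _ D])
    show "(\<lambda>x :: 'a. U (norm x)) \<in> borel_measurable (lebesgue_on (ball 0 R))"
      by (rule continuous_imp_measurable_on_sets_lebesgue[OF continuous_on_subset[OF continuous_on_norm_compose[OF U] ball_subset_cball]]) auto
  qed (use D in auto)
  moreover have "U \<in> L2 {0<..<R}"
  proof (rule L2_bounded[of _ _ D])
    show "U \<in> borel_measurable (lebesgue_on {0<..<R})"
      by (rule continuous_imp_measurable_on_sets_lebesgue[OF continuous_on_subset[OF U]]) auto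
    show "{0<..<R} \<in> lmeasurable" by (simp add: bounded_set_imp_lmeasurable)
  qed (use D in auto)
  ultimately show ?thesis unfolding L2_radial_def by auto
qed

section \<open>The nonlocal term and a fixed point theorem\<close>

text \<open>Both sides times the volume of the unit ball equal
  \<open>\<integral>\<integral> h (T x + y) 1\<^bsub>B\<^esub>(y) dy dx\<close>, by translation invariance in either variable.
  (\<open>measure_orthogonal_image\<close> is restricted to well-ordered index types.)\<close>
lemma nn_integral_lborel_orthogonal:
  fixes T :: "'a::euclidean_space \<Rightarrow> 'a" and h :: "'a \<Rightarrow> ennreal"
  assumes T: "orthogonal_transformation T" and h: "h \<in> borel_measurable borel"
  shows "(\<integral>\<^sup>+x. h (T x) \<partial>lborel) = (\<integral>\<^sup>+x. h x \<partial>lborel)"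
proof -
  define S where "S = inv T"
  have S: "T (S y) = y" for y
    using orthogonal_transformation_surj[OF T] by (simp add: S_def surj_f_inv_f)
  note lin = orthogonal_transformation_linear[OF T]
  have Tm: "T \<in> borel_measurable borel"
    using linear_continuous_on[OF linear_conv_bounded_linear[THEN iffD1, OF lin], of UNIV]
    by (rule borel_measurable_continuous_onI)
  have shift: "(\<integral>\<^sup>+x. k (c + x) \<partial>lborel) = (\<integral>\<^sup>+x. k x \<partial>lborel)"
    if "k \<in> borel_measurable borel" for k :: "'a \<Rightarrow> ennreal" and c
    using nn_integral_distr[of "(+) c" lborel borel k] that by (simp add: lborel_distr_plus)
  define B where "B = (ball 0 1 :: 'a set)"
  define v where "v = emeasure lborel B"
  have v: "v \<noteq> 0" "v \<noteq> \<infinity>"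
    using emeasure_ball[of 1 "0 :: 'a"] unit_ball_vol_pos[of "real DIM('a)"]
    by (auto simp: v_def B_def simp del: unit_ball_vol_pos)
  \<comment> \<open>The points x with T x at distance less than 1 from y form the unit ball about
    \<open>S y\<close>, because T is an isometry.\<close>
  have ball_shift: "(\<integral>\<^sup>+x. indicator B (y - T x) \<partial>lborel) = v" for y
  proof -
    have "y - T x = T (S y - x)" for x using lin S by (simp add: linear_diff)
    then have "norm (y - T x) = norm (S y - x)" for x
      using orthogonal_transformation_norm[OF T] by simp
    then have "(indicator B (y - T x) :: ennreal) = indicator (ball (S y) 1) x" for x :: 'a
      by (simp add: B_def dist_norm indicator_def norm_minus_commute[of "T x" y])
    then have "(\<integral>\<^sup>+x. indicator B (y - T x) \<partial>lborel) = emeasure lborel (ball (S y) 1)" by simp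
    then show ?thesis by (simp add: v_def B_def emeasure_ball)
  qed
  have Bm: "B \<in> sets borel" by (simp add: B_def)
  have "v * (\<integral>\<^sup>+x. h (T x) \<partial>lborel) = (\<integral>\<^sup>+y. indicator B y * (\<integral>\<^sup>+x. h (T x) \<partial>lborel) \<partial>lborel)"
    using Bm by (simp add: v_def nn_integral_multc)
  also have "\<dots> = (\<integral>\<^sup>+y. (\<integral>\<^sup>+x. indicator B y * h (T x + y) \<partial>lborel) \<partial>lborel)"
  proof (rule nn_integral_cong)
    fix y
    have "(\<integral>\<^sup>+x. h (T x) \<partial>lborel) = (\<integral>\<^sup>+x. h (T (S y + x)) \<partial>lborel)"
      by (rule shift[of "\<lambda>x. h (T x)", symmetric]) (use h Tm in measurable)
    also have "\<dots> = (\<integral>\<^sup>+x. h (T x + y) \<partial>lborel)"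
      using lin S by (simp add: linear_add add.commute)
    finally have "(\<integral>\<^sup>+x. h (T x) \<partial>lborel) = (\<integral>\<^sup>+x. h (T x + y) \<partial>lborel)" .
    then show "indicator B y * (\<integral>\<^sup>+x. h (T x) \<partial>lborel) = (\<integral>\<^sup>+x. indicator B y * h (T x + y) \<partial>lborel)"
      using h Tm by (simp add: nn_integral_cmult)
  qed
  also have "\<dots> = (\<integral>\<^sup>+x. (\<integral>\<^sup>+y. indicator B y * h (T x + y) \<partial>lborel) \<partial>lborel)"
    by (rule lborel_pair.Fubini') (use h Tm Bm in measurable)
  also have "\<dots> = (\<integral>\<^sup>+x. (\<integral>\<^sup>+y. indicator B (y - T x) * h y \<partial>lborel) \<partial>lborel)"
  proof (rule nn_integral_cong)
    fix x
    have "(\<integral>\<^sup>+y. indicator B (T x + y - T x) * h (T x + y) \<partial>lborel) = (\<integral>\<^sup>+y. indicator B (y - T x) * h y \<partial>lborel)"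
      by (rule shift[of "\<lambda>y. indicator B (y - T x) * h y"]) (use h Bm in measurable)
    then show "(\<integral>\<^sup>+y. indicator B y * h (T x + y) \<partial>lborel) = (\<integral>\<^sup>+y. indicator B (y - T x) * h y \<partial>lborel)"
      by simp
  qed
  also have "\<dots> = (\<integral>\<^sup>+y. (\<integral>\<^sup>+x. indicator B (y - T x) * h y \<partial>lborel) \<partial>lborel)"
    by (rule lborel_pair.Fubini') (use h Tm Bm in measurable)
  also have "\<dots> = (\<integral>\<^sup>+y. v * h y \<partial>lborel)"
  proof (rule nn_integral_cong)
    fix y
    have "(\<lambda>x. indicator B (y - T x) :: ennreal) \<in> borel_measurable lborel" using Tm Bm by measurable
    then show "(\<integral>\<^sup>+x. indicator B (y - T x) * h y \<partial>lborel) = v * h y"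
      by (simp add: nn_integral_multc ball_shift)
  qed
  also have "\<dots> = v * (\<integral>\<^sup>+y. h y \<partial>lborel)" using h by (simp add: nn_integral_cmult)
  finally show ?thesis using v by (simp add: ennreal_mult_cancel_left)
qed

lemma integral_lborel_orthogonal:
  fixes T :: "'a::euclidean_space \<Rightarrow> 'a" and h :: "'a \<Rightarrow> real"
  assumes T: "orthogonal_transformation T" and h: "h \<in> borel_measurable borel"
  shows "(LINT x|lborel. h (T x)) = (LINT x|lborel. h x)"
proof -
  have Tm: "T \<in> borel_measurable borel"
    using linear_continuous_on[OF linear_conv_bounded_linear[THEN iffD1, OF orthogonal_transformation_linear[OF T]], of UNIV]
    by (rule borel_measurable_continuous_onI)
  have "distr lborel borel T = lborel"
  proof (rule measure_eqI)
    fix A assume A: "A \<in> sets (distr lborel borel T)"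
    have "emeasure (distr lborel borel T) A = (\<integral>\<^sup>+x. indicator A x \<partial>distr lborel borel T)"
      using A by simp
    also have "\<dots> = (\<integral>\<^sup>+x. indicator A (T x) \<partial>lborel)"
      by (rule nn_integral_distr) (use A Tm in auto)
    also have "\<dots> = (\<integral>\<^sup>+x. indicator A x \<partial>lborel)"
      by (rule nn_integral_lborel_orthogonal[OF T]) (use A in auto)
    finally show "emeasure (distr lborel borel T) A = emeasure lborel A" using A by simp
  qed simp
  then show ?thesis
    using integral_distr[of T lborel borel h] Tm h by simp
qed

text \<open>The given profile is only Lebesgue measurable, so a Borel version replaces it. Taking
  its absolute value makes it nonnegative everywhere and preserves the almost everywhere identity,
  since f is nonnegative almost everywhere.\<close>

lemma L2_radial_density:
  fixes f :: "'a::euclidean_space \<Rightarrow> real"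
  assumes f: "f \<in> L2_radial R" and pos: "AE x in lebesgue_on (ball 0 R). f x \<ge> 0" and R: "R > 0"
  obtains F where "radial_density R F" and "\<forall>t. F t \<ge> 0"
    and "AE x in lebesgue_on (ball 0 R). f x = F (norm x)"
proof -
  obtain w where w: "w \<in> L2 {0<..<R}" and fw: "AE x in lebesgue_on (ball 0 R). f x = w (norm x)"
    using f unfolding L2_radial_def by blast
  have S: "{0<..<R} \<in> sets lebesgue" by simp
  define w0 where "w0 t = (if t \<in> {0<..<R} then w t else 0)" for t
  have "integrable (lebesgue_on {0<..<R}) w"
    by (rule L2_integrable[OF w]) (simp add: bounded_set_imp_lmeasurable)
  then have w0i: "integrable lebesgue w0"
    unfolding w0_def[abs_def] by (rule Lebesgue_Measure.integrable_restrict_UNIV[OF S, THEN iffD2])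
  obtain F0 where F0: "F0 \<in> borel_measurable lborel" "AE t in lborel. w0 t = F0 t"
    using completion_ex_borel_measurable_real[OF borel_measurable_integrable[OF w0i]] by blast
  define F where "F t = indicator {0<..<R} t * \<bar>F0 t\<bar>" for t
  have "integrable lebesgue F0"
    by (rule integrable_cong_AE_imp[OF w0i])
      (use F0 in \<open>auto simp: measurable_completion AE_completion_iff\<close>)
  then have F0i: "integrable lborel F0" using F0(1) by (simp add: integrable_completion)
  have "integrable lborel (\<lambda>t. indicator {0<..<R} t *\<^sub>R \<bar>F0 t\<bar>)"
    by (rule integrable_mult_indicator) (use F0i in auto)
  then have "radial_density R F" by (auto simp: radial_density_def F_def[abs_def])
  moreover have "\<forall>t. F t \<ge> 0" by (simp add: F_def)
  moreover have "AE x in lebesgue_on (ball (0 :: 'a) R). norm x \<in> {0<..<R} \<and> w (norm x) = F0 (norm x)"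
  proof (rule AE_ball_normI[OF R])
    show "AE t in lborel. t \<in> {0<..<R} \<longrightarrow> t \<in> {0<..<R} \<and> w t = F0 t"
      using F0(2) by eventually_elim (auto simp: w0_def)
  qed
  then have "AE x in lebesgue_on (ball 0 R). f x = F (norm x)"
    using fw pos by eventually_elim (simp add: F_def)
  ultimately show ?thesis by (rule that)
qed

section \<open>Continuity, monotonicity and symmetry of the nonlocal operator\<close>

text \<open>Moving x from the domain into an indicator puts all values over one measure space, as
  dominated convergence and comparison require.\<close>

lemma nonlocal_eq_indicator:
  fixes g v :: "'a::euclidean_space \<Rightarrow> real"
  assumes "\<Omega> \<in> sets lebesgue"
  shows "nonlocal \<Omega> g r v x = (LINT y|lebesgue_on \<Omega>. indicator (cball x r) y * (g y * v y))"
proof -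
  have e: "(\<lambda>y. indicat_real (\<Omega> \<inter> cball x r) y *\<^sub>R (g y * v y))
      = (\<lambda>y. indicat_real \<Omega> y *\<^sub>R (indicat_real (cball x r) y * (g y * v y)))"
    by (auto simp: fun_eq_iff split: split_indicator)
  have "nonlocal \<Omega> g r v x = (LINT y|lebesgue. indicat_real (\<Omega> \<inter> cball x r) y *\<^sub>R (g y * v y))"
    unfolding nonlocal_def by (rule Bochner_Integration.integral_restrict_space) (use assms in auto)
  also have "\<dots> = (LINT y|lebesgue_on \<Omega>. indicator (cball x r) y * (g y * v y))"
    unfolding e by (rule Bochner_Integration.integral_restrict_space[symmetric]) (use assms in auto)
  finally show ?thesis .
qed

lemma nonlocal_integrable:
  fixes h :: "'a::euclidean_space \<Rightarrow> real"
  assumes "integrable (lebesgue_on \<Omega>) h"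
  shows "integrable (lebesgue_on \<Omega>) (\<lambda>y. indicator (cball x r) y * h y)"
proof -
  have "integrable (lebesgue_on \<Omega>) (\<lambda>y. indicator (cball x r \<inter> \<Omega>) y *\<^sub>R h y)"
    by (rule integrable_mult_indicator[OF _ assms]) (auto simp: sets_restrict_space)
  then show ?thesis
    by (rule Bochner_Integration.integrable_cong[THEN iffD1, OF refl, rotated]) (auto split: split_indicator)
qed

text \<open>Spheres are null sets, so for almost every y membership in the moving closed ball is
  eventually constant.\<close>

lemma continuous_on_nonlocal:
  fixes g v :: "'a::euclidean_space \<Rightarrow> real"
  assumes S: "\<Omega> \<in> sets lebesgue" and h: "integrable (lebesgue_on \<Omega>) (\<lambda>y. g y * v y)"
  shows "continuous_on UNIV (nonlocal \<Omega> g r v)"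
  unfolding continuous_on_sequentially
proof (intro allI ballI impI, elim conjE)
  fix z :: "nat \<Rightarrow> 'a" and x assume z: "z \<longlonglongrightarrow> x"
  show "(nonlocal \<Omega> g r v \<circ> z) \<longlonglongrightarrow> nonlocal \<Omega> g r v x"
    unfolding comp_def nonlocal_eq_indicator[OF S]
  proof (rule integral_dominated_convergence)
    show "(\<lambda>y. indicator (cball x r) y * (g y * v y)) \<in> borel_measurable (lebesgue_on \<Omega>)"
      "(\<lambda>y. indicator (cball (z k) r) y * (g y * v y)) \<in> borel_measurable (lebesgue_on \<Omega>)" for k
      by (rule borel_measurable_integrable[OF nonlocal_integrable[OF h]])+
    show "integrable (lebesgue_on \<Omega>) (\<lambda>y. \<bar>g y * v y\<bar>)" using h by (rule integrable_abs)
    show "AE y in lebesgue_on \<Omega>. norm (indicator (cball (z k) r) y * (g y * v y)) \<le> \<bar>g y * v y\<bar>" for k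
      by (intro AE_I2) (auto split: split_indicator)
    have "AE y in lebesgue. y \<notin> sphere x r"
      by (intro AE_not_in) (simp add: negligible_iff_null_sets[symmetric] negligible_sphere)
    then show "AE y in lebesgue_on \<Omega>. (\<lambda>k. indicator (cball (z k) r) y * (g y * v y)) \<longlonglongrightarrow> indicator (cball x r) y * (g y * v y)"
      unfolding AE_lebesgue_on_iff[OF S]
    proof eventually_elim
      case (elim y)
      have d: "(\<lambda>k. dist (z k) y) \<longlonglongrightarrow> dist x y" by (intro tendsto_intros z)
      have "eventually (\<lambda>k. dist (z k) y \<le> r \<longleftrightarrow> dist x y \<le> r) sequentially"
        using order_tendstoD[OF d, of r] elim by (cases "dist x y < r") (auto elim!: eventually_mono)
      then have "eventually (\<lambda>k. indicator (cball (z k) r) y * (g y * v y) = indicator (cball x r) y * (g y * v y)) sequentially"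
        by eventually_elim (simp add: indicator_def)
      then show ?case by (intro impI tendsto_eventually)
    qed
  qed
qed

lemma nonlocal_cong_AE:
  fixes g v g' v' :: "'a::euclidean_space \<Rightarrow> real"
  assumes S: "\<Omega> \<in> sets lebesgue" and h: "integrable (lebesgue_on \<Omega>) (\<lambda>y. g y * v y)"
    and ae: "AE y in lebesgue_on \<Omega>. g y * v y = g' y * v' y"
  shows "nonlocal \<Omega> g r v x = nonlocal \<Omega> g' r v' x"
  unfolding nonlocal_eq_indicator[OF S]
  by (rule integral_lebesgue_on_cong_AE[OF S borel_measurable_integrable[OF nonlocal_integrable[OF h]]])
    (use ae in eventually_elim, simp)

lemma nonlocal_mono:
  fixes g v w :: "'a::euclidean_space \<Rightarrow> real"
  assumes S: "\<Omega> \<in> sets lebesgue"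
    and v: "integrable (lebesgue_on \<Omega>) (\<lambda>y. g y * v y)" and w: "integrable (lebesgue_on \<Omega>) (\<lambda>y. g y * w y)"
    and le: "AE y in lebesgue_on \<Omega>. g y * v y \<le> g y * w y"
  shows "nonlocal \<Omega> g r v x \<le> nonlocal \<Omega> g r w x"
  unfolding nonlocal_eq_indicator[OF S]
  by (rule integral_mono_AE[OF nonlocal_integrable[OF v] nonlocal_integrable[OF w]])
    (use le in eventually_elim, auto split: split_indicator)

lemma nonlocal_abs_le:
  fixes g v :: "'a::euclidean_space \<Rightarrow> real"
  assumes S: "\<Omega> \<in> sets lebesgue" and v: "integrable (lebesgue_on \<Omega>) (\<lambda>y. g y * v y)"
  shows "\<bar>nonlocal \<Omega> g r v x\<bar> \<le> (LINT y|lebesgue_on \<Omega>. \<bar>g y * v y\<bar>)"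
proof -
  have "\<bar>nonlocal \<Omega> g r v x\<bar> \<le> (LINT y|lebesgue_on \<Omega>. \<bar>indicator (cball x r) y * (g y * v y)\<bar>)"
    unfolding nonlocal_eq_indicator[OF S] by (rule integral_abs_bound)
  also have "\<dots> \<le> (LINT y|lebesgue_on \<Omega>. \<bar>g y * v y\<bar>)"
    by (rule integral_mono[OF integrable_abs[OF nonlocal_integrable[OF v]] integrable_abs[OF v]])
      (auto split: split_indicator)
  finally show ?thesis .
qed

lemma nonlocal_diff:
  fixes g v w :: "'a::euclidean_space \<Rightarrow> real"
  assumes S: "\<Omega> \<in> sets lebesgue"
    and v: "integrable (lebesgue_on \<Omega>) (\<lambda>y. g y * v y)" and w: "integrable (lebesgue_on \<Omega>) (\<lambda>y. g y * w y)"
  shows "nonlocal \<Omega> g r v x - nonlocal \<Omega> g r w x = nonlocal \<Omega> g r (\<lambda>y. v y - w y) x"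
  unfolding nonlocal_eq_indicator[OF S]
  using Bochner_Integration.integral_diff[OF nonlocal_integrable[OF v] nonlocal_integrable[OF w]]
  by (simp add: right_diff_distrib)

lemma nonlocal_divide:
  fixes g v :: "'a::euclidean_space \<Rightarrow> real"
  shows "nonlocal \<Omega> g r (\<lambda>y. v y / c) x = nonlocal \<Omega> g r v x / c"
  unfolding nonlocal_def by simp

text \<open>An orthogonal map taking x to y preserves norms and Lebesgue measure, and carries
  \<open>cball x r\<close> to \<open>cball y r\<close>.\<close>

lemma nonlocal_radial:
  fixes x y :: "real ^ 'n"
  assumes "norm x = norm y" and G: "G \<in> borel_measurable borel" and U: "U \<in> borel_measurable borel"
  shows "nonlocal (ball 0 R) (\<lambda>y. G (norm y)) r (\<lambda>y. U (norm y)) x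
    = nonlocal (ball 0 R) (\<lambda>y. G (norm y)) r (\<lambda>y. U (norm y)) y"
proof -
  obtain T where T: "orthogonal_transformation T" "T x = y"
    by (rule orthogonal_transformation_exists[OF assms(1)])
  define k where "k x z = indicator (ball 0 R \<inter> cball x r) z * (G (norm z) * U (norm z))" for x z :: "real ^ 'n"
  have km: "k x \<in> borel_measurable borel" for x
    unfolding k_def[abs_def] by (intro borel_measurable_times borel_measurable_indicator
        measurable_compose[OF borel_measurable_norm G] measurable_compose[OF borel_measurable_norm U]) auto
  have e: "nonlocal (ball 0 R) (\<lambda>y. G (norm y)) r (\<lambda>y. U (norm y)) x = (LINT z|lborel. k x z)" for x :: "real ^ 'n"
  proof -
    have "nonlocal (ball 0 R) (\<lambda>y. G (norm y)) r (\<lambda>y. U (norm y)) x = (LINT z|lebesgue_on (ball 0 R \<inter> cball x r). k x z)"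
      unfolding nonlocal_def by (rule Bochner_Integration.integral_cong) (auto simp: k_def)
    also have "\<dots> = (LINT z|lborel. k x z)"
      by (rule integral_lebesgue_on_eq_lborel[OF _ km]) (auto simp: k_def)
    finally show ?thesis .
  qed
  have "k y (T z) = k x z" for z
  proof -
    have "T x - T z = T (x - z)" using orthogonal_transformation_linear[OF T(1)] by (simp add: linear_diff)
    then have "norm (y - T z) = norm (x - z)"
      using T orthogonal_transformation_norm[OF T(1)] by simp
    then show ?thesis
      using orthogonal_transformation_norm[OF T(1), of z] by (simp add: k_def indicator_def dist_norm)
  qed
  then show ?thesis
    unfolding e using integral_lborel_orthogonal[OF T(1) km[of y]] by simp
qed

text \<open>Kuhn's labelling lemma on the grid of step functions yields almost fixed points, and
  Arzela-Ascoli a limit of these.\<close>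
lemma fixed_point_equi_Lipschitz:
  fixes T :: "(real \<Rightarrow> real) \<Rightarrow> real \<Rightarrow> real"
  assumes R: "R > 0" and M: "M \<ge> 0" and L: "L \<ge> 0"
    and range: "\<And>U t. U \<in> borel_measurable borel \<Longrightarrow> (\<And>t. 0 \<le> U t \<and> U t \<le> M) \<Longrightarrow> t \<in> {0..R} \<Longrightarrow> 0 \<le> T U t \<and> T U t \<le> M"
    and lip: "\<And>U s t. U \<in> borel_measurable borel \<Longrightarrow> (\<And>t. 0 \<le> U t \<and> U t \<le> M) \<Longrightarrow> s \<in> {0..R} \<Longrightarrow> t \<in> {0..R}
      \<Longrightarrow> \<bar>T U s - T U t\<bar> \<le> L * \<bar>s - t\<bar>"
    and cont: "\<And>e. e > 0 \<Longrightarrow> \<exists>d>0. \<forall>U V. U \<in> borel_measurable borel \<longrightarrow> V \<in> borel_measurable borel \<longrightarrow>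
      (\<forall>t. 0 \<le> U t \<and> U t \<le> M) \<longrightarrow> (\<forall>t. 0 \<le> V t \<and> V t \<le> M) \<longrightarrow> (\<forall>t\<in>{0..R}. \<bar>U t - V t\<bar> \<le> d) \<longrightarrow>
      (\<forall>t\<in>{0..R}. \<bar>T U t - T V t\<bar> \<le> e)"
  obtains U where "U \<in> borel_measurable borel" and "\<forall>t. 0 \<le> U t \<and> U t \<le> M" and "\<forall>t\<in>{0..R}. T U t = U t"
proof -
  define adm where "adm U \<longleftrightarrow> U \<in> borel_measurable borel \<and> (\<forall>t. 0 \<le> U t \<and> U t \<le> M)" for U :: "real \<Rightarrow> real"
  have range': "0 \<le> T U t" "T U t \<le> M" if "adm U" "t \<in> {0..R}" for U t
    using range[of U t] that unfolding adm_def by blast+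
  have lip': "\<bar>T U s - T U t\<bar> \<le> L * \<bar>s - t\<bar>" if "adm U" "s \<in> {0..R}" "t \<in> {0..R}" for U s t
    using lip[of U s t] that unfolding adm_def by blast
  have cont': "\<exists>d>0. \<forall>U V. adm U \<longrightarrow> adm V \<longrightarrow> (\<forall>t\<in>{0..R}. \<bar>U t - V t\<bar> \<le> d) \<longrightarrow>
      (\<forall>t\<in>{0..R}. \<bar>T U t - T V t\<bar> \<le> e)" if "e > 0" for e
    using cont[OF that] unfolding adm_def by blast
  have almost: "\<exists>V. adm V \<and> (\<forall>t\<in>{0..R}. \<bar>T V t - V t\<bar> \<le> e)" if e: "e > 0" for e
  proof -
    have "e / 3 > 0" using e by simp
    from cont'[OF this] obtain d where d: "d > 0" and dc: "\<And>U V t. adm U \<Longrightarrow> adm V \<Longrightarrow>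
        \<forall>t\<in>{0..R}. \<bar>U t - V t\<bar> \<le> d \<Longrightarrow> t \<in> {0..R} \<Longrightarrow> \<bar>T U t - T V t\<bar> \<le> e / 3"
      by blast
    \<comment> \<open>N makes the value step M/N at most d, and M/N + L R/N at most e/3.\<close>
    obtain N :: nat where N: "real N > (M + M + L * R + 1) / min d (e / 3)" using reals_Archimedean2 by blast
    have md: "min d (e / 3) > 0" using d e by simp
    have NB: "(M + M + L * R + 1) < real N * min d (e / 3)"
      using N md by (simp add: pos_divide_less_eq)
    have LR: "L * R \<ge> 0" using L R by simp
    have N0: "N > 0"
    proof (rule ccontr)
      assume "\<not> N > 0"
      then show False using NB M LR by simp
    qed
    have rN: "real N > 0" using N0 by simp
    have MN: "M / real N \<le> d" "M / real N + L * R / real N \<le> e / 3"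
    proof -
      have "M \<le> min d (e / 3) * real N" "M + L * R \<le> min d (e / 3) * real N"
        using NB M LR by (simp_all add: mult.commute)
      moreover have "min d (e / 3) * real N \<le> d * real N" "min d (e / 3) * real N \<le> e / 3 * real N"
        using rN by (intro mult_right_mono; simp)+
      ultimately have "M \<le> d * real N" "M + L * R \<le> e / 3 * real N" by linarith+
      then show "M / real N \<le> d" "M / real N + L * R / real N \<le> e / 3"
        using rN by (simp_all add: pos_divide_le_eq add_divide_distrib[symmetric])
    qed
    \<comment> \<open>The cell containing t; the minimum puts the endpoint R into the last
      cell.\<close>
    define idx where "idx t = min (N - 1) (nat \<lfloor>real N * t / R\<rfloor>)" for t :: real
    define node where "node i = real i * R / real N" for i :: nat
    \<comment> \<open>A grid point read as a step function with values in multiples of M/N; the cap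
      at N keeps every \<open>S x\<close> between 0 and M.\<close>
    define S where "S x t = M * real (min N (x (idx t))) / real N" for x :: "nat \<Rightarrow> nat" and t
    have idxN: "idx t < N" for t using N0 by (simp add: idx_def)
    have node: "node i \<in> {0..R}" if "i < N" for i
    proof -
      have "real i * R \<le> real N * R" using that R by (intro mult_right_mono) auto
      then show ?thesis using R rN by (simp add: node_def pos_divide_le_eq mult.commute)
    qed
    have idx_node: "\<bar>t - node (idx t)\<bar> \<le> R / real N" if t: "t \<in> {0..R}" for t
    proof -
      define a where "a = real N * t / R"
      have a: "0 \<le> a" "a \<le> real N" "t = a * R / real N"
        using t R rN by (auto simp: a_def divide_le_eq)
      have "real (idx t) \<le> a"
        using a(1) unfolding idx_def a_def[symmetric] by (simp add: min_def) linarith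
      moreover have "a \<le> real (idx t) + 1"
        using a(1,2) N0 unfolding idx_def a_def[symmetric] by (simp add: min_def of_nat_diff)
      ultimately have "\<bar>a - real (idx t)\<bar> \<le> 1" by simp
      then have "\<bar>a - real (idx t)\<bar> * (R / real N) \<le> 1 * (R / real N)" using R by (intro mult_right_mono) auto
      moreover have "t - node (idx t) = (a - real (idx t)) * (R / real N)"
        using a(3) by (simp add: node_def left_diff_distrib diff_divide_distrib)
      ultimately show ?thesis using R by (simp add: abs_mult)
    qed
    have S_adm: "adm (S x)" for x
    proof -
      have "idx \<in> measurable borel (count_space UNIV)"
        unfolding idx_def[abs_def] by measurable
      moreover have "(\<lambda>i. M * real (min N (x i)) / real N) \<in> measurable (count_space UNIV) borel" by simp
      ultimately have "S x \<in> borel_measurable borel"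
        unfolding S_def[abs_def] by (rule measurable_compose)
      moreover have "M * real (min N j) / real N \<le> M" for j
        using M rN by (simp add: pos_divide_le_eq mult_left_mono)
      ultimately show ?thesis using M by (auto simp: adm_def S_def)
    qed
    \<comment> \<open>Label 0 records that T is at least the grid value at the node, label 1 that it
      is at most that value. The labels forced by Kuhn's lemma at 0 and N agree with this because T
      stays within [0, M].\<close>
    define label :: "(nat \<Rightarrow> nat) \<Rightarrow> nat \<Rightarrow> nat" where
      "label x i = (if x i \<noteq> N \<and> (x i = 0 \<or> M * real (x i) / real N \<le> T (S x) (node i)) then 0 else 1)" for x i
    obtain q where q: "\<forall>i<N. q i < N"
      and qrs: "\<forall>i<N. \<exists>r s. (\<forall>j<N. q j \<le> r j \<and> r j \<le> q j + 1) \<and> (\<forall>j<N. q j \<le> s j \<and> s j \<le> q j + 1) \<and> label r i \<noteq> label s i"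
      by (rule kuhn_lemma[of N N label]) (use N0 in \<open>auto simp: label_def\<close>)
    have near: "\<bar>T (S x) t - T (S q) t\<bar> \<le> e / 3" if x: "\<forall>j<N. q j \<le> x j \<and> x j \<le> q j + 1" and t: "t \<in> {0..R}" for x t
    proof (rule dc[OF S_adm S_adm _ t], rule ballI)
      fix t
      have j: "q (idx t) \<le> x (idx t)" "x (idx t) \<le> q (idx t) + 1" "q (idx t) < N" using x q idxN by auto
      have "S x t - S q t = M * (real (x (idx t)) - real (q (idx t))) / real N"
        using j by (simp add: S_def min_def diff_divide_distrib right_diff_distrib)
      moreover have "\<bar>real (x (idx t)) - real (q (idx t))\<bar> \<le> 1" using j by linarith
      ultimately have "\<bar>S x t - S q t\<bar> \<le> M * 1 / real N"
        using M rN by (simp add: abs_mult divide_right_mono mult_left_le)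
      then show "\<bar>S x t - S q t\<bar> \<le> d" using MN(1) by simp
    qed
    \<comment> \<open>Both labels occur next to \<open>q\<close>, so T at the node is squeezed
      between neighbouring grid values, up to e/3 for moving to \<open>q\<close>.\<close>
    have at_node: "\<bar>T (S q) (node i) - M * real (q i) / real N\<bar> \<le> M / real N + e / 3" if i: "i < N" for i
    proof -
      have "\<exists>r s. (\<forall>j<N. q j \<le> r j \<and> r j \<le> q j + 1) \<and> (\<forall>j<N. q j \<le> s j \<and> s j \<le> q j + 1) \<and> label r i = 0 \<and> label s i = 1"
      proof -
        obtain r s where rs: "\<forall>j<N. q j \<le> r j \<and> r j \<le> q j + 1" "\<forall>j<N. q j \<le> s j \<and> s j \<le> q j + 1" "label r i \<noteq> label s i"
          using qrs i by blast
        show ?thesis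
        proof (cases "label r i = 0")
          case True
          then have "label s i = 1" using rs(3) by (simp add: label_def split: if_splits)
          then show ?thesis using rs True by blast
        next
          case False
          then have "label r i = 1" "label s i = 0" using rs(3) by (simp_all add: label_def split: if_splits)
          then show ?thesis using rs by blast
        qed
      qed
      then obtain r s where rs: "\<forall>j<N. q j \<le> r j \<and> r j \<le> q j + 1" "\<forall>j<N. q j \<le> s j \<and> s j \<le> q j + 1"
        and l: "label r i = 0" "label s i = 1" by blast
      have ri: "q i \<le> r i" "s i \<le> q i + 1" using rs i by auto
      have "M * real (q i) / real N \<le> M * real (r i) / real N"
        using M rN ri by (intro divide_right_mono mult_left_mono) auto
      also have "\<dots> \<le> T (S r) (node i)"
        using l(1) range'(1)[OF S_adm node[OF i], of r] by (auto simp: label_def split: if_splits)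
      finally have 1: "M * real (q i) / real N \<le> T (S r) (node i)" .
      have "T (S s) (node i) \<le> M * real (s i) / real N"
        using l(2) range'(2)[OF S_adm node[OF i], of s] rN by (auto simp: label_def split: if_splits)
      also have "\<dots> \<le> M * real (q i + 1) / real N"
        using M rN ri by (intro divide_right_mono mult_left_mono) auto
      finally have 2: "T (S s) (node i) \<le> M * real (q i) / real N + M / real N"
        by (simp add: distrib_left add_divide_distrib)
      have "\<bar>T (S r) (node i) - T (S q) (node i)\<bar> \<le> e / 3" "\<bar>T (S s) (node i) - T (S q) (node i)\<bar> \<le> e / 3"
        using near[OF rs(1) node[OF i]] near[OF rs(2) node[OF i]] .
      moreover have "M / real N \<ge> 0" using M by simp
      ultimately show ?thesis using 1 2 unfolding abs_le_iff by linarith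
    qed
    have "\<bar>T (S q) t - S q t\<bar> \<le> e" if t: "t \<in> {0..R}" for t
    proof -
      have "\<bar>T (S q) t - T (S q) (node (idx t))\<bar> \<le> L * \<bar>t - node (idx t)\<bar>"
        by (rule lip'[OF S_adm t node[OF idxN]])
      also have "\<dots> \<le> L * (R / real N)" by (rule mult_left_mono[OF idx_node[OF t] L])
      finally have 1: "\<bar>T (S q) t - T (S q) (node (idx t))\<bar> \<le> L * R / real N" by simp
      have 2: "S q t = M * real (q (idx t)) / real N"
        using q idxN[of t] by (auto simp: S_def min_def)
      show ?thesis
        using 1 at_node[OF idxN[of t]] MN(2) e unfolding 2[symmetric] abs_le_iff by linarith
    qed
    then show ?thesis using S_adm by blast
  qed
  have "\<exists>V. adm V \<and> (\<forall>t\<in>{0..R}. \<bar>T V t - V t\<bar> \<le> inverse (real (Suc k)))" for k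
    by (rule almost) simp
  then obtain V where V: "\<And>k. adm (V k)" "\<And>k t. t \<in> {0..R} \<Longrightarrow> \<bar>T (V k) t - V k t\<bar> \<le> inverse (real (Suc k))"
    by metis
  obtain g j where g: "continuous_on {0..R} g" and j: "strict_mono (j :: nat \<Rightarrow> nat)"
    and gj: "\<And>e. 0 < e \<Longrightarrow> \<exists>N. \<forall>n x. n \<ge> N \<and> x \<in> {0..R} \<longrightarrow> norm (T (V (j n)) x - g x) < e"
  proof (rule Arzela_Ascoli[of "{0..R}" "\<lambda>k. T (V k)" M])
    show "norm (T (V k) x) \<le> M" if "x \<in> {0..R}" for k x
      using range'[OF V(1)[of k] that] by simp
    show "\<exists>d>0. \<forall>k y. y \<in> {0..R} \<and> norm (x - y) < d \<longrightarrow> norm (T (V k) x - T (V k) y) < e"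
      if x: "x \<in> {0..R}" and e: "0 < e" for x e
    proof (intro exI[of _ "e / (L + 1)"] conjI allI impI)
      show "0 < e / (L + 1)" using e L by simp
      fix k y assume y: "y \<in> {0..R} \<and> norm (x - y) < e / (L + 1)"
      have "\<bar>T (V k) x - T (V k) y\<bar> \<le> L * \<bar>x - y\<bar>" using lip'[OF V(1) x] y by blast
      also have "\<dots> \<le> (L + 1) * \<bar>x - y\<bar>" by (intro mult_right_mono) auto
      also have "\<dots> < e" using y L by (simp add: pos_less_divide_eq mult.commute)
      finally show "norm (T (V k) x - T (V k) y) < e" by simp
    qed
  qed (simp, rule that)
  \<comment> \<open>Constant continuation beyond [0, R], since admissibility is a condition on the
    whole line.\<close>
  define U where "U t = g (max 0 (min R t))" for t
  have cl: "max 0 (min R t) \<in> {0..R}" for t using R by auto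
  have Ug: "U t = g t" if "t \<in> {0..R}" for t using that by (simp add: U_def min_absorb2 max_absorb2)
  have lim: "(\<lambda>n. T (V (j n)) t) \<longlonglongrightarrow> g t" if "t \<in> {0..R}" for t
    unfolding LIMSEQ_iff using gj that by blast
  have U: "adm U"
  proof -
    have "continuous_on UNIV U"
      unfolding U_def by (rule continuous_on_compose2[OF g]) (use cl in \<open>auto intro!: continuous_intros\<close>)
    moreover have "0 \<le> U t \<and> U t \<le> M" for t
    proof
      show "0 \<le> U t" unfolding U_def
        by (rule LIMSEQ_le_const[OF lim[OF cl]]) (use range'(1)[OF V(1) cl] in blast)
      show "U t \<le> M" unfolding U_def
        by (rule LIMSEQ_le_const2[OF lim[OF cl]]) (use range'(2)[OF V(1) cl] in blast)
    qed
    ultimately show ?thesis unfolding adm_def by (blast intro: borel_measurable_continuous_onI)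
  qed
  have "T U t = U t" if t: "t \<in> {0..R}" for t
  proof -
    \<comment> \<open>One e for passing from U to a late \<open>V (j n)\<close> inside T, one for
      the distance of its image from U.\<close>
    have "\<bar>T U t - U t\<bar> \<le> e + e" if e: "e > 0" for e
    proof -
      obtain d where d: "d > 0" and dc: "\<And>U V t. adm U \<Longrightarrow> adm V \<Longrightarrow>
          \<forall>t\<in>{0..R}. \<bar>U t - V t\<bar> \<le> d \<Longrightarrow> t \<in> {0..R} \<Longrightarrow> \<bar>T U t - T V t\<bar> \<le> e"
        using cont'[OF e] by blast
      have m: "min d e / 2 > 0" using d e by simp
      obtain N1 where N1: "\<And>n x. n \<ge> N1 \<Longrightarrow> x \<in> {0..R} \<Longrightarrow> norm (T (V (j n)) x - g x) < min d e / 2"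
        using gj[OF m] by blast
      obtain N2 where N2: "inverse (real (Suc N2)) < min d e / 2"
        using reals_Archimedean[OF m] by blast
      define n where "n = max N1 N2"
      have "n \<le> j n" by (rule seq_suble[OF j])
      then have iv: "inverse (real (Suc (j n))) \<le> inverse (real (Suc N2))"
        by (intro le_imp_inverse_le) (auto simp: n_def)
      have "\<bar>U s - V (j n) s\<bar> \<le> d" if s: "s \<in> {0..R}" for s
      proof -
        have "\<bar>T (V (j n)) s - g s\<bar> < min d e / 2" using N1[of n s] s by (simp add: n_def)
        moreover have "min d e \<le> d" by simp
        ultimately show ?thesis
          using V(2)[OF s, of "j n"] iv N2 unfolding Ug[OF s] abs_le_iff abs_less_iff by linarith
      qed
      then have "\<bar>T U t - T (V (j n)) t\<bar> \<le> e" by (intro dc[OF U V(1) _ t] ballI)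
      moreover have "\<bar>T (V (j n)) t - U t\<bar> < e"
      proof -
        have "\<bar>T (V (j n)) t - g t\<bar> < min d e / 2" using N1[of n t] t by (simp add: n_def)
        moreover have "min d e \<le> e" by simp
        ultimately show ?thesis using e unfolding Ug[OF t] by linarith
      qed
      ultimately show ?thesis by linarith
    qed
    then have "\<bar>T U t - U t\<bar> \<le> 0"
      by (metis field_sum_of_halves field_le_epsilon add_0 half_gt_zero)
    then show ?thesis by simp
  qed
  then show ?thesis using U that unfolding adm_def by blast
qed

section \<open>Solutions with nonlocal term in a given interval\<close>

lemma flux_quotient_continuous:
  assumes F: "radial_density R F" and \<alpha>: "continuous_on {0..R} \<alpha>" "\<And>t. t \<in> {0..R} \<Longrightarrow> \<alpha> t > 0"
  shows "continuous_on {0..R} (\<lambda>t. flux n F t / \<alpha> t)"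
proof -
  have "continuous_on {0..R} (flux n F)" by (rule continuous_on_subset[OF continuous_on_flux[OF F]]) auto
  then show ?thesis using \<alpha> by (intro continuous_on_divide) force+
qed

lemma integral_upper_part_lipschitz:
  fixes W :: "real \<Rightarrow> real"
  assumes W: "continuous_on {0..R} W" and bd: "\<And>t. t \<in> {0..R} \<Longrightarrow> \<bar>W t\<bar> \<le> L" and "s \<in> {0..R}" "t \<in> {0..R}"
  shows "\<bar>integral {s..R} W - integral {t..R} W\<bar> \<le> L * \<bar>s - t\<bar>"
proof -
  have "norm (integral {s..R} W - integral {t..R} W) \<le> L * norm (s - t)"
  proof (rule field_differentiable_bound[of "{0..R}" "\<lambda>t. integral {t..R} W" "\<lambda>t. - W t"])
    show "((\<lambda>t. integral {t..R} W) has_field_derivative - W z) (at z within {0..R})" if "z \<in> {0..R}" for z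
      by (rule integral_has_real_derivative'[OF W that])
  qed (use assms in auto)
  then show ?thesis by simp
qed

lemma L2_cong_AE:
  fixes u v :: "'a::euclidean_space \<Rightarrow> 'b::euclidean_space"
  assumes S: "S \<in> sets lebesgue" and u: "u \<in> L2 S" and ae: "AE x in lebesgue_on S. u x = v x"
  shows "v \<in> L2 S"
proof -
  have v: "v \<in> borel_measurable (lebesgue_on S)"
    by (rule borel_measurable_lebesgue_on_AE[OF S L2_measurable[OF u] ae])
  have "integrable (lebesgue_on S) (\<lambda>x. (norm (v x))\<^sup>2)"
  proof (rule integrable_cong_AE_imp[OF L2_integrable_norm_sq[OF u]])
    show "(\<lambda>x. (norm (v x))\<^sup>2) \<in> borel_measurable (lebesgue_on S)" using v by measurable
    show "AE x in lebesgue_on S. (norm (u x))\<^sup>2 = (norm (v x))\<^sup>2" using ae by eventually_elim simp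
  qed
  then show ?thesis using v by (simp add: L2_def)
qed

lemma abs_clip_diff_le: "\<bar>max lo (min hi x) - max lo (min hi y)\<bar> \<le> \<bar>x - y\<bar>" for lo hi x y :: real
  by (auto simp: max_def min_def)

text \<open>This treats a single interval [lo, hi]. The clipped coefficient lies between
  \<open>a hi\<close> and \<open>a lo\<close> for every profile, so the range and Lipschitz constant
  of the fixed point map are uniform.\<close>

lemma exists_radial_solution:
  fixes f g \<phi> :: "real ^ 'n \<Rightarrow> real" and a :: "real \<Rightarrow> real"
  assumes R: "R > 0" and f: "f \<in> L2_radial R" and g: "g \<in> L2_radial R"
    and f0: "AE x in lebesgue_on (ball 0 R). f x \<ge> 0" and g0: "AE x in lebesgue_on (ball 0 R). g x \<ge> 0"
    and a: "continuous_on {lo..hi} a" and lohi: "lo \<le> hi" and ahi: "a hi > 0"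
    and max: "\<And>t. t \<in> {lo..hi} \<Longrightarrow> a t \<le> a lo" and min: "\<And>t. t \<in> {lo..hi} \<Longrightarrow> a hi \<le> a t"
    and \<phi>: "weak_solution (ball 0 R) (\<lambda>x. 1) f \<phi>"
    and range: "\<And>x. x \<in> ball 0 R \<Longrightarrow> lo * a lo \<le> nonlocal (ball 0 R) g r \<phi> x \<and> nonlocal (ball 0 R) g r \<phi> x \<le> hi * a hi"
  obtains u where "u \<in> L2_radial R" and "weak_solution (ball 0 R) (\<lambda>x. a (nonlocal (ball 0 R) g r u x)) f u"
    and "\<forall>x\<in>ball 0 R. lo \<le> nonlocal (ball 0 R) g r u x \<and> nonlocal (ball 0 R) g r u x \<le> hi"
proof -
  let ?B = "ball (0 :: real ^ 'n) R"
  let ?n = "DIM(real ^ 'n)"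
  have S: "?B \<in> sets lebesgue" and L: "?B \<in> lmeasurable" by auto
  obtain F where F: "radial_density R F" and F0: "\<forall>t. F t \<ge> 0" and fF: "AE x in lebesgue_on ?B. f x = F (norm x)"
    by (rule L2_radial_density[OF f f0 R])
  obtain G where G: "radial_density R G" and G0: "\<forall>t. G t \<ge> 0" and gG: "AE x in lebesgue_on ?B. g x = G (norm x)"
    by (rule L2_radial_density[OF g g0 R])
  have fL2: "f \<in> L2 ?B" and gL2: "g \<in> L2 ?B" using f g by (simp_all add: L2_radial_def)
  \<comment> \<open>A Borel radial representative; the nonlocal term sees g only up to null
    sets.\<close>
  define gr where "gr x = G (norm x)" for x :: "real ^ 'n"
  have grL2: "gr \<in> L2 ?B" unfolding gr_def[abs_def] by (rule L2_cong_AE[OF S gL2 gG])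
  have Gm: "G \<in> borel_measurable borel" by (rule radial_densityD(2)[OF G])
  define P where "P = flux ?n F"
  have P0: "P t \<ge> 0" if "t \<ge> 0" for t unfolding P_def using F0 that by (intro flux_nonneg) auto
  have Pc: "continuous_on {0..R} P"
    unfolding P_def by (rule continuous_on_subset[OF continuous_on_flux[OF F]]) auto
  obtain PM where PM_: "\<forall>t\<in>{0..R}. \<bar>P t\<bar> \<le> PM" by (rule continuous_on_Icc_bounded[OF Pc])
  note PM = PM_[rule_format]
  have PM0: "PM \<ge> 0" using PM[of 0] R abs_ge_zero[of "P 0"] by force
  define clip where "clip z = Orderings.max lo (Orderings.min hi z)" for z :: real
  have clip: "clip z \<in> {lo..hi}" for z using lohi by (auto simp: clip_def)
  define prof where "prof U x = U (norm x)" for U :: "real \<Rightarrow> real" and x :: "real ^ 'n"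
  \<comment> \<open>A unit vector; which axis it follows is immaterial, because by symmetry the
    nonlocal term is determined by its values along one ray.\<close>
  define e where "e = (axis undefined 1 :: real ^ 'n)"
  have ne: "norm e = 1" by (simp add: e_def)
  define nl where "nl U t = nonlocal ?B gr r (prof U) (t *\<^sub>R e)" for U t
  define \<alpha> where "\<alpha> U t = a (clip (nl U t))" for U t
  \<comment> \<open>A bound for the slope, flux over coefficient; integrated over a length of at
    most R it gives \<open>M\<close>.\<close>
  define L' where "L' = PM / a hi"
  define M where "M = L' * R"
  have L'0: "L' \<ge> 0" using PM0 ahi by (simp add: L'_def)
  have M0: "M \<ge> 0" using L'0 R by (simp add: M_def)
  define adm where "adm U \<longleftrightarrow> U \<in> borel_measurable borel \<and> (\<forall>t. 0 \<le> U t \<and> U t \<le> M)" for U :: "real \<Rightarrow> real"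
  have profL2: "prof U \<in> L2 ?B" if "adm U" for U
  proof (rule L2_bounded[OF L])
    have "prof U \<in> borel_measurable borel"
      unfolding prof_def[abs_def] using that by (intro measurable_compose[OF borel_measurable_norm]) (simp add: adm_def)
    then show "prof U \<in> borel_measurable (lebesgue_on ?B)"
      by (intro measurable_restrict_space1 measurable_completion) simp
    show "norm (prof U x) \<le> M" for x using that by (simp add: adm_def prof_def)
  qed
  have gU: "integrable (lebesgue_on ?B) (\<lambda>y. gr y * prof U y)" if "adm U" for U
    by (rule L2_mult_integrable[OF grL2 profL2[OF that]])
  have nl_cont: "continuous_on {0..R} (nl U)" if "adm U" for U
    unfolding nl_def
    by (rule continuous_on_compose2[OF continuous_on_nonlocal[OF S gU[OF that]]]) (auto intro!: continuous_intros)
  have \<alpha>_cont: "continuous_on {0..R} (\<alpha> U)" if "adm U" for U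
  proof -
    have "continuous_on {0..R} (\<lambda>t. clip (nl U t))"
      unfolding clip_def by (intro continuous_intros nl_cont[OF that])
    then show ?thesis unfolding \<alpha>_def by (rule continuous_on_compose2[OF a]) (use clip in auto)
  qed
  have \<alpha>_bounds: "a hi \<le> \<alpha> U t" "\<alpha> U t \<le> a lo" "\<alpha> U t > 0" for U t
    using max[OF clip] min[OF clip] ahi less_le_trans[OF ahi min[OF clip]] by (auto simp: \<alpha>_def)
  define W where "W U t = P t / \<alpha> U t" for U t
  define T where "T U t = integral {t..R} (W U)" for U t
  have W_cont: "continuous_on {0..R} (W U)" if "adm U" for U
    unfolding W_def P_def by (rule flux_quotient_continuous[OF F \<alpha>_cont[OF that] \<alpha>_bounds(3)])
  have W0: "W U t \<ge> 0" if "t \<ge> 0" for U t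
    unfolding W_def using P0[OF that] \<alpha>_bounds(3)[of U t] by simp
  have W_le: "\<bar>W U t\<bar> \<le> L'" if "t \<in> {0..R}" for U t
  proof -
    have "\<bar>W U t\<bar> = \<bar>P t\<bar> / \<alpha> U t" unfolding W_def using \<alpha>_bounds(3)[of U t] by simp
    also have "\<dots> \<le> PM / a hi" by (rule frac_le[OF PM0 PM[OF that] ahi \<alpha>_bounds(1)])
    finally show ?thesis by (simp add: L'_def)
  qed
  have lip: "\<bar>T U s - T U t\<bar> \<le> L' * \<bar>s - t\<bar>" if "adm U" "s \<in> {0..R}" "t \<in> {0..R}" for U s t
    unfolding T_def by (rule integral_upper_part_lipschitz[OF W_cont[OF that(1)] W_le that(2,3)])
  have TR: "T U R = 0" for U by (simp add: T_def)
  have T_range: "0 \<le> T U t \<and> T U t \<le> M" if U: "adm U" and t: "t \<in> {0..R}" for U t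
  proof
    have "W U integrable_on {t..R}"
      by (rule integrable_continuous_real[OF continuous_on_subset[OF W_cont[OF U]]]) (use t in auto)
    then show "0 \<le> T U t" unfolding T_def by (rule integral_nonneg) (use t W0 in auto)
    have "T U t \<le> L' * \<bar>t - R\<bar>" using lip[OF U t, of R] R by (simp add: TR)
    also have "\<dots> \<le> M" unfolding M_def using t L'0 by (intro mult_left_mono) auto
    finally show "T U t \<le> M" .
  qed
  have T_cont: "\<exists>d>0. \<forall>U V. adm U \<longrightarrow> adm V \<longrightarrow> (\<forall>t\<in>{0..R}. \<bar>U t - V t\<bar> \<le> d) \<longrightarrow> (\<forall>t\<in>{0..R}. \<bar>T U t - T V t\<bar> \<le> \<epsilon>)"
    if \<epsilon>: "\<epsilon> > 0" for \<epsilon>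
  proof -
    \<comment> \<open>The profile enters T only through the reciprocal coefficient. The summands 1
      below keep the denominators positive.\<close>
    have "uniformly_continuous_on {lo..hi} (\<lambda>z. 1 / a z)"
    proof (rule compact_uniformly_continuous)
      show "continuous_on {lo..hi} (\<lambda>z. 1 / a z)"
        using a min ahi by (intro continuous_intros) force+
    qed simp
    moreover have "\<epsilon> / (PM * R + 1) > 0" using \<epsilon> PM0 R by (simp add: add_nonneg_pos)
    ultimately obtain \<eta> where \<eta>: "\<eta> > 0" "\<And>z z'. z \<in> {lo..hi} \<Longrightarrow> z' \<in> {lo..hi} \<Longrightarrow> dist z' z < \<eta>
        \<Longrightarrow> dist (1 / a z') (1 / a z) < \<epsilon> / (PM * R + 1)"
      unfolding uniformly_continuous_on_def by blast
    \<comment> \<open>The L1 norm of g, a Lipschitz constant of the nonlocal term for the uniform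
      norm of profiles.\<close>
    define I where "I = (LINT y|lebesgue_on ?B. \<bar>gr y\<bar>)"
    have I0: "I \<ge> 0" unfolding I_def by (rule integral_nonneg_AE) simp
    have gri: "integrable (lebesgue_on ?B) (\<lambda>y. \<bar>gr y\<bar>)"
      by (rule integrable_abs[OF L2_integrable[OF grL2 L]])
    show ?thesis
    proof (intro exI[of _ "\<eta> / (I + 1)"] conjI allI impI ballI)
      show d0: "\<eta> / (I + 1) > 0" using \<eta>(1) I0 by simp
      fix U V t assume U: "adm U" and V: "adm V" and d: "\<forall>t\<in>{0..R}. \<bar>U t - V t\<bar> \<le> \<eta> / (I + 1)" and t: "t \<in> {0..R}"
      have nld: "\<bar>nl U s - nl V s\<bar> < \<eta>" for s
      proof -
        have di: "integrable (lebesgue_on ?B) (\<lambda>y. gr y * (prof U y - prof V y))"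
          by (rule L2_mult_integrable[OF grL2 L2_diff[OF profL2[OF U] profL2[OF V]]])
        have "\<bar>nl U s - nl V s\<bar> \<le> (LINT y|lebesgue_on ?B. \<bar>gr y * (prof U y - prof V y)\<bar>)"
          unfolding nl_def nonlocal_diff[OF S gU[OF U] gU[OF V]] by (rule nonlocal_abs_le[OF S di])
        also have "\<dots> \<le> (LINT y|lebesgue_on ?B. \<eta> / (I + 1) * \<bar>gr y\<bar>)"
        proof (rule integral_mono[OF integrable_abs[OF di] integrable_mult_right[OF gri]])
          fix y assume "y \<in> space (lebesgue_on ?B)"
          then have "norm y \<in> {0..R}" by simp
          then have "\<bar>prof U y - prof V y\<bar> \<le> \<eta> / (I + 1)" using d unfolding prof_def by blast
          then have "\<bar>gr y\<bar> * \<bar>prof U y - prof V y\<bar> \<le> \<bar>gr y\<bar> * (\<eta> / (I + 1))" by (rule mult_left_mono) simp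
          then show "\<bar>gr y * (prof U y - prof V y)\<bar> \<le> \<eta> / (I + 1) * \<bar>gr y\<bar>"
            unfolding abs_mult by (simp only: mult.commute)
        qed
        also have "\<dots> = \<eta> / (I + 1) * I" by (simp add: I_def)
        also have "\<dots> < \<eta> / (I + 1) * (I + 1)" using d0 by (intro mult_strict_left_mono) auto
        also have "\<dots> = \<eta>" using I0 by simp
        finally show ?thesis .
      qed
      have Wd: "\<bar>W U s - W V s\<bar> \<le> PM * (\<epsilon> / (PM * R + 1))" if s: "s \<in> {0..R}" for s
      proof -
        have "dist (clip (nl U s)) (clip (nl V s)) < \<eta>"
          using le_less_trans[OF abs_clip_diff_le nld] by (simp add: dist_real_def clip_def)
        from \<eta>(2)[OF clip clip this] have "\<bar>1 / \<alpha> U s - 1 / \<alpha> V s\<bar> \<le> \<epsilon> / (PM * R + 1)"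
          by (simp add: dist_real_def \<alpha>_def)
        then have "\<bar>P s\<bar> * \<bar>1 / \<alpha> U s - 1 / \<alpha> V s\<bar> \<le> PM * (\<epsilon> / (PM * R + 1))"
          using PM[OF s] PM0 by (intro mult_mono) auto
        then show ?thesis unfolding W_def abs_mult[symmetric] by (simp add: right_diff_distrib)
      qed
      have "W U integrable_on {t..R}" "W V integrable_on {t..R}"
        using t by (auto intro!: integrable_continuous_real continuous_on_subset[OF W_cont] U V)
      then have "T U t - T V t = integral {t..R} (\<lambda>s. W U s - W V s)"
        unfolding T_def by (rule Henstock_Kurzweil_Integration.integral_diff[symmetric])
      moreover have "norm (integral {t..R} (\<lambda>s. W U s - W V s)) \<le> PM * (\<epsilon> / (PM * R + 1)) * (R - t)"
      proof (rule integral_bound)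
        show "continuous_on {t..R} (\<lambda>s. W U s - W V s)"
          using t by (intro continuous_intros continuous_on_subset[OF W_cont] U V) auto
        show "norm (W U s - W V s) \<le> PM * (\<epsilon> / (PM * R + 1))" if "s \<in> {t..R}" for s
          unfolding real_norm_def by (rule Wd) (use that t in auto)
      qed (use t in auto)
      ultimately have "\<bar>T U t - T V t\<bar> \<le> PM * (\<epsilon> / (PM * R + 1)) * (R - t)" by simp
      also have "\<dots> \<le> PM * (\<epsilon> / (PM * R + 1)) * R"
        using t PM0 \<open>\<epsilon> / (PM * R + 1) > 0\<close> by (intro mult_left_mono mult_nonneg_nonneg) auto
      also have "\<dots> = (PM * R) * (\<epsilon> / (PM * R + 1))" by simp
      also have "\<dots> \<le> (PM * R + 1) * (\<epsilon> / (PM * R + 1))"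
        using \<open>\<epsilon> / (PM * R + 1) > 0\<close> by (intro mult_right_mono) auto
      also have "\<dots> = \<epsilon>"
      proof -
        have "PM * R \<ge> 0" using PM0 R by simp
        then have "PM * R + 1 \<noteq> 0" by linarith
        then show ?thesis by simp
      qed
      finally show "\<bar>T U t - T V t\<bar> \<le> \<epsilon>" .
    qed
  qed
  obtain U where Um: "U \<in> borel_measurable borel" and Ur: "\<forall>t. 0 \<le> U t \<and> U t \<le> M" and fix_: "\<forall>t\<in>{0..R}. T U t = U t"
  proof (rule fixed_point_equi_Lipschitz[OF R M0 L'0, of T])
    fix V :: "real \<Rightarrow> real" and s t :: real assume V: "V \<in> borel_measurable borel" "\<And>t. 0 \<le> V t \<and> V t \<le> M"
    then have "adm V" by (simp add: adm_def)
    then show "t \<in> {0..R} \<Longrightarrow> 0 \<le> T V t \<and> T V t \<le> M"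
      and "s \<in> {0..R} \<Longrightarrow> t \<in> {0..R} \<Longrightarrow> \<bar>T V s - T V t\<bar> \<le> L' * \<bar>s - t\<bar>"
      using T_range lip by blast+
  next
    fix \<epsilon> :: real assume "\<epsilon> > 0"
    from T_cont[OF this] show "\<exists>d>0. \<forall>U V. U \<in> borel_measurable borel \<longrightarrow> V \<in> borel_measurable borel \<longrightarrow>
      (\<forall>t. 0 \<le> U t \<and> U t \<le> M) \<longrightarrow> (\<forall>t. 0 \<le> V t \<and> V t \<le> M) \<longrightarrow> (\<forall>t\<in>{0..R}. \<bar>U t - V t\<bar> \<le> d) \<longrightarrow>
      (\<forall>t\<in>{0..R}. \<bar>T U t - T V t\<bar> \<le> \<epsilon>)"
      unfolding adm_def by blast
  qed (rule that)
  have U: "adm U" using Um Ur by (simp add: adm_def)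
  define u where "u x = integral {norm x..R} (W U)" for x :: "real ^ 'n"
  have uU: "u x = prof U x" if "x \<in> ?B" for x
    using fix_ that by (simp add: u_def prof_def T_def)
  have u_rad: "u \<in> L2_radial R"
    unfolding u_def[abs_def] by (rule L2_radial_continuous[OF R continuous_on_radial_potential[OF W_cont[OF U]]])
  then have uL2: "u \<in> L2 ?B" by (simp add: L2_radial_def)
  have gu: "integrable (lebesgue_on ?B) (\<lambda>y. g y * u y)" by (rule L2_mult_integrable[OF gL2 uL2])
  have nl_u: "nonlocal ?B g r u x = nonlocal ?B gr r (prof U) x" for x
  proof (rule nonlocal_cong_AE[OF S gu])
    have "AE y in lebesgue_on ?B. y \<in> ?B" by (intro AE_I2) simp
    then show "AE y in lebesgue_on ?B. g y * u y = gr y * prof U y"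
      using gG by eventually_elim (simp add: gr_def uU)
  qed
  have nl_radial: "nonlocal ?B g r u x = nl U (norm x)" for x
    unfolding nl_u nl_def gr_def[abs_def] prof_def[abs_def]
    by (rule nonlocal_radial[OF _ Gm Um]) (simp add: ne)
  \<comment> \<open>The explicit solution with coefficient 1; agreeing with \<open>\<phi>\<close>
    almost everywhere is enough under the integral.\<close>
  define \<Phi> where "\<Phi> x = integral {norm x..R} P" for x :: "real ^ 'n"
  have "weak_solution ?B (\<lambda>x. 1) f \<Phi>"
    using weak_solution_radial[OF R F fL2 fF, of "\<lambda>t. 1" "\<lambda>x. 1"] by (simp add: \<Phi>_def[abs_def] P_def)
  from weak_solution_unique[OF \<phi> this] have \<phi>\<Phi>: "AE x in lebesgue_on ?B. \<phi> x = \<Phi> x" .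
  have \<Phi>L2: "\<Phi> \<in> L2 ?B"
    using L2_radial_continuous[OF R continuous_on_radial_potential[OF Pc], where 'a="real ^ 'n"]
    unfolding \<Phi>_def[abs_def] L2_radial_def by blast
  have g\<Phi>: "integrable (lebesgue_on ?B) (\<lambda>y. g y * \<Phi> y)" by (rule L2_mult_integrable[OF gL2 \<Phi>L2])
  have nl\<Phi>: "nonlocal ?B g r \<Phi> x = nonlocal ?B g r \<phi> x" for x
    by (rule nonlocal_cong_AE[OF S g\<Phi>]) (use \<phi>\<Phi> in eventually_elim, simp)
  have alo: "a lo > 0" using ahi max[of hi] lohi by simp
  \<comment> \<open>The flux is nonnegative, so the two bounds on the coefficient order the
    integrands pointwise.\<close>
  have compare: "\<Phi> x / a lo \<le> u x" "u x \<le> \<Phi> x / a hi" if x: "x \<in> ?B" for x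
  proof -
    have sub: "{norm x..R} \<subseteq> {0..R}" by auto
    have i: "W U integrable_on {norm x..R}" "(\<lambda>t. P t / c) integrable_on {norm x..R}" for c
      using continuous_on_subset[OF W_cont[OF U] sub] continuous_on_subset[OF Pc sub]
      by (auto intro!: integrable_continuous_real integrable_on_divide)
    have e: "\<Phi> x / c = integral {norm x..R} (\<lambda>t. P t / c)" for c
      unfolding \<Phi>_def by (simp add: integral_divide)
    have le: "P t / a lo \<le> W U t" "W U t \<le> P t / a hi" if "t \<in> {norm x..R}" for t
    proof -
      have "P t \<ge> 0" using P0 that order_trans[OF norm_ge_zero] by auto
      then show "P t / a lo \<le> W U t" "W U t \<le> P t / a hi"
        unfolding W_def using \<alpha>_bounds[of U t] ahi by (auto intro!: divide_left_mono)
    qed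
    show "\<Phi> x / a lo \<le> u x" unfolding e u_def by (rule integral_le[OF i(2,1) le(1)])
    show "u x \<le> \<Phi> x / a hi" unfolding e u_def by (rule integral_le[OF i(1,2) le(2)])
  qed
  have inB: "AE y in lebesgue_on ?B. y \<in> ?B" by (intro AE_I2) simp
  have gdiv: "integrable (lebesgue_on ?B) (\<lambda>y. g y * (\<Phi> y / c))" for c
    using g\<Phi> by simp
  have bounds: "lo \<le> nonlocal ?B g r u x" "nonlocal ?B g r u x \<le> hi" if x: "x \<in> ?B" for x
  proof -
    have "lo * a lo / a lo \<le> nonlocal ?B g r \<phi> x / a lo"
      using range[OF x] alo by (intro divide_right_mono) auto
    also have "\<dots> = nonlocal ?B g r (\<lambda>y. \<Phi> y / a lo) x" by (simp only: nonlocal_divide nl\<Phi>)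
    also have "\<dots> \<le> nonlocal ?B g r u x"
      by (rule nonlocal_mono[OF S gdiv gu])
        (use g0 inB in \<open>eventually_elim, intro mult_left_mono compare\<close>)
    finally show "lo \<le> nonlocal ?B g r u x" using alo by simp
    have "nonlocal ?B g r u x \<le> nonlocal ?B g r (\<lambda>y. \<Phi> y / a hi) x"
      by (rule nonlocal_mono[OF S gu gdiv])
        (use g0 inB in \<open>eventually_elim, intro mult_left_mono compare\<close>)
    also have "\<dots> = nonlocal ?B g r \<phi> x / a hi" by (simp only: nonlocal_divide nl\<Phi>)
    also have "\<dots> \<le> hi * a hi / a hi" using range[OF x] ahi by (intro divide_right_mono) auto
    finally show "nonlocal ?B g r u x \<le> hi" using ahi by simp
  qed
  have "weak_solution ?B (\<lambda>x. a (nonlocal ?B g r u x)) f (\<lambda>x. integral {norm x..R} (\<lambda>t. flux ?n F t / \<alpha> U t))"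
  proof (rule weak_solution_radial[OF R F fL2 fF \<alpha>_cont[OF U] \<alpha>_bounds(3)])
    fix x assume x: "x \<in> ?B"
    have "clip (nonlocal ?B g r u x) = nonlocal ?B g r u x"
      using bounds[OF x] by (simp add: clip_def)
    then show "a (nonlocal ?B g r u x) = \<alpha> U (norm x)" by (simp add: \<alpha>_def nl_radial)
  qed
  then have "weak_solution ?B (\<lambda>x. a (nonlocal ?B g r u x)) f u"
    by (simp only: u_def[abs_def] W_def[abs_def] P_def)
  then show ?thesis using that[OF u_rad] bounds by blast
qed

section \<open>Assembling the family of solutions\<close>

text \<open>The set where the bound fails is open, and a nonempty open set is not null.\<close>

lemma continuous_AE_bounded:
  fixes a :: "real \<Rightarrow> real"
  assumes "continuous_on UNIV a" and "AE t in lebesgue. \<bar>a t\<bar> \<le> C"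
  shows "\<bar>a t\<bar> \<le> C"
proof (rule ccontr)
  assume t: "\<not> \<bar>a t\<bar> \<le> C"
  have o: "open {t. C < \<bar>a t\<bar>}" by (intro open_Collect_less continuous_intros assms(1))
  have "AE t in lebesgue. t \<notin> {t. C < \<bar>a t\<bar>}" using assms(2) by eventually_elim auto
  then have "{t. C < \<bar>a t\<bar>} \<in> null_sets lebesgue"
    using o by (subst AE_iff_null_sets) auto
  then have "negligible {t. C < \<bar>a t\<bar>}" by (simp add: negligible_iff_null_sets)
  moreover have "t \<in> {t. C < \<bar>a t\<bar>}" using t by simp
  ultimately show False using open_not_negligible[OF o] by blast
qed

text \<open>The count is expressed by a family over the even indices up to n1 - 1, of which there
  are (n1 + 1)/2, with members that pairwise differ modulo null sets.\<close>

theorem proposition3p4: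
  fixes d r :: real
    and \<Omega> :: "(real ^ 'n) set"
    and f g \<phi> :: "real ^ 'n \<Rightarrow> real"
    and a :: "real \<Rightarrow> real"
    and n1 :: nat
    and m :: "nat \<Rightarrow> real"
  assumes "d > 0" and "\<Omega> = ball 0 (d / 2)" and "0 \<le> r" and "r \<le> d"
    and "f \<in> L2_radial (d / 2)" and "g \<in> L2_radial (d / 2)"
    and "AE x in lebesgue_on \<Omega>. f x \<ge> 0" and "AE x in lebesgue_on \<Omega>. g x \<ge> 0"
    and "a \<in> W1infty UNIV" and "continuous_on UNIV a" and "(INF t. a t) > 0"
    and "weak_solution \<Omega> (\<lambda>x. 1) f \<phi>"
    and "odd n1" and "n1 \<ge> 1"
    and "\<forall>i\<le>n1. m i \<ge> 0" and "m 0 = 0" and "\<forall>i<n1. m i < m (i + 1)"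
    and "\<forall>i\<in>{i. even i \<and> i \<le> n1 - 1}.
           (\<forall>t\<in>{m i..m (i + 1)}. a t \<le> a (m i)) \<and>
           (\<forall>t\<in>{m i..m (i + 1)}. a (m (i + 1)) \<le> a t)"
    and "nonlocal_range \<Omega> g r \<phi> \<subseteq>
           (\<Inter>i\<in>{i. even i \<and> i \<le> n1 - 1}. {m i * a (m i)..m (i + 1) * a (m (i + 1))})"
  shows "\<exists>u :: nat \<Rightarrow> real ^ 'n \<Rightarrow> real.
           (\<forall>i\<in>{i. even i \<and> i \<le> n1 - 1}.
              u i \<in> L2_radial (d / 2) \<and>
              weak_solution \<Omega> (\<lambda>x. a (nonlocal \<Omega> g r (u i) x)) f (u i) \<and>
              (AE x in lebesgue_on \<Omega>. m i \<le> nonlocal \<Omega> g r (u i) x \<and>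
                                      nonlocal \<Omega> g r (u i) x \<le> m (i + 1))) \<and>
           (\<forall>i\<in>{i. even i \<and> i \<le> n1 - 1}. \<forall>j\<in>{i. even i \<and> i \<le> n1 - 1}.
              i \<noteq> j \<longrightarrow> \<not> (AE x in lebesgue_on \<Omega>. u i x = u j x))"
proof -
  define R where "R = d / 2"
  define E where "E = {i. even i \<and> i \<le> n1 - 1}"
  have R: "R > 0" using \<open>d > 0\<close> by (simp add: R_def)
  have \<Omega>: "\<Omega> = ball 0 R" using assms(2) by (simp add: R_def)
  have S: "\<Omega> \<in> sets lebesgue" by (simp add: \<Omega>)
  have gL2: "g \<in> L2 \<Omega>" using assms(6) by (simp add: L2_radial_def \<Omega> R_def)
  have "\<phi> \<in> H10 \<Omega>" using assms(12) by (simp add: weak_solution_def)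
  then have "\<phi> \<in> L2 \<Omega>" by (simp add: H10_def)
  note g\<phi> = L2_mult_integrable[OF gL2 this]
  have Suc: "i + 1 \<le> n1" if "i \<in> E" for i using that \<open>n1 \<ge> 1\<close> by (auto simp: E_def)
  \<comment> \<open>On the reals INF bounds a set from below only if the set is bounded below; this
    is drawn from the essential bound on \<open>a\<close> and its continuity.\<close>
  have apos: "a t > 0" for t
  proof -
    obtain C where "AE t in lebesgue_on UNIV. norm (a t) \<le> C"
      using assms(9) unfolding W1infty_def Linfty_def by blast
    then have "AE t in lebesgue. \<bar>a t\<bar> \<le> C" by (simp only: lebesgue_on_UNIV_eq real_norm_def)
    then have "\<bar>a t\<bar> \<le> C" for t by (rule continuous_AE_bounded[OF assms(10)])
    then have "bdd_below (range a)" by (intro bdd_belowI2[of _ "- C"]) (simp add: abs_le_iff minus_le_iff)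
    then have "(INF t. a t) \<le> a t" by (rule cINF_lower) simp
    then show ?thesis using assms(11) by linarith
  qed
  have range: "m i * a (m i) \<le> nonlocal \<Omega> g r \<phi> x \<and> nonlocal \<Omega> g r \<phi> x \<le> m (i + 1) * a (m (i + 1))"
    if i: "i \<in> E" and x: "x \<in> \<Omega>" for i x
  proof -
    define K where "K = (LINT y|lebesgue_on \<Omega>. \<bar>g y * \<phi> y\<bar>)"
    have K: "\<bar>nonlocal \<Omega> g r \<phi> x\<bar> \<le> K" for x unfolding K_def by (rule nonlocal_abs_le[OF S g\<phi>])
    \<comment> \<open>Boundedness makes the infimum and supremum in \<open>nonlocal_range\<close>
      genuine bounds.\<close>
    have "bdd_below (nonlocal \<Omega> g r \<phi> ` \<Omega>)"
      by (intro bdd_belowI2[of _ "- K"]) (use K in \<open>simp add: abs_le_iff minus_le_iff\<close>)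
    moreover have "bdd_above (nonlocal \<Omega> g r \<phi> ` \<Omega>)"
      by (intro bdd_aboveI2[of _ _ K]) (use K in \<open>simp add: abs_le_iff\<close>)
    ultimately have "nonlocal \<Omega> g r \<phi> x \<in> nonlocal_range \<Omega> g r \<phi>"
      unfolding nonlocal_range_def using x by (auto intro: cINF_lower cSUP_upper)
    then have "nonlocal \<Omega> g r \<phi> x \<in> (\<Inter>i\<in>E. {m i * a (m i)..m (i + 1) * a (m (i + 1))})"
      using assms(19) unfolding E_def by blast
    then show ?thesis using i by auto
  qed
  have "\<exists>u. u \<in> L2_radial R \<and> weak_solution \<Omega> (\<lambda>x. a (nonlocal \<Omega> g r u x)) f u \<and>
      (\<forall>x\<in>\<Omega>. m i \<le> nonlocal \<Omega> g r u x \<and> nonlocal \<Omega> g r u x \<le> m (i + 1))" if i: "i \<in> E" for i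
  proof -
    have "m i \<le> m (i + 1)" using assms(17) Suc[OF i] by (simp add: less_imp_le)
    moreover have "\<forall>t\<in>{m i..m (i + 1)}. a t \<le> a (m i)" "\<forall>t\<in>{m i..m (i + 1)}. a (m (i + 1)) \<le> a t"
      using assms(18) i unfolding E_def by blast+
    moreover have "continuous_on {m i..m (i + 1)} a" by (rule continuous_on_subset[OF assms(10)]) simp
    ultimately obtain u where "u \<in> L2_radial R" "weak_solution \<Omega> (\<lambda>x. a (nonlocal \<Omega> g r u x)) f u"
      "\<forall>x\<in>\<Omega>. m i \<le> nonlocal \<Omega> g r u x \<and> nonlocal \<Omega> g r u x \<le> m (i + 1)"
      using exists_radial_solution[OF R assms(5,6,7,8)[unfolded \<Omega> R_def[symmetric]] _ _ apos _ _ assms(12)[unfolded \<Omega>]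
          range[OF i, unfolded \<Omega>], folded \<Omega>] by blast
    then show ?thesis by blast
  qed
  then obtain u where u: "\<And>i. i \<in> E \<Longrightarrow> u i \<in> L2_radial R"
    "\<And>i. i \<in> E \<Longrightarrow> weak_solution \<Omega> (\<lambda>x. a (nonlocal \<Omega> g r (u i) x)) f (u i)"
    "\<And>i x. i \<in> E \<Longrightarrow> x \<in> \<Omega> \<Longrightarrow> m i \<le> nonlocal \<Omega> g r (u i) x \<and> nonlocal \<Omega> g r (u i) x \<le> m (i + 1)"
    by metis
  have distinct: "\<not> (AE x in lebesgue_on \<Omega>. u i x = u j x)" if ij: "i \<in> E" "j \<in> E" "i < j" for i j
  proof
    assume ae: "AE x in lebesgue_on \<Omega>. u i x = u j x"
    have "u i \<in> L2 \<Omega>" using u(1)[OF ij(1)] by (simp add: L2_radial_def \<Omega>)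
    from nonlocal_cong_AE[OF S L2_mult_integrable[OF gL2 this], of g "u j"] ae
    \<comment> \<open>The nonlocal term is an integral, so functions equal almost everywhere give
      the same value at the centre.\<close>
    have eq: "nonlocal \<Omega> g r (u i) 0 = nonlocal \<Omega> g r (u j) 0" by (simp add: eventually_mono)
    \<comment> \<open>Both indices are even, so a gap remains between the two intervals and they are
      disjoint.\<close>
    have "i + 1 < j" using ij by (auto simp: E_def elim!: evenE)
    moreover have "m k < m l" if "k < l" "l \<le> n1" for k l
      using that
    proof (induction l)
      case (Suc l)
      have "m l < m (Suc l)" using assms(17) Suc.prems(2) by simp
      moreover have "m k \<le> m l" using Suc by (cases "k = l") (auto simp: less_imp_le)
      ultimately show ?case by simp
    qed simp
    ultimately have "m (i + 1) < m j" using Suc[OF ij(2)] by simp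
    moreover have "0 \<in> \<Omega>" using R by (simp add: \<Omega>)
    ultimately show False using u(3)[OF ij(1), of 0] u(3)[OF ij(2), of 0] eq by simp
  qed
  show ?thesis
  proof (intro exI[of _ u] conjI ballI impI, fold E_def R_def)
    fix i assume i: "i \<in> E"
    show "u i \<in> L2_radial R" "weak_solution \<Omega> (\<lambda>x. a (nonlocal \<Omega> g r (u i) x)) f (u i)"
      by (rule u(1)[OF i], rule u(2)[OF i])
    show "AE x in lebesgue_on \<Omega>. m i \<le> nonlocal \<Omega> g r (u i) x \<and> nonlocal \<Omega> g r (u i) x \<le> m (i + 1)"
      by (intro AE_I2) (use u(3)[OF i] in simp)
  next
    fix i j assume ij: "i \<in> E" "j \<in> E" "i \<noteq> j"
    then consider "i < j" | "j < i" by linarith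
    then show "\<not> (AE x in lebesgue_on \<Omega>. u i x = u j x)"
    proof cases
      case 1
      then show ?thesis by (rule distinct[OF ij(1,2)])
    next
      case 2
      from distinct[OF ij(2,1) this] show ?thesis by (simp add: eq_commute)
    qed
  qed
qed

end
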